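(* Let $k$ be a field of characteristic zero, let $a\in k[h]$ be a non-constant polynomial, let $h_0\in k\setminus\{0\}$ and let $\sigma$ be the $k$-algebra automorphism of $k[h]$ with $\sigma(h)=h-h_0$. Let $A=A(k[h],a,\sigma)$ be the generalized Weyl algebra, put $n=\deg a$ and $d=\deg(a;a')$, where $a'$ is the formal derivative of $a$ and $(a;a')$ is the (monic) greatest common divisor of $a$ and $a'$. Then for the Hochschild cohomology $H\!H^*(A)=\operatorname{Ext}_{A\otimes A^{op}}^*(A,A)$: \begin{itemize} \item if $(a;a')=1$ (i.e. $d=0$), then $\dim_k H\!H^0(A)=1$, $\dim_k H\!H^2(A)=n-1$, and $H\!H^i(A)=0$ for $i\neq 0,2$; \item if $d\geq 1$, then $\dim_k H\!H^0(A)=1$, $\dim_k H\!H^1(A)=0$, $\dim_k H\!H^2(A)=n-1$, and $\dim_k H\!H^i(A)=d$ for all $i\geq 3$. \end{itemize}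
   Context: For a $k$-algebra $R$, a central element $a\in R$ and $\sigma\in\mathrm{Aut}_k(R)$, the generalized Weyl algebra $A(R,a,\sigma)$ is the $k$-algebra generated by $R$ and two new variables $x,y$ subject to the relations $yx=a$, $xy=\sigma(a)$, $xr=\sigma(r)x$ and $ry=y\sigma(r)$ for all $r\in R$. Here $R=k[h]$. *)

theory Defs
  imports "HOL-Computational_Algebra.Polynomial" "HOL-Computational_Algebra.Polynomial_Factorial"
begin

record ('a, 'k) kalg =
  kcar :: "'a set"
  kadd :: "'a \<Rightarrow> 'a \<Rightarrow> 'a"
  kmul :: "'a \<Rightarrow> 'a \<Rightarrow> 'a"
  kzero :: "'a"
  ksm :: "'k \<Rightarrow> 'a \<Rightarrow> 'a"

definition ksum :: "('a, 'k) kalg \<Rightarrow> 'a list \<Rightarrow> 'a" where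
  "ksum A l = foldr (kadd A) l (kzero A)"

text \<open>Hochschild n-cochains: k-multilinear maps A^n -> A, represented as functions on
  lists of length n (extended by zero outside A^n).\<close>
definition is_cochain :: "('a, 'k) kalg \<Rightarrow> nat \<Rightarrow> ('a list \<Rightarrow> 'a) \<Rightarrow> bool" where
  "is_cochain A n f \<longleftrightarrow>
     (\<forall>xs. length xs = n \<and> set xs \<subseteq> kcar A \<longrightarrow> f xs \<in> kcar A) \<and>
     (\<forall>xs. \<not> (length xs = n \<and> set xs \<subseteq> kcar A) \<longrightarrow> f xs = kzero A) \<and>
     (\<forall>us vs u v c. length us + length vs + 1 = n \<and> set us \<subseteq> kcar A \<and> set vs \<subseteq> kcar A
        \<and> u \<in> kcar A \<and> v \<in> kcar A \<longrightarrow>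
        f (us @ kadd A u v # vs) = kadd A (f (us @ u # vs)) (f (us @ v # vs)) \<and>
        f (us @ ksm A c u # vs) = ksm A c (f (us @ u # vs)))"

definition hdiff :: "('a, 'k::ring_1) kalg \<Rightarrow> nat \<Rightarrow> ('a list \<Rightarrow> 'a) \<Rightarrow> ('a list \<Rightarrow> 'a)" where
  "hdiff A n f xs =
     (if length xs = n + 1 \<and> set xs \<subseteq> kcar A then
        ksum A ([kmul A (hd xs) (f (tl xs))] @
                map (\<lambda>j. ksm A ((-1) ^ (j + 1))
                         (f (take j xs @ kmul A (xs ! j) (xs ! (j + 1)) # drop (j + 2) xs))) [0..<n] @
                [ksm A ((-1) ^ (n + 1)) (kmul A (f (take n xs)) (xs ! n))])
      else kzero A)"

definition hcocycles :: "('a, 'k::ring_1) kalg \<Rightarrow> nat \<Rightarrow> ('a list \<Rightarrow> 'a) set" where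
  "hcocycles A n = {f. is_cochain A n f \<and> hdiff A n f = (\<lambda>_. kzero A)}"

definition hcoboundaries :: "('a, 'k::ring_1) kalg \<Rightarrow> nat \<Rightarrow> ('a list \<Rightarrow> 'a) set" where
  "hcoboundaries A n =
     (if n = 0 then {\<lambda>_. kzero A} else hdiff A (n - 1) ` {g. is_cochain A (n - 1) g})"

definition fnadd :: "('a, 'k) kalg \<Rightarrow> ('b \<Rightarrow> 'a) \<Rightarrow> ('b \<Rightarrow> 'a) \<Rightarrow> ('b \<Rightarrow> 'a)" where
  "fnadd A f g = (\<lambda>xs. kadd A (f xs) (g xs))"

definition fnsm :: "('a, 'k) kalg \<Rightarrow> 'k \<Rightarrow> ('b \<Rightarrow> 'a) \<Rightarrow> ('b \<Rightarrow> 'a)" where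
  "fnsm A c f = (\<lambda>xs. ksm A c (f xs))"

definition lincomb :: "('a, 'k) kalg \<Rightarrow> 'k list \<Rightarrow> ('b \<Rightarrow> 'a) list \<Rightarrow> ('b \<Rightarrow> 'a)" where
  "lincomb A cs fs = foldr (fnadd A) (map2 (fnsm A) cs fs) (\<lambda>_. kzero A)"

text \<open>dim_k HH^n(A) = m : the quotient space Z^n / B^n has a basis of m elements.\<close>
definition hh_dim :: "('a, 'k::ring_1) kalg \<Rightarrow> nat \<Rightarrow> nat \<Rightarrow> bool" where
  "hh_dim A n m \<longleftrightarrow>
     (\<exists>bs. length bs = m \<and> set bs \<subseteq> hcocycles A n \<and>
        (\<forall>cs. length cs = m \<and> lincomb A cs bs \<in> hcoboundaries A n \<longrightarrow> (\<forall>c\<in>set cs. c = 0)) \<and>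
        (\<forall>f\<in>hcocycles A n. \<exists>cs b. length cs = m \<and> b \<in> hcoboundaries A n \<and>
              f = fnadd A (lincomb A cs bs) b))"

datatype gen = Gh | Gx | Gy

type_synonym 'k fa = "gen list \<Rightarrow> 'k"

definition Fset :: "'k::zero fa set" where
  "Fset = {f. finite {w. f w \<noteq> 0}}"

definition fadd :: "'k::plus fa \<Rightarrow> 'k fa \<Rightarrow> 'k fa" where
  "fadd f g = (\<lambda>w. f w + g w)"

definition fsub :: "'k::minus fa \<Rightarrow> 'k fa \<Rightarrow> 'k fa" where
  "fsub f g = (\<lambda>w. f w - g w)"

definition fzero :: "'k::zero fa" where
  "fzero = (\<lambda>w. 0)"

definition fone :: "'k::{zero,one} fa" where
  "fone = (\<lambda>w. if w = [] then 1 else 0)"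

definition fsm :: "'k::times \<Rightarrow> 'k fa \<Rightarrow> 'k fa" where
  "fsm c f = (\<lambda>w. c * f w)"

text \<open>Multiplication: concatenation of words, extended bilinearly.\<close>
definition fmul :: "'k::comm_semiring_1 fa \<Rightarrow> 'k fa \<Rightarrow> 'k fa" where
  "fmul f g = (\<lambda>w. \<Sum>i\<le>length w. f (take i w) * g (drop i w))"

definition fpoly :: "'k::comm_semiring_1 poly \<Rightarrow> 'k fa" where
  "fpoly p = (\<lambda>w. if set w \<subseteq> {Gh} then coeff p (length w) else 0)"

definition fgen :: "gen \<Rightarrow> 'k::{zero,one} fa" where
  "fgen g = (\<lambda>w. if w = [g] then 1 else 0)"

inductive_set fideal :: "'k::comm_semiring_1 fa set \<Rightarrow> 'k fa set" for S where
  gen: "s \<in> S \<Longrightarrow> s \<in> fideal S"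
| zero: "fzero \<in> fideal S"
| add: "p \<in> fideal S \<Longrightarrow> q \<in> fideal S \<Longrightarrow> fadd p q \<in> fideal S"
| lmul: "p \<in> fideal S \<Longrightarrow> u \<in> Fset \<Longrightarrow> fmul u p \<in> fideal S"
| rmul: "p \<in> fideal S \<Longrightarrow> u \<in> Fset \<Longrightarrow> fmul p u \<in> fideal S"

definition shift_aut :: "'k::comm_ring_1 \<Rightarrow> 'k poly \<Rightarrow> 'k poly" where
  "shift_aut h0 p = pcompose p [:- h0, 1:]"

definition gwa_rels :: "'k::comm_ring_1 poly \<Rightarrow> ('k poly \<Rightarrow> 'k poly) \<Rightarrow> 'k fa set" where
  "gwa_rels a \<sigma> =
     {fsub (fmul (fgen Gy) (fgen Gx)) (fpoly a),
      fsub (fmul (fgen Gx) (fgen Gy)) (fpoly (\<sigma> a))}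
     \<union> {fsub (fmul (fgen Gx) (fpoly r)) (fmul (fpoly (\<sigma> r)) (fgen Gx)) | r. True}
     \<union> {fsub (fmul (fpoly r) (fgen Gy)) (fmul (fgen Gy) (fpoly (\<sigma> r))) | r. True}"

definition fcoset :: "'k::comm_ring_1 fa set \<Rightarrow> 'k fa \<Rightarrow> 'k fa set" where
  "fcoset I p = {q \<in> Fset. fsub q p \<in> I}"

definition gwa :: "'k::field poly \<Rightarrow> ('k poly \<Rightarrow> 'k poly) \<Rightarrow> ('k fa set, 'k) kalg" where
  "gwa a \<sigma> = (let I = fideal (gwa_rels a \<sigma>) in
     \<lparr> kcar = fcoset I ` Fset,
       kadd = (\<lambda>C D. \<Union>p\<in>C. \<Union>q\<in>D. fcoset I (fadd p q)),
       kmul = (\<lambda>C D. \<Union>p\<in>C. \<Union>q\<in>D. fcoset I (fmul p q)),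
       kzero = fcoset I fzero,
       ksm = (\<lambda>c C. \<Union>p\<in>C. fcoset I (fsm c p)) \<rparr>)"

end

theory Submission
  imports Defs "HOL-Library.Poly_Mapping" "HOL-Library.Function_Algebras" "HOL-Library.Product_Plus"
begin

text \<open>Call a word in \<open>x\<close>, \<open>y\<close> alternating if no letter is repeated consecutively. Products of two consecutive
  letters of such a word lie in \<open>k[h]\<close>, so the alternating words span a subcomplex of the normalized bar
  resolution of \<open>A\<close> relative to \<open>k[h]\<close>, and this subcomplex is already a resolution. Combining it with the
  Koszul resolution of \<open>k[h]\<close> gives a resolution of \<open>A\<close> by free bimodules of ranks 1, 3, 4, 4, 4, \<dots>; the only
  correction term is the noncommutative derivative of \<open>a\<close>. A double complex whose rows and columns are
  exact compares it with the bar resolution. On the resulting small complex the commutator with \<open>h\<close> is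
  diagonalizable, so only the components of matching weight contribute. There the relative complex has
  cohomology \<open>k\<close> in degree 0, \<open>k[h]/(a)\<close> in even degrees \<open>\<ge> 2\<close> and 0 in odd degrees, and what
  remains is multiplication by \<open>a'\<close> from degree \<open>i\<close> to degree \<open>i + 2\<close>, whose kernel and cokernel on
  \<open>k[h]/(a)\<close> both have the dimension of \<open>k[h]/(a, a')\<close>.\<close>

section \<open>Quotient dimensions and double complexes\<close>

text \<open>Entry (p, q) of the double complex consists of the degree q cochains of the small
  complex with coefficients in the (p+1)-linear maps into A, the first argument being a module slot.
  The bar differential acts on the coefficients and is contracted by inserting the unit. In the
  other direction all arguments but the first are parameters, so only Hom_k(A, A) matters; there the
  cohomology is Ext_A(A, A), and an explicit linear contraction shows that it vanishes in positive
  degrees. Thus neither tensor products nor chain maps between resolutions are constructed. The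
  commutator with h has eigenvalues that are integer multiples of h0, invertible in characteristic
  zero except at the matching weight. There the left and the twisted right copy of h agree, which
  turns the noncommutative derivative of a into a'. Characteristic zero enters again through t(h +
  h0) - t(h), which is onto with kernel k. Surjectivity removes the odd relative classes; the kernel
  makes degree 2 special, since the multiplier of a' coming from degree 0 is a constant, and the
  dimension is n - 1 instead of d.\<close>

definition qdim :: "('k::zero \<Rightarrow> 'v \<Rightarrow> 'v) \<Rightarrow> 'v::ab_group_add set \<Rightarrow> 'v set \<Rightarrow> nat \<Rightarrow> bool" where
  "qdim s Z B m \<longleftrightarrow> (\<exists>b. (\<forall>i<m. b i \<in> Z) \<and>
     (\<forall>c. (\<Sum>i<m. s (c i) (b i)) \<in> B \<longrightarrow> (\<forall>i<m. c i = 0)) \<and>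
     (\<forall>z\<in>Z. \<exists>c. z - (\<Sum>i<m. s (c i) (b i)) \<in> B))"

text \<open>The correspondence \<open>R\<close> is a relation and not a map, because a zigzag in a
  double complex determines its far end only up to choices. Being closed under differences and
  scalars, it carries along every linear combination of basis representatives.\<close>

lemma qdim_transfer:
  assumes q: "qdim s Z B m"
    and zero: "R 0 0"
    and diff: "\<And>v w v' w'. R v w \<Longrightarrow> R v' w' \<Longrightarrow> R (v - v') (w - w')"
    and scal: "\<And>c v w. R v w \<Longrightarrow> R (s c v) (s' c w)"
    and left_total: "\<And>v. v \<in> Z \<Longrightarrow> \<exists>w\<in>Z'. R v w"
    and right_total: "\<And>w. w \<in> Z' \<Longrightarrow> \<exists>v\<in>Z. R v w"
    and bound: "\<And>v w. R v w \<Longrightarrow> v \<in> B \<longleftrightarrow> w \<in> B'"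
  shows "qdim s' Z' B' m"
proof -
  have add: "R (v + v') (w + w')" if "R v w" "R v' w'" for v w v' w'
    using diff[OF that(1) diff[OF zero that(2)]] by simp
  from q obtain b where b: "\<And>i. i < m \<Longrightarrow> b i \<in> Z"
    and ind: "\<And>c i. (\<Sum>i<m. s (c i) (b i)) \<in> B \<Longrightarrow> i < m \<Longrightarrow> c i = 0"
    and span: "\<And>z. z \<in> Z \<Longrightarrow> \<exists>c. z - (\<Sum>i<m. s (c i) (b i)) \<in> B"
    unfolding qdim_def by metis
  have "\<forall>i. \<exists>w. i < m \<longrightarrow> w \<in> Z' \<and> R (b i) w" using left_total b by blast
  then obtain b' where b': "\<And>i. i < m \<Longrightarrow> b' i \<in> Z'" and Rb: "\<And>i. i < m \<Longrightarrow> R (b i) (b' i)"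
    by metis
  have sums: "R (\<Sum>i<m. s (c i) (b i)) (\<Sum>i<m. s' (c i) (b' i))" for c
  proof -
    have "j \<le> m \<Longrightarrow> R (\<Sum>i<j. s (c i) (b i)) (\<Sum>i<j. s' (c i) (b' i))" for j
      by (induction j) (auto simp: zero intro!: add scal Rb)
    then show ?thesis by blast
  qed
  show ?thesis unfolding qdim_def
  proof (intro exI[of _ b'] conjI allI impI ballI)
    fix c i assume "(\<Sum>i<m. s' (c i) (b' i)) \<in> B'" "i < m"
    then show "c i = 0" using ind bound[OF sums] by blast
  next
    fix z assume "z \<in> Z'"
    then obtain y where y: "y \<in> Z" "R y z" using right_total by blast
    then obtain c where "y - (\<Sum>i<m. s (c i) (b i)) \<in> B" using span by blast
    then show "\<exists>c. z - (\<Sum>i<m. s' (c i) (b' i)) \<in> B'"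
      using bound[OF diff[OF y(2) sums]] by blast
  qed (use b' in auto)
qed

definition cyc :: "(nat \<Rightarrow> 'c::zero set) \<Rightarrow> (nat \<Rightarrow> 'c \<Rightarrow> 'c) \<Rightarrow> nat \<Rightarrow> 'c set" where
  "cyc C d n = {c \<in> C n. d n c = 0}"

definition cob :: "(nat \<Rightarrow> 'c::zero set) \<Rightarrow> (nat \<Rightarrow> 'c \<Rightarrow> 'c) \<Rightarrow> nat \<Rightarrow> 'c set" where
  "cob C d n = (case n of 0 \<Rightarrow> {0} | Suc m \<Rightarrow> d m ` C m)"

text \<open>First-quadrant double complex with two augmenting edges: \<open>C\<close> is the kernel
  of the first vertical maps, \<open>K\<close> the kernel of the first horizontal ones. Carriers are
  sets, so that one type serves all bidegrees. Scalars enter only in \<open>qdim_eq\<close>.\<close>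

locale bicomplex =
  fixes D :: "nat \<Rightarrow> nat \<Rightarrow> 'x::ab_group_add set"
    and h v :: "nat \<Rightarrow> 'x \<Rightarrow> 'x"
    and C :: "nat \<Rightarrow> 'c::ab_group_add set" and dC :: "nat \<Rightarrow> 'c \<Rightarrow> 'c" and \<beta> :: "'c \<Rightarrow> 'x"
    and K :: "nat \<Rightarrow> 'y::ab_group_add set" and dK :: "nat \<Rightarrow> 'y \<Rightarrow> 'y" and \<alpha> :: "'y \<Rightarrow> 'x"
  assumes D_diff: "x \<in> D p q \<Longrightarrow> y \<in> D p q \<Longrightarrow> x - y \<in> D p q"
    and h_in: "x \<in> D p q \<Longrightarrow> h p x \<in> D (Suc p) q"
    and v_in: "x \<in> D p q \<Longrightarrow> v q x \<in> D p (Suc q)"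
    and h_diff: "x \<in> D p q \<Longrightarrow> y \<in> D p q \<Longrightarrow> h p (x - y) = h p x - h p y"
    and v_diff: "x \<in> D p q \<Longrightarrow> y \<in> D p q \<Longrightarrow> v q (x - y) = v q x - v q y"
    and hv: "x \<in> D p q \<Longrightarrow> h p (v q x) = v q (h p x)"
    and hh: "x \<in> D p q \<Longrightarrow> h (Suc p) (h p x) = 0"
    and vv: "x \<in> D p q \<Longrightarrow> v (Suc q) (v q x) = 0"
    and \<beta>_in: "c \<in> C p \<Longrightarrow> \<beta> c \<in> D p 0"
    and \<alpha>_in: "k \<in> K q \<Longrightarrow> \<alpha> k \<in> D 0 q"
    and dC_in: "c \<in> C p \<Longrightarrow> dC p c \<in> C (Suc p)"
    and dK_in: "k \<in> K q \<Longrightarrow> dK q k \<in> K (Suc q)"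
    and C_0: "0 \<in> C p" and K_0: "0 \<in> K p"
    and \<beta>_0: "\<beta> 0 = 0" and \<alpha>_0: "\<alpha> 0 = 0"
    and \<beta>_inj: "c \<in> C p \<Longrightarrow> c' \<in> C p \<Longrightarrow> \<beta> c = \<beta> c' \<Longrightarrow> c = c'"
    and \<alpha>_inj: "k \<in> K p \<Longrightarrow> k' \<in> K p \<Longrightarrow> \<alpha> k = \<alpha> k' \<Longrightarrow> k = k'"
    and \<beta>_d: "c \<in> C p \<Longrightarrow> \<beta> (dC p c) = h p (\<beta> c)"
    and \<alpha>_d: "k \<in> K q \<Longrightarrow> \<alpha> (dK q k) = v q (\<alpha> k)"
    and v\<beta>: "c \<in> C p \<Longrightarrow> v 0 (\<beta> c) = 0"
    and h\<alpha>: "k \<in> K q \<Longrightarrow> h 0 (\<alpha> k) = 0"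
    and h_exact0: "x \<in> D 0 q \<Longrightarrow> h 0 x = 0 \<Longrightarrow> \<exists>k\<in>K q. x = \<alpha> k"
    and v_exact0: "x \<in> D p 0 \<Longrightarrow> v 0 x = 0 \<Longrightarrow> \<exists>c\<in>C p. x = \<beta> c"
    and h_exact: "x \<in> D (Suc p) q \<Longrightarrow> h (Suc p) x = 0 \<Longrightarrow> \<exists>y\<in>D p q. x = h p y"
    and v_exact: "x \<in> D p (Suc q) \<Longrightarrow> v (Suc q) x = 0 \<Longrightarrow> \<exists>y\<in>D p q. x = v q y"
begin

text \<open>Transposition exchanges the two edges, so each half of the comparison is proved
  once.\<close>

lemma swap: "bicomplex (\<lambda>p q. D q p) v h K dK \<alpha> C dC \<beta>"
  by unfold_locales
    (auto intro: D_diff h_in v_in h_diff v_diff hv[symmetric] hh vv \<beta>_in \<alpha>_in dC_in dK_in C_0 K_0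
       \<beta>_0 \<alpha>_0 \<beta>_inj \<alpha>_inj \<beta>_d \<alpha>_d v\<beta> h\<alpha> h_exact0 v_exact0 h_exact v_exact)

text \<open>The zigzag is written without signs: \<open>h\<close> and \<open>v\<close> commute.\<close>

definition linked :: "nat \<Rightarrow> 'c \<Rightarrow> 'y \<Rightarrow> bool" where
  "linked n c k \<longleftrightarrow> c \<in> C n \<and> k \<in> K n \<and> (\<exists>u e. u 0 = \<alpha> k \<and> u n = \<beta> c \<and>
     (\<forall>i<n. e i \<in> D i (n - 1 - i) \<and> h i (e i) = u (Suc i) \<and> v (n - 1 - i) (e i) = u i))"

lemma linkedI:
  assumes "c \<in> C n" "k \<in> K n" "u 0 = \<alpha> k" "u n = \<beta> c"
    and "\<And>i. i < n \<Longrightarrow> e i \<in> D i (n - 1 - i)"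
    and "\<And>i. i < n \<Longrightarrow> h i (e i) = u (Suc i)"
    and "\<And>i. i < n \<Longrightarrow> v (n - 1 - i) (e i) = u i"
  shows "linked n c k"
  unfolding linked_def using assms by blast

text \<open>Zigzag chase from the \<open>C\<close> edge: lift along \<open>h\<close> by exactness,
  apply \<open>v\<close>, and repeat until the \<open>K\<close> edge is reached.\<close>

lemma cocycle_linked:
  assumes "c \<in> cyc C dC n"
  shows "\<exists>k\<in>cyc K dK n. linked n c k"
proof -
  have c: "c \<in> C n" "dC n c = 0" using assms by (auto simp: cyc_def)
  \<comment> \<open>Invariant of the chase at position (i, n - i): the element is killed by both
    differentials.\<close>
  define P where "P i x \<longleftrightarrow> x \<in> D i (n - i) \<and> h i x = 0 \<and> v (n - i) x = 0" for i x
  define Q where "Q i x e \<longleftrightarrow> e \<in> D i (n - 1 - i) \<and> h i e = x" for i x e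
  have step: "\<exists>e. Q i x e \<and> P i (v (n - 1 - i) e)" if "P (Suc i) x" "i < n" for i x
  proof -
    have eqs: "n - Suc i = n - 1 - i" "n - i = Suc (n - 1 - i)" using that by auto
    have x: "x \<in> D (Suc i) (n - 1 - i)" "h (Suc i) x = 0" "v (n - 1 - i) x = 0"
      using that(1) unfolding P_def eqs by auto
    obtain e where e: "e \<in> D i (n - 1 - i)" "x = h i e" using h_exact[OF x(1,2)] by blast
    show ?thesis unfolding P_def Q_def eqs
      using e x v_in[OF e(1)] hv[OF e(1)] vv[OF e(1)] by auto
  qed
  define E where "E i x = (SOME e. Q i x e \<and> P i (v (n - 1 - i) e))" for i x
  have E: "Q i x (E i x) \<and> P i (v (n - 1 - i) (E i x))" if "P (Suc i) x" "i < n" for i x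
    unfolding E_def by (rule someI_ex) (rule step[OF that])
  \<comment> \<open>\<open>w j\<close> is the element reached after \<open>j\<close> steps, at
    position (n - j, j); \<open>u\<close> below reindexes it by the first coordinate.\<close>
  define w where "w = rec_nat (\<beta> c) (\<lambda>j x. v j (E (n - 1 - j) x))"
  have w0: "w 0 = \<beta> c" and wS: "w (Suc j) = v j (E (n - 1 - j) (w j))" for j
    by (auto simp: w_def)
  have "h n (\<beta> c) = 0" using \<beta>_d[OF c(1)] c(2) \<beta>_0 by simp
  then have P0: "P n (w 0)" unfolding P_def w0 using \<beta>_in[OF c(1)] v\<beta>[OF c(1)] by auto
  have Pw: "j \<le> n \<Longrightarrow> P (n - j) (w j)" for j
  proof (induction j)
    case 0 then show ?case using P0 by simp
  next
    case (Suc j)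
    then have "P (Suc (n - Suc j)) (w j)" using Suc_diff_Suc[of j n] by simp
    from E[OF this] Suc.prems have "P (n - Suc j) (v (n - 1 - (n - Suc j)) (E (n - Suc j) (w j)))" by simp
    then show ?case using Suc.prems by (simp add: wS)
  qed
  define u where "u i = w (n - i)" for i
  define e where "e i = E i (u (Suc i))" for i
  have Pu: "i \<le> n \<Longrightarrow> P i (u i)" for i using Pw[of "n - i"] by (simp add: u_def)
  have Qe: "Q i (u (Suc i)) (e i)" if "i < n" for i
    using E[of i "u (Suc i)"] Pu[of "Suc i"] that by (simp add: e_def)
  have ve: "v (n - 1 - i) (e i) = u i" if "i < n" for i
  proof -
    have "n - i = Suc (n - 1 - i)" using that by simp
    then have "u i = v (n - 1 - i) (E (n - 1 - (n - 1 - i)) (w (n - 1 - i)))"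
      unfolding u_def using wS by simp
    moreover have "n - 1 - (n - 1 - i) = i" using that by simp
    ultimately show ?thesis unfolding e_def u_def by simp
  qed
  have P: "u 0 \<in> D 0 n" "h 0 (u 0) = 0" "v n (u 0) = 0" using Pu[of 0] by (auto simp: P_def)
  obtain k where k: "k \<in> K n" "u 0 = \<alpha> k" using h_exact0[OF P(1,2)] by blast
  have "\<alpha> (dK n k) = \<alpha> 0" using \<alpha>_d[OF k(1)] P k \<alpha>_0 by simp
  then have "dK n k = 0" using \<alpha>_inj dK_in[OF k(1)] K_0 by blast
  moreover have "linked n c k"
    using c(1) k(1) k(2) _ _ _ ve
    by (rule linkedI) (use Qe in \<open>auto simp: Q_def u_def w0\<close>)
  ultimately show ?thesis using k by (auto simp: cyc_def)
qed

text \<open>A primitive of \<open>c\<close> is pushed along the zigzag: its mismatch with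
  \<open>e\<close> is \<open>h\<close>-closed, hence \<open>h\<close>-exact, and the vertical
  differential of the new primitive continues the chase. At the last corner the mismatch comes from
  \<open>K\<close> and is a primitive of \<open>k\<close>.\<close>

lemma linked_cob:
  assumes l: "linked n c k" and c: "c \<in> cob C dC n"
  shows "k \<in> cob K dK n"
proof (cases n)
  case 0
  then have "\<alpha> k = \<alpha> 0" using l c \<beta>_0 \<alpha>_0 by (auto simp: linked_def cob_def)
  then have "k = 0" using l \<alpha>_inj K_0 unfolding linked_def by blast
  then show ?thesis by (simp add: cob_def 0)
next
  case (Suc m)
  obtain c' where c': "c' \<in> C m" "c = dC m c'" using c Suc by (auto simp: cob_def)
  obtain u e where u: "u 0 = \<alpha> k" "u n = \<beta> c" and e: "\<And>i. i < n \<Longrightarrow> e i \<in> D i (n - 1 - i)"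
    and he: "\<And>i. i < n \<Longrightarrow> h i (e i) = u (Suc i)" and ve: "\<And>i. i < n \<Longrightarrow> v (n - 1 - i) (e i) = u i"
    using l unfolding linked_def by blast
  have k: "k \<in> K n" using l by (simp add: linked_def)
  \<comment> \<open>The induction keeps \<open>y\<close> killed by \<open>v\<close>, so that it
    drops out when \<open>v\<close> is applied to the mismatch.\<close>
  have "j \<le> m \<Longrightarrow> \<exists>y\<in>D (m - j) j. u (Suc (m - j)) = h (m - j) y \<and> v j y = 0" for j
  proof (induction j)
    case 0
    show ?case using \<beta>_in[OF c'(1)] \<beta>_d[OF c'(1)] v\<beta>[OF c'(1)] u Suc c' by auto
  next
    case (Suc j)
    define i where "i = m - Suc j"
    have i: "m - j = Suc i" "m = Suc i + j" using Suc.prems by (auto simp: i_def)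
    obtain y where y: "y \<in> D (Suc i) j" "u (Suc (Suc i)) = h (Suc i) y" "v j y = 0"
      using Suc by (auto simp: i)
    have n1: "n - 1 - Suc i = j" "n - 1 - i = Suc j" "Suc i < n" "i < n" using i \<open>n = Suc m\<close> by auto
    have eD: "e (Suc i) \<in> D (Suc i) j" using e[of "Suc i"] n1 by simp
    have "h (Suc i) (e (Suc i) - y) = 0" using h_diff[OF eD y(1)] he[of "Suc i"] y n1 by simp
    then obtain z where z: "z \<in> D i j" "e (Suc i) - y = h i z"
      using h_exact[OF D_diff[OF eD y(1)]] by blast
    have "u (Suc i) = v j (e (Suc i) - y)" using v_diff[OF eD y(1)] ve[of "Suc i"] y n1 by simp
    also have "\<dots> = h i (v j z)" using z hv by simp
    finally have "u (Suc i) = h i (v j z)" .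
    then show ?case unfolding i_def[symmetric] using v_in[OF z(1)] vv[OF z(1)] by auto
  qed
  from this[of m] obtain y where y: "y \<in> D 0 m" "u (Suc 0) = h 0 y" "v m y = 0" by auto
  have e0: "e 0 \<in> D 0 m" using e[of 0] Suc by simp
  have "h 0 (e 0 - y) = 0" using h_diff[OF e0 y(1)] he[of 0] y Suc by simp
  then obtain k' where k': "k' \<in> K m" "e 0 - y = \<alpha> k'" using h_exact0[OF D_diff[OF e0 y(1)]] by blast
  have "\<alpha> k = v m (e 0 - y)" using v_diff[OF e0 y(1)] ve[of 0] y u Suc by simp
  also have "\<dots> = \<alpha> (dK m k')" using \<alpha>_d k' by simp
  finally have "k = dK m k'" using \<alpha>_inj k dK_in[OF k'(1)] Suc by blast
  then show ?thesis using k' Suc by (auto simp: cob_def)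
qed

lemma linked_swap:
  assumes "linked n c k"
  shows "bicomplex.linked (\<lambda>p q. D q p) v h K \<alpha> C \<beta> n k c"
proof -
  obtain u e where u: "u 0 = \<alpha> k" "u n = \<beta> c" and e: "\<And>i. i < n \<Longrightarrow> e i \<in> D i (n - 1 - i)"
    and he: "\<And>i. i < n \<Longrightarrow> h i (e i) = u (Suc i)" and ve: "\<And>i. i < n \<Longrightarrow> v (n - 1 - i) (e i) = u i"
    using assms unfolding linked_def by blast
  have "e (n - 1 - i) \<in> D (n - 1 - i) i \<and> v i (e (n - 1 - i)) = u (n - Suc i) \<and>
        h (n - 1 - i) (e (n - 1 - i)) = u (n - i)" if "i < n" for i
    using e[of "n - 1 - i"] he[of "n - 1 - i"] ve[of "n - 1 - i"] that
    by (simp add: Suc_diff_Suc)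
  then show ?thesis
    by (intro bicomplex.linkedI[OF swap, where u = "\<lambda>i. u (n - i)" and e = "\<lambda>i. e (n - 1 - i)"])
      (use assms u in \<open>auto simp: linked_def\<close>)
qed

lemma linked_unswap:
  assumes "bicomplex.linked (\<lambda>p q. D q p) v h K \<alpha> C \<beta> n k c"
  shows "linked n c k"
  using bicomplex.linked_swap[OF swap assms] by simp

lemma linked_cob_iff:
  assumes "linked n c k"
  shows "c \<in> cob C dC n \<longleftrightarrow> k \<in> cob K dK n"
  using linked_cob[OF assms] bicomplex.linked_cob[OF swap linked_swap[OF assms]] by blast

lemma cocycle_linked':
  assumes "k \<in> cyc K dK n"
  shows "\<exists>c\<in>cyc C dC n. linked n c k"
  using bicomplex.cocycle_linked[OF swap assms] linked_unswap by blast

text \<open>Stated for arbitrary binary operations so that one proof covers differences and, with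
  the second argument ignored, scalar multiples.\<close>

lemma linked_map:
  assumes l: "linked n c k" "linked n c' k'"
    and C: "\<And>c c'. c \<in> C n \<Longrightarrow> c' \<in> C n \<Longrightarrow> fC c c' \<in> C n" and K: "\<And>c c'. c \<in> K n \<Longrightarrow> c' \<in> K n \<Longrightarrow> fK c c' \<in> K n"
    and D: "\<And>x y p q. x \<in> D p q \<Longrightarrow> y \<in> D p q \<Longrightarrow> fD x y \<in> D p q"
    and \<alpha>: "\<And>c c'. c \<in> K n \<Longrightarrow> c' \<in> K n \<Longrightarrow> \<alpha> (fK c c') = fD (\<alpha> c) (\<alpha> c')"
    and \<beta>: "\<And>c c'. c \<in> C n \<Longrightarrow> c' \<in> C n \<Longrightarrow> \<beta> (fC c c') = fD (\<beta> c) (\<beta> c')"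
    and h: "\<And>x y p q. x \<in> D p q \<Longrightarrow> y \<in> D p q \<Longrightarrow> h p (fD x y) = fD (h p x) (h p y)"
    and v: "\<And>x y p q. x \<in> D p q \<Longrightarrow> y \<in> D p q \<Longrightarrow> v q (fD x y) = fD (v q x) (v q y)"
  shows "linked n (fC c c') (fK k k')"
proof -
  obtain u e where u: "u 0 = \<alpha> k" "u n = \<beta> c" and e: "\<And>i. i < n \<Longrightarrow> e i \<in> D i (n - 1 - i)"
    and he: "\<And>i. i < n \<Longrightarrow> h i (e i) = u (Suc i)" and ve: "\<And>i. i < n \<Longrightarrow> v (n - 1 - i) (e i) = u i"
    using l(1) unfolding linked_def by blast
  obtain u' e' where u': "u' 0 = \<alpha> k'" "u' n = \<beta> c'" and e': "\<And>i. i < n \<Longrightarrow> e' i \<in> D i (n - 1 - i)"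
    and he': "\<And>i. i < n \<Longrightarrow> h i (e' i) = u' (Suc i)" and ve': "\<And>i. i < n \<Longrightarrow> v (n - 1 - i) (e' i) = u' i"
    using l(2) unfolding linked_def by blast
  have mem: "c \<in> C n" "k \<in> K n" "c' \<in> C n" "k' \<in> K n" using l by (auto simp: linked_def)
  show ?thesis
  proof (rule linkedI[where u = "\<lambda>i. fD (u i) (u' i)" and e = "\<lambda>i. fD (e i) (e' i)"])
    fix i assume i: "i < n"
    show "fD (e i) (e' i) \<in> D i (n - 1 - i)" using D e e' i by blast
    show "h i (fD (e i) (e' i)) = fD (u (Suc i)) (u' (Suc i))" using h e[OF i] e'[OF i] he he' i by metis
    show "v (n - 1 - i) (fD (e i) (e' i)) = fD (u i) (u' i)" using v e[OF i] e'[OF i] ve ve' i by metis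
  qed (auto simp: u u' mem \<alpha> \<beta> C K)
qed

text \<open>Linkedness is a linear relation, total on cocycles in both directions and matching
  coboundaries, so it induces an isomorphism on cohomology.\<close>

theorem qdim_eq:
  fixes sC :: "'k::zero \<Rightarrow> 'c \<Rightarrow> 'c" and sK :: "'k \<Rightarrow> 'y \<Rightarrow> 'y" and sD :: "'k \<Rightarrow> 'x \<Rightarrow> 'x"
  assumes q: "qdim sK (cyc K dK n) (cob K dK n) m"
    and C_diff: "\<And>c c'. c \<in> C n \<Longrightarrow> c' \<in> C n \<Longrightarrow> c - c' \<in> C n"
    and K_diff: "\<And>c c'. c \<in> K n \<Longrightarrow> c' \<in> K n \<Longrightarrow> c - c' \<in> K n"
    and \<beta>_diff: "\<And>c c'. \<beta> (c - c') = \<beta> c - \<beta> c'" and \<alpha>_diff: "\<And>c c'. \<alpha> (c - c') = \<alpha> c - \<alpha> c'"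
    and C_s: "\<And>r c. c \<in> C n \<Longrightarrow> sC r c \<in> C n" and K_s: "\<And>r c. c \<in> K n \<Longrightarrow> sK r c \<in> K n"
    and D_s: "\<And>r x p q. x \<in> D p q \<Longrightarrow> sD r x \<in> D p q"
    and \<beta>_s: "\<And>r c. \<beta> (sC r c) = sD r (\<beta> c)" and \<alpha>_s: "\<And>r c. \<alpha> (sK r c) = sD r (\<alpha> c)"
    and h_s: "\<And>r x p q. x \<in> D p q \<Longrightarrow> h p (sD r x) = sD r (h p x)"
    and v_s: "\<And>r x p q. x \<in> D p q \<Longrightarrow> v q (sD r x) = sD r (v q x)"
  shows "qdim sC (cyc C dC n) (cob C dC n) m"
proof (rule qdim_transfer[OF q, where R = "\<lambda>k c. linked n c k"])
  show "linked n 0 0"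
  proof (rule linkedI[where u = "\<lambda>i. 0" and e = "\<lambda>i. 0"])
    fix i assume "i < n"
    have 0: "0 \<in> D p q" for p q
    proof (induction p)
      case 0 show ?case using \<alpha>_in[OF K_0] \<alpha>_0 by metis
    next
      case (Suc p) then show ?case using h_in[OF Suc] D_diff by (metis diff_self)
    qed
    show "0 \<in> D i (n - 1 - i)" by (rule 0)
    show "h i 0 = 0" using h_diff[OF 0[of i 0] 0[of i 0]] by simp
    show "v (n - 1 - i) 0 = 0" using v_diff[OF 0[of i] 0[of i]] by (metis diff_self)
  qed (auto simp: \<alpha>_0 \<beta>_0 C_0 K_0)
next
  fix k c k' c' assume "linked n c k" "linked n c' k'"
  from linked_map[OF this, of "(-)" "(-)" "(-)"]
  show "linked n (c - c') (k - k')" by (auto simp: C_diff K_diff D_diff \<beta>_diff \<alpha>_diff h_diff v_diff)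
next
  fix r k c assume "linked n c k"
  from linked_map[OF this this, of "\<lambda>c _. sC r c" "\<lambda>c _. sK r c" "\<lambda>x _. sD r x"]
  show "linked n (sC r c) (sK r k)" by (auto simp: C_s K_s D_s \<beta>_s \<alpha>_s h_s v_s)
next
  fix k assume "k \<in> cyc K dK n" then show "\<exists>c\<in>cyc C dC n. linked n c k" by (rule cocycle_linked')
next
  fix c assume "c \<in> cyc C dC n" then show "\<exists>k\<in>cyc K dK n. linked n c k" by (rule cocycle_linked)
next
  fix k c assume "linked n c k" then show "k \<in> cob K dK n \<longleftrightarrow> c \<in> cob C dC n"
    using linked_cob_iff by blast
qed

end

section \<open>Multilinear maps and the bar differential\<close>

lemma additive_diff:
  fixes F :: "'a::ab_group_add \<Rightarrow> 'b::ab_group_add"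
  assumes "\<And>x y. F (x + y) = F x + F y"
  shows "F (x - y) = F x - F y"
  by (metis add_diff_cancel assms diff_add_cancel)

lemma additive_zero:
  fixes F :: "'a::ab_group_add \<Rightarrow> 'b::ab_group_add"
  assumes "\<And>x y. F (x + y) = F x + F y"
  shows "F 0 = 0"
  by (metis add_cancel_right_right assms)

locale alg =
  fixes mul :: "'a::ab_group_add \<Rightarrow> 'a \<Rightarrow> 'a" (infixl "\<odot>" 70) and one :: 'a
    and sm :: "'k::field \<Rightarrow> 'a \<Rightarrow> 'a"
  assumes mul_add_left: "(x + y) \<odot> z = x \<odot> z + y \<odot> z"
    and mul_add_right: "z \<odot> (x + y) = z \<odot> x + z \<odot> y"
    and mul_assoc: "(x \<odot> y) \<odot> z = x \<odot> (y \<odot> z)"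
    and one_left [simp]: "one \<odot> x = x" and one_right [simp]: "x \<odot> one = x"
    and sm_add_right: "sm c (x + y) = sm c x + sm c y"
    and sm_add_left: "sm (c + e) x = sm c x + sm e x"
    and sm_sm: "sm c (sm e x) = sm (c * e) x"
    and sm_one [simp]: "sm 1 x = x"
    and sm_mul_left: "sm c x \<odot> y = sm c (x \<odot> y)"
    and sm_mul_right: "x \<odot> sm c y = sm c (x \<odot> y)"
begin

lemma mul_diff_left: "(x - y) \<odot> z = x \<odot> z - y \<odot> z"
  by (rule additive_diff) (rule mul_add_left)
lemma mul_diff_right: "z \<odot> (x - y) = z \<odot> x - z \<odot> y"
  by (rule additive_diff) (rule mul_add_right)
lemma mul_zero_left [simp]: "0 \<odot> z = 0" using mul_diff_left[of 0 0] by simp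
lemma mul_zero_right [simp]: "z \<odot> 0 = 0" using mul_diff_right[of _ 0 0] by simp
lemma sm_diff_right: "sm c (x - y) = sm c x - sm c y"
  by (rule additive_diff) (rule sm_add_right)
lemma sm_zero_right [simp]: "sm c 0 = 0" using sm_diff_right[of _ 0 0] by simp
lemma sm_zero_left [simp]: "sm 0 x = 0" using sm_add_left[of 0 0 x] by simp
lemma sm_minus_right: "sm c (- x) = - sm c x" using sm_diff_right[of c 0 x] by simp
lemma sm_minus_left: "sm (- c) x = - sm c x"
  using sm_add_left[of c "-c" x] by (simp add: eq_neg_iff_add_eq_0 add.commute)
lemma mul_minus_right: "x \<odot> (- y) = - (x \<odot> y)" using mul_diff_right[of x 0 y] by simp

definition lin :: "('a \<Rightarrow> 'a) \<Rightarrow> bool" where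
  "lin F \<longleftrightarrow> (\<forall>x y. F (x + y) = F x + F y) \<and> (\<forall>c x. F (sm c x) = sm c (F x))"

lemma linI: "(\<And>x y. F (x + y) = F x + F y) \<Longrightarrow> (\<And>c x. F (sm c x) = sm c (F x)) \<Longrightarrow> lin F"
  by (simp add: lin_def)
lemma lin_add: "lin F \<Longrightarrow> F (x + y) = F x + F y" by (simp add: lin_def)
lemma lin_sm: "lin F \<Longrightarrow> F (sm c x) = sm c (F x)" by (simp add: lin_def)
lemma lin_0: "lin F \<Longrightarrow> F 0 = 0" using additive_zero[of F] lin_add by blast

lemma lin_const0 [simp]: "lin (\<lambda>_. 0)" by (simp add: lin_def)
lemma lin_plus: "lin F \<Longrightarrow> lin G \<Longrightarrow> lin (\<lambda>x. F x + G x)" by (auto simp: lin_def sm_add_right)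
lemma lin_minus: "lin F \<Longrightarrow> lin G \<Longrightarrow> lin (\<lambda>x. F x - G x)" by (auto simp: lin_def sm_diff_right)
lemma lin_mul_left: "lin F \<Longrightarrow> lin (\<lambda>x. c \<odot> F x)" by (auto simp: lin_def mul_add_right sm_mul_right)
lemma lin_mul_right: "lin F \<Longrightarrow> lin (\<lambda>x. F x \<odot> c)" by (auto simp: lin_def mul_add_left sm_mul_left)
lemma lin_scale: "lin F \<Longrightarrow> lin (\<lambda>x. sm c (F x))" by (auto simp: lin_def sm_add_right sm_sm mult.commute)
lemma lin_comp: "lin F \<Longrightarrow> lin G \<Longrightarrow> lin (\<lambda>x. F (G x))" by (auto simp: lin_def)
lemma lin_id: "lin (\<lambda>x. x)" by (auto simp: lin_def)

definition mlin :: "nat \<Rightarrow> ('a list \<Rightarrow> 'a) \<Rightarrow> bool" where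
  "mlin n f \<longleftrightarrow> (\<forall>xs. length xs \<noteq> n \<longrightarrow> f xs = 0) \<and> (\<forall>us vs. lin (\<lambda>u. f (us @ u # vs)))"

lemma mlinI: "(\<And>xs. length xs \<noteq> n \<Longrightarrow> f xs = 0) \<Longrightarrow> (\<And>us vs. lin (\<lambda>u. f (us @ u # vs))) \<Longrightarrow> mlin n f"
  by (simp add: mlin_def)
lemma mlin_off: "mlin n f \<Longrightarrow> length xs \<noteq> n \<Longrightarrow> f xs = 0" by (simp add: mlin_def)
lemma mlin_lin: "mlin n f \<Longrightarrow> lin (\<lambda>u. f (us @ u # vs))" by (simp add: mlin_def)
lemma mlin_lin0: "mlin n f \<Longrightarrow> lin (\<lambda>u. f (u # vs))" using mlin_lin[of n f "[]"] by simp
lemma mlin_Nil: "mlin (Suc n) f \<Longrightarrow> f [] = 0" by (simp add: mlin_def)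
lemma mlin_zero: "mlin n 0" by (simp add: mlin_def)
lemma mlin_minus: "mlin n f \<Longrightarrow> mlin n g \<Longrightarrow> mlin n (f - g)" by (auto simp: mlin_def lin_minus)
lemma mlin_scale: "mlin n f \<Longrightarrow> mlin n (\<lambda>xs. sm c (f xs))" by (auto simp: mlin_def lin_scale)

lemma mlin_slice: "mlin (Suc n) f \<Longrightarrow> mlin n (\<lambda>xs. f (x # xs))"
  by (rule mlinI) (auto simp: mlin_off dest: mlin_lin[of _ _ "x # _"])

text \<open>The negative of the Hochschild differential without its first term \<open>x \<odot> f xs\<close>. On maps \<open>f (b # as)\<close>
  whose first argument \<open>b\<close> is a module slot, this is the differential of the row.\<close>

fun bar :: "('a list \<Rightarrow> 'a) \<Rightarrow> 'a list \<Rightarrow> 'a" where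
  "bar f [] = 0"
| "bar f [x] = f [] \<odot> x"
| "bar f (x # y # zs) = f (x \<odot> y # zs) - bar (\<lambda>ws. f (x # ws)) (y # zs)"

definition hoch :: "('a list \<Rightarrow> 'a) \<Rightarrow> 'a list \<Rightarrow> 'a" where
  "hoch c xs = (case xs of [] \<Rightarrow> 0 | x # ys \<Rightarrow> x \<odot> c ys - bar c xs)"

lemma bar_map:
  assumes "\<And>x y. \<Phi> (x - y) = \<Phi> x - \<Phi> y" "\<And>x y. \<Phi> (x \<odot> y) = \<Phi> x \<odot> y"
  shows "bar (\<lambda>xs. \<Phi> (f xs)) xs = \<Phi> (bar f xs)"
proof -
  have "\<Phi> 0 = 0" using assms(1)[of 0 0] by simp
  then show ?thesis by (induction f xs rule: bar.induct) (auto simp: assms)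
qed

lemma bar_plus: "bar (\<lambda>xs. f xs + g xs) xs = bar f xs + bar g xs"
proof (induction f xs arbitrary: g rule: bar.induct)
  case (3 f x y zs)
  show ?case using 3[of "\<lambda>ws. g (x # ws)"] by (simp add: algebra_simps)
qed (auto simp: mul_add_left)

lemma bar_minus: "bar (\<lambda>xs. f xs - g xs) xs = bar f xs - bar g xs"
proof (induction f xs arbitrary: g rule: bar.induct)
  case (3 f x y zs)
  show ?case using 3[of "\<lambda>ws. g (x # ws)"] by (simp add: algebra_simps)
qed (auto simp: mul_diff_left)

lemma bar_zero: "bar (\<lambda>_. 0) xs = 0" using bar_minus[of "\<lambda>_. 0" "\<lambda>_. 0" xs] by simp

lemma bar_sm: "bar (\<lambda>xs. sm c (f xs)) xs = sm c (bar f xs)"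
  by (rule bar_map) (auto simp: sm_diff_right sm_mul_left)

lemma bar_mul: "bar (\<lambda>xs. c \<odot> f xs) xs = c \<odot> bar f xs"
  by (rule bar_map) (auto simp: mul_diff_right mul_assoc)

text \<open>With the recursive form of the differential, associativity and one induction on the
  argument list suffice; the double sum with its cancelling pairs never appears.\<close>

lemma bar_bar: "bar (bar f) xs = 0"
proof (induction xs arbitrary: f rule: induct_list012)
  case 1 show ?case by simp
next
  case (2 x) show ?case by simp
next
  case (3 x y zs)
  show ?case
  proof (cases zs)
    case Nil then show ?thesis by (simp add: mul_assoc)
  next
    case (Cons z ws)
    show ?thesis using 3(2)[of "\<lambda>ws. f (x # ws)"] unfolding Cons
      by (simp add: mul_assoc bar_minus)
  qed
qed

lemma bar_off: "(\<And>xs. length xs \<noteq> n \<Longrightarrow> f xs = 0) \<Longrightarrow> length xs \<noteq> Suc n \<Longrightarrow> bar f xs = 0"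
proof (induction f xs arbitrary: n rule: bar.induct)
  case (3 f x y zs)
  show ?case
  proof (cases n)
    case 0
    then have "bar (\<lambda>ws. f (x # ws)) (y # zs) = 0"
      using 3(2) bar_zero[of "y # zs"] by simp
    then show ?thesis using 3 0 by simp
  next
    case (Suc m)
    then have "bar (\<lambda>ws. f (x # ws)) (y # zs) = 0" using 3(3) by (intro 3(1)[of m] 3(2)) auto
    then show ?thesis using 3(2,3) Suc by simp
  qed
qed auto

lemma bar_lin:
  assumes "\<And>us vs. lin (\<lambda>u. f (us @ u # vs))"
  shows "lin (\<lambda>u. bar f (us @ u # vs))"
  using assms
proof (induction us arbitrary: f)
  case Nil
  have f0: "lin (\<lambda>u. f (u # ws))" for ws using Nil[of "[]"] by simp
  show ?case
  proof (cases vs)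
    case Nil then show ?thesis by (simp add: lin_mul_left[OF lin_id])
  next
    case (Cons y zs)
    have "lin (\<lambda>u. f (u \<odot> y # zs))" using lin_comp[OF f0 lin_mul_right[OF lin_id]] .
    moreover have "lin (\<lambda>u. bar (\<lambda>ws. f (u # ws)) (y # zs))"
      by (rule linI) (simp_all only: lin_add[OF f0] lin_sm[OF f0] bar_plus bar_sm)
    ultimately show ?thesis by (simp add: Cons lin_minus)
  qed
next
  case (Cons x us)
  have fx: "lin (\<lambda>u. f (x # us @ u # vs))" for us vs x using Cons(2)[of "x # us"] by simp
  have IH: "lin (\<lambda>u. bar (\<lambda>ws. f (x # ws)) (us @ u # vs))" by (rule Cons(1)) (rule fx)
  show ?case
  proof (cases us)
    case Nil
    have "lin (\<lambda>u. f (x \<odot> u # vs))"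
      using lin_comp[OF Cons(2)[of "[]"] lin_mul_left[OF lin_id]] by simp
    then show ?thesis using IH by (simp add: Nil lin_minus)
  next
    case (Cons z ws)
    show ?thesis using IH fx[of "x \<odot> z" ws] by (simp add: Cons lin_minus)
  qed
qed

lemma mlin_bar: "mlin n f \<Longrightarrow> mlin (Suc n) (bar f)"
  unfolding mlin_def using bar_off[of n f] bar_lin[of f] by blast

lemma mlin_hoch: 
  assumes "mlin n f" shows "mlin (Suc n) (hoch f)"
proof (rule mlinI)
  fix xs :: "'a list" assume "length xs \<noteq> Suc n"
  then show "hoch f xs = 0" using assms mlin_off[OF mlin_bar[OF assms], of xs]
    by (auto simp: hoch_def mlin_off split: list.splits)
next
  fix us vs
  show "lin (\<lambda>u. hoch f (us @ u # vs))"
  proof (cases us)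
    case Nil then show ?thesis using lin_minus[OF lin_mul_right[OF lin_id] mlin_lin[OF mlin_bar[OF assms], of "[]"]]
      by (simp add: hoch_def)
  next
    case (Cons x ws) then show ?thesis
      using lin_minus[OF lin_mul_left[OF mlin_lin[OF assms, of ws vs]] mlin_lin[OF mlin_bar[OF assms], of "x # ws"]]
      by (simp add: hoch_def)
  qed
qed

text \<open>Turns a contraction built for linear maps into one for multilinear maps: the arguments
  after the first are parameters, and linear dependence on the partial maps becomes multilinearity
  in the parameters.\<close>

lemma mlin_functional:
  fixes f :: "'i \<Rightarrow> 'a list \<Rightarrow> 'a"
  assumes f: "\<And>i. mlin (Suc p) (f i)"
    and add: "\<And>F G. (\<And>i. lin (F i)) \<Longrightarrow> (\<And>i. lin (G i)) \<Longrightarrow> \<psi> (\<lambda>i b. F i b + G i b) = \<psi> F + \<psi> G"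
    and scale: "\<And>c F. (\<And>i. lin (F i)) \<Longrightarrow> \<psi> (\<lambda>i b. sm c (F i b)) = sm c (\<psi> F)"
  shows "mlin p (\<lambda>as. \<psi> (\<lambda>i b. f i (b # as)))"
proof (rule mlinI)
  have z: "\<psi> (\<lambda>i b. 0) = 0" using scale[of "\<lambda>i b. 0" 0] by simp
  fix xs :: "'a list" assume "length xs \<noteq> p"
  then show "\<psi> (\<lambda>i b. f i (b # xs)) = 0" using mlin_off[OF f] z by simp
next
  fix us vs
  have fl: "lin (\<lambda>u. f i (b # us @ u # vs))" for i b using mlin_lin[OF f, of i "b # us" vs] by simp
  have fb: "lin (\<lambda>b. f i (b # xs))" for i xs by (rule mlin_lin0[OF f])
  show "lin (\<lambda>u. \<psi> (\<lambda>i b. f i (b # us @ u # vs)))"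
    by (rule linI) (simp_all only: lin_add[OF fl] lin_sm[OF fl] add[OF fb fb] scale[OF fb])
qed

end

section \<open>Horner recursion on polynomials and translation of the variable\<close>

function prec :: "('k::zero poly \<Rightarrow> 'n \<Rightarrow> 'n) \<Rightarrow> 'k poly \<Rightarrow> 'n::zero" where
  "prec G p = (if p = 0 then 0 else G (poly_shift 1 p) (prec G (poly_shift 1 p)))"
  by auto
termination
proof (relation "measure (\<lambda>(G, p). length (coeffs p))")
  fix G :: "'a::zero poly \<Rightarrow> 'b::zero \<Rightarrow> 'b" and p :: "'a poly" assume "p \<noteq> 0"
  moreover obtain b q where "p = pCons b q" by (cases p)
  moreover have "poly_shift 1 (pCons b q) = q" by (rule poly_eqI) (simp add: coeff_poly_shift)
  ultimately show "((G, poly_shift 1 p), G, p) \<in> measure (\<lambda>(G, p). length (coeffs p))"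
    by (auto simp: cCons_def)
qed auto

lemma prec_0 [simp]: "prec G 0 = 0" by simp

declare prec.simps [simp del]

text \<open>The recursion discards the constant coefficient, as suits divided differences, which
  vanish on constants. The hypothesis settles the ambiguous case
  \<open>pCons 0 0 = 0\<close>.\<close>

lemma prec_pCons:
  assumes "G 0 0 = 0"
  shows "prec G (pCons b p) = G p (prec G p)"
proof -
  have "poly_shift 1 (pCons b p) = p" by (rule poly_eqI) (simp add: coeff_poly_shift)
  then show ?thesis using assms prec.simps[of G "pCons b p"] by auto
qed

definition sh :: "'k::comm_ring_1 \<Rightarrow> 'k poly \<Rightarrow> 'k poly" where
  "sh c p = pcompose p [:c, 1:]"

lemma sh_0 [simp]: "sh c 0 = 0" by (simp add: sh_def)
lemma sh_1 [simp]: "sh c 1 = 1" by (simp add: sh_def pcompose_1)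
lemma sh_const [simp]: "sh c [:b:] = [:b:]" by (simp add: sh_def)
lemma sh_add: "sh c (p + q) = sh c p + sh c q" by (simp add: sh_def pcompose_add)
lemma sh_diff: "sh c (p - q) = sh c p - sh c q" by (simp add: sh_def pcompose_diff)
lemma sh_minus: "sh c (- p) = - sh c p" by (simp add: sh_def pcompose_uminus)
lemma sh_mult: "sh c (p * q) = sh c p * sh c q" by (simp add: sh_def pcompose_mult)
lemma sh_smult: "sh c (smult b p) = smult b (sh c p)" by (simp add: sh_def pcompose_smult)
lemma sh_lin: "sh c [:b, 1:] = [:b + c, 1:]" by (simp add: sh_def pcompose_pCons)
lemma sh_pCons: "sh c (pCons b p) = [:b:] + [:c, 1:] * sh c p" by (simp add: sh_def pcompose_pCons)
lemma sh_zero [simp]: "sh 0 p = p"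
  by (induction p) (simp_all add: sh_pCons)
lemma sh_sh: "sh c (sh b p) = sh (c + b) p"
  by (induction p) (simp_all add: sh_pCons sh_add sh_smult smult_add_left algebra_simps)

section \<open>The small complex\<close>

definition sg :: "bool \<Rightarrow> int" where "sg l = (if l then 1 else - 1)"

lemma sg_not [simp]: "sg (\<not> l) = - sg l" by (simp add: sg_def)

text \<open>A is described by its basis over k[h]: \<open>bs j\<close> stands for x^j if j >= 0 and
  for y^(-j) otherwise. \<open>X True\<close> is x and \<open>X False\<close> is y;
  \<open>sg\<close>, \<open>ss\<close> and \<open>al\<close> record the degree of a letter, its
  shift and its product with the other letter, so that one argument serves both. \<open>bext\<close>
  extends a family given on the basis to a linear map.\<close>

locale gwalg = alg mul one sm
  for mul :: "'a::ab_group_add \<Rightarrow> 'a \<Rightarrow> 'a" (infixl "\<odot>" 70) and one :: 'a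
    and sm :: "'k::field \<Rightarrow> 'a \<Rightarrow> 'a" +
  fixes a :: "'k poly" and h0 :: 'k
    and hp :: "'k poly \<Rightarrow> 'a" and X :: "bool \<Rightarrow> 'a" and bs :: "int \<Rightarrow> 'a"
    and bext :: "(int \<Rightarrow> 'k poly \<Rightarrow> 'a) \<Rightarrow> 'a \<Rightarrow> 'a"
    and ss :: "bool \<Rightarrow> 'k" and al :: "bool \<Rightarrow> 'k poly"
  defines "ss \<equiv> \<lambda>l. if l then h0 else - h0"
    and "al \<equiv> \<lambda>l. if l then sh (- h0) a else a"
  assumes hp_add: "hp (p + q) = hp p + hp q"
    and hp_mult: "hp (p * q) = hp p \<odot> hp q"
    and hp_1: "hp 1 = one"
    and hp_const: "hp [:c:] = sm c one"
    and X_hp: "X l \<odot> hp p = hp (sh (- ss l) p) \<odot> X l"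
    and X_X: "X l \<odot> X (\<not> l) = hp (al l)"
    and bs_0: "bs 0 = one"
    and X_bs: "0 \<le> sg l * j \<Longrightarrow> X l \<odot> bs j = bs (j + sg l)"
    and bext_lin: "(\<And>j p q. F j (p + q) = F j p + F j q) \<Longrightarrow> (\<And>j c p. F j (smult c p) = sm c (F j p)) \<Longrightarrow> lin (bext F)"
    and bext_bs: "(\<And>j p q. F j (p + q) = F j p + F j q) \<Longrightarrow> bext F (hp p \<odot> bs j) = F j p"
    and basis_eq: "lin G \<Longrightarrow> lin G' \<Longrightarrow> (\<And>p j. G (hp p \<odot> bs j) = G' (hp p \<odot> bs j)) \<Longrightarrow> G = G'"
begin

lemma hp_0 [simp]: "hp 0 = 0" using hp_add[of 0 0] by simp

lemma ss_not [simp]: "ss (\<not> l) = - ss l" by (simp add: ss_def)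
lemma sh_al: "sh (- ss l) (al (\<not> l)) = al l" by (simp add: ss_def al_def sh_sh)
lemma sh_al': "sh (ss l) (al l) = al (\<not> l)" by (simp add: ss_def al_def sh_sh)

lemma hp_mul_const: "hp [:c:] \<odot> t = sm c t" by (simp add: hp_const sm_mul_left)
lemma mul_hp_const: "t \<odot> hp [:c:] = sm c t" by (simp add: hp_const sm_mul_right)
lemma hp_smult: "hp (smult c p) = sm c (hp p)"
  using hp_mult[of "[:c:]" p] by (simp add: hp_mul_const)

lemma hp_X: "hp p \<odot> X l = X l \<odot> hp (sh (ss l) p)"
  by (simp add: X_hp sh_sh)

text \<open>The letter cancels against the first letter of the monomial.\<close>

lemma X_bs_neg:
  assumes "sg l * j < 0"
  shows "X l \<odot> bs j = hp (al l) \<odot> bs (j + sg l)"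
proof -
  have "0 \<le> sg (\<not> l) * (j + sg l)" using assms by (auto simp: sg_def split: if_splits)
  from X_bs[OF this] have "bs j = X (\<not> l) \<odot> bs (j + sg l)" by simp
  then show ?thesis by (simp add: mul_assoc[symmetric] X_X)
qed

text \<open>\<open>(p(U) - p(V)) / (U - V)\<close> for the commuting operators \<open>U = L (hp h)\<close> and \<open>V = R (hp (h + c))\<close>, expanded by
  Horner's rule.\<close>

definition Del :: "('a \<Rightarrow> 'n \<Rightarrow> 'n) \<Rightarrow> ('a \<Rightarrow> 'n \<Rightarrow> 'n) \<Rightarrow> 'k \<Rightarrow> 'k poly \<Rightarrow> 'n \<Rightarrow> 'n::ab_group_add" where
  "Del L R c p F = prec (\<lambda>q w. L (hp q) F + R (hp [:c, 1:]) w) p"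

text \<open>The shift of h on passing an alternating word: the shifts of consecutive letters cancel,
  so only the first letter of an odd word counts.\<close>

definition dg :: "bool \<Rightarrow> bool \<Rightarrow> 'k" where "dg e l = (if e then 0 else ss l)"

text \<open>An alternating word is encoded by its first letter \<open>l\<close> (\<open>True\<close> for \<open>x\<close>) and its length, of which only the
  parity \<open>e\<close> (\<open>True\<close> for even) matters. In a bimodule with actions \<open>L\<close> and \<open>R\<close>, \<open>dlt\<close> is the differential of the
  relative complex and \<open>eta\<close> the commutator with \<open>h\<close>, twisted by the degree of the word. Since
  \<open>dlt \<circ> dlt = tau \<circ> eta\<close> is not zero, the differential of the total complex needs the correction \<open>tau\<close>.\<close>

definition dlt :: "('a \<Rightarrow> 'n \<Rightarrow> 'n) \<Rightarrow> ('a \<Rightarrow> 'n \<Rightarrow> 'n) \<Rightarrow> bool \<Rightarrow> (bool \<Rightarrow> 'n) \<Rightarrow> bool \<Rightarrow> 'n::ab_group_add" where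
  "dlt L R e f l = (if e then L (X l) (f (\<not> l)) - R (X l) (f l)
                    else L (X l) (f (\<not> l)) + R (X (\<not> l)) (f l))"

definition eta :: "('a \<Rightarrow> 'n \<Rightarrow> 'n) \<Rightarrow> ('a \<Rightarrow> 'n \<Rightarrow> 'n) \<Rightarrow> bool \<Rightarrow> (bool \<Rightarrow> 'n) \<Rightarrow> bool \<Rightarrow> 'n::ab_group_add" where
  "eta L R e f l = L (hp [:0, 1:]) (f l) - R (hp [:dg e l, 1:]) (f l)"

definition tau :: "('a \<Rightarrow> 'n \<Rightarrow> 'n) \<Rightarrow> ('a \<Rightarrow> 'n \<Rightarrow> 'n) \<Rightarrow> bool \<Rightarrow> (bool \<Rightarrow> 'n) \<Rightarrow> bool \<Rightarrow> 'n::ab_group_add" where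
  "tau L R e g l = Del L R (dg e l) (al l) (g l)"

text \<open>A cochain of degree \<open>n\<close> is a pair of a map on words of length \<open>n\<close> and a map on words of length \<open>n - 1\<close> preceded
  by \<open>h\<close>.\<close>

definition sd :: "('a \<Rightarrow> 'n \<Rightarrow> 'n) \<Rightarrow> ('a \<Rightarrow> 'n \<Rightarrow> 'n) \<Rightarrow> nat \<Rightarrow>
    (bool \<Rightarrow> 'n) \<times> (bool \<Rightarrow> 'n) \<Rightarrow> (bool \<Rightarrow> 'n) \<times> (bool \<Rightarrow> 'n::ab_group_add)" where
  "sd L R n = (\<lambda>(f, g). (dlt L R (even n) f - tau L R (odd n) g, eta L R (even n) f - dlt L R (odd n) g))"

text \<open>There is only one word of length 0, hence the conditions that its value does not depend on the first
  letter.\<close>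

definition Kc :: "'n::ab_group_add set \<Rightarrow> nat \<Rightarrow> ((bool \<Rightarrow> 'n) \<times> (bool \<Rightarrow> 'n)) set" where
  "Kc N n = {(f, g). (\<forall>l. f l \<in> N) \<and> (\<forall>l. g l \<in> N) \<and>
     (n = 0 \<longrightarrow> f False = f True \<and> g = 0) \<and> (n = 1 \<longrightarrow> g False = g True)}"

end

text \<open>Abstract coefficients; the instances are \<open>A\<close> itself, the linear maps on
  \<open>A\<close> and the multilinear maps. The operators \<open>R c\<close> form a right action,
  hence the reversed order in \<open>R_mul\<close>. By \<open>L_const\<close> the field acts in the
  same way on both sides.\<close>

locale bimod = gwalg mul one sm a h0 hp X bs bext ss al
  for mul :: "'a::ab_group_add \<Rightarrow> 'a \<Rightarrow> 'a" (infixl "\<odot>" 70) and one :: 'a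
    and sm :: "'k::field \<Rightarrow> 'a \<Rightarrow> 'a"
    and a h0 hp X bs bext ss al +
  fixes NN :: "'n::ab_group_add set" and L R :: "'a \<Rightarrow> 'n \<Rightarrow> 'n"
  assumes N_0: "0 \<in> NN" and N_diff: "F \<in> NN \<Longrightarrow> G \<in> NN \<Longrightarrow> F - G \<in> NN"
    and L_in: "F \<in> NN \<Longrightarrow> L c F \<in> NN" and R_in: "F \<in> NN \<Longrightarrow> R c F \<in> NN"
    and L_add: "F \<in> NN \<Longrightarrow> G \<in> NN \<Longrightarrow> L c (F + G) = L c F + L c G"
    and R_add: "F \<in> NN \<Longrightarrow> G \<in> NN \<Longrightarrow> R c (F + G) = R c F + R c G"
    and L_plus: "F \<in> NN \<Longrightarrow> L (c + e) F = L c F + L e F"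
    and R_plus: "F \<in> NN \<Longrightarrow> R (c + e) F = R c F + R e F"
    and L_mul: "F \<in> NN \<Longrightarrow> L (c \<odot> e) F = L c (L e F)"
    and R_mul: "F \<in> NN \<Longrightarrow> R (c \<odot> e) F = R e (R c F)"
    and LR: "F \<in> NN \<Longrightarrow> L c (R e F) = R e (L c F)"
    and L_const: "F \<in> NN \<Longrightarrow> L (hp [:b:]) F = R (hp [:b:]) F"
begin

lemma N_add: "F \<in> NN \<Longrightarrow> G \<in> NN \<Longrightarrow> F + G \<in> NN"
  using N_diff[of F "0 - G"] N_diff[of 0 G] N_0 by simp

lemma L_0 [simp]: "L c 0 = 0" using L_add[OF N_0 N_0] by simp
lemma R_0 [simp]: "R c 0 = 0" using R_add[OF N_0 N_0] by simp
lemma L_zero: "F \<in> NN \<Longrightarrow> L 0 F = 0" using L_plus[of F 0 0] by simp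
lemma R_zero: "F \<in> NN \<Longrightarrow> R 0 F = 0" using R_plus[of F 0 0] by simp
lemma L_diff: "F \<in> NN \<Longrightarrow> G \<in> NN \<Longrightarrow> L c (F - G) = L c F - L c G"
  using L_add[of "F - G" G c] N_diff by (simp add: algebra_simps)
lemma R_diff: "F \<in> NN \<Longrightarrow> G \<in> NN \<Longrightarrow> R c (F - G) = R c F - R c G"
  using R_add[of "F - G" G c] N_diff by (simp add: algebra_simps)

abbreviation "DD \<equiv> Del L R"

lemma Del_0 [simp]: "DD c 0 F = 0" by (simp add: Del_def)

lemma Del_pCons:
  assumes "F \<in> NN" shows "DD c (pCons b p) F = L (hp p) F + R (hp [:c, 1:]) (DD c p F)"
  unfolding Del_def by (rule prec_pCons) (simp add: L_zero assms)

lemma Del_in: "F \<in> NN \<Longrightarrow> DD c p F \<in> NN"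
  by (induction p) (auto simp: Del_pCons N_0 intro!: N_add L_in R_in)

lemma Del_add: "F \<in> NN \<Longrightarrow> G \<in> NN \<Longrightarrow> DD c p (F + G) = DD c p F + DD c p G"
  by (induction p) (auto simp: Del_pCons N_add L_add R_add Del_in algebra_simps)

lemma Del_zero [simp]: "DD c p 0 = 0" using Del_add[OF N_0 N_0] by simp

lemma Del_diff: "F \<in> NN \<Longrightarrow> G \<in> NN \<Longrightarrow> DD c p (F - G) = DD c p F - DD c p G"
  using Del_add[of "F - G" G c p] N_diff by (simp add: algebra_simps)

lemma Del_plus: "F \<in> NN \<Longrightarrow> DD c (p + q) F = DD c p F + DD c q F"
proof (induction p q rule: poly_induct2)
  case (pCons b p e q)
  then show ?case by (simp add: Del_pCons hp_add L_plus R_add Del_in algebra_simps)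
qed simp

lemma L_hp_comm: "F \<in> NN \<Longrightarrow> L (hp p) (L (hp q) F) = L (hp q) (L (hp p) F)"
  by (metis L_mul hp_mult mult.commute)

lemma R_hp_comm: "F \<in> NN \<Longrightarrow> R (hp p) (R (hp q) F) = R (hp q) (R (hp p) F)"
  by (metis R_mul hp_mult mult.commute)

lemma Del_L: "F \<in> NN \<Longrightarrow> DD c p (L (hp q) F) = L (hp q) (DD c p F)"
  by (induction p) (auto simp: Del_pCons L_in R_in L_add LR Del_in L_hp_comm)

lemma Del_R: "F \<in> NN \<Longrightarrow> DD c p (R (hp q) F) = R (hp q) (DD c p F)"
proof (induction p)
  case (pCons b p)
  then show ?case
    using R_hp_comm[OF Del_in[OF pCons.prems], of q "[:c,1:]" c p]
    by (simp add: Del_pCons R_in R_add L_in Del_in LR)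
qed simp

lemma Del_smult: "F \<in> NN \<Longrightarrow> DD c (smult e p) F = L (hp [:e:]) (DD c p F)"
proof (induction p)
  case (pCons b p)
  have "hp (smult e p) = hp [:e:] \<odot> hp p" using hp_mult[of "[:e:]" p] by simp
  then show ?case using pCons by (simp add: Del_pCons L_mul L_add L_in R_in Del_in LR)
qed simp

text \<open>Telescoping of Horner's rule for p(U) - p(V); constant coefficients cancel by
  \<open>L_const\<close>.\<close>

lemma Del_eta: "F \<in> NN \<Longrightarrow> DD c p (L (hp [:0, 1:]) F - R (hp [:c, 1:]) F) = L (hp p) F - R (hp (sh c p)) F"
proof (induction p)
  case 0 then show ?case by (simp add: L_zero R_zero)
next
  case (pCons b p)
  have L1: "L (hp (pCons b p)) F = L (hp [:b:]) F + L (hp p) (L (hp [:0, 1:]) F)"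
  proof -
    have "pCons b p = [:b:] + p * [:0, 1:]" by simp
    then show ?thesis using pCons.prems by (metis L_mul L_plus hp_add hp_mult)
  qed
  have R1: "R (hp (sh c (pCons b p))) F = R (hp [:b:]) F + R (hp [:c, 1:]) (R (hp (sh c p)) F)"
  proof -
    have "sh c (pCons b p) = [:b:] + sh c p * [:c, 1:]" by (simp add: sh_pCons)
    then show ?thesis using pCons.prems by (metis R_mul R_plus hp_add hp_mult)
  qed
  show ?case unfolding L1 R1 using pCons
    by (simp add: Del_pCons N_diff L_in R_in L_diff R_diff LR L_const)
qed

lemma L_X_hp: "F \<in> NN \<Longrightarrow> L (X l) (L (hp p) F) = L (hp (sh (- ss l) p)) (L (X l) F)"
  by (metis L_mul X_hp)

lemma R_X_hp: "F \<in> NN \<Longrightarrow> R (X l) (R (hp p) F) = R (hp (sh (ss l) p)) (R (X l) F)"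
  by (metis R_mul hp_X)

text \<open>A divided difference is unchanged when both of its arguments are translated. A letter
  acting from the left translates only the left copy of h; translating both copies back moves the
  shift into the polynomial and into the offset of the right copy.\<close>

lemma L_X_Del: "F \<in> NN \<Longrightarrow> L (X l) (DD c p F) = DD (c + ss l) (sh (- ss l) p) (L (X l) F)"
proof (induction p)
  case (pCons b p)
  let ?s = "ss l" and ?q = "sh (- ss l) p" and ?G = "L (X l) F"
  have G: "?G \<in> NN" using pCons by (simp add: L_in)
  have "sh (- ?s) (pCons b p) = [:b:] + (smult (- ?s) ?q + pCons 0 ?q)" by (simp add: sh_pCons)
  then have "DD (c + ?s) (sh (- ?s) (pCons b p)) ?G
     = L (hp [:- ?s:]) (DD (c + ?s) ?q ?G) + (L (hp ?q) ?G + R (hp [:c + ?s, 1:]) (DD (c + ?s) ?q ?G))"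
    by (simp only: Del_plus[OF G] Del_smult[OF G] Del_pCons[OF G] hp_0 L_zero[OF G] Del_0 R_0 add_0_left)
  also have "\<dots> = L (hp ?q) ?G + R (hp [:c, 1:]) (DD (c + ?s) ?q ?G)"
  proof -
    have "[:c, 1:] = [:- ?s:] + [:c + ?s, 1:]" by simp
    then have "R (hp [:c, 1:]) (DD (c + ?s) ?q ?G)
       = R (hp [:- ?s:]) (DD (c + ?s) ?q ?G) + R (hp [:c + ?s, 1:]) (DD (c + ?s) ?q ?G)"
      by (metis Del_in G R_plus hp_add)
    then show ?thesis using G by (simp add: L_const Del_in)
  qed
  finally show ?case using pCons by (simp add: Del_pCons L_add L_in R_in Del_in LR L_X_hp)
qed simp

lemma R_X_Del: "F \<in> NN \<Longrightarrow> R (X l) (DD c p F) = DD (c + ss l) p (R (X l) F)"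
  by (induction p) (auto simp: Del_pCons R_add L_in R_in Del_in LR R_X_hp sh_lin)

abbreviation "inN f \<equiv> (\<forall>l. f l \<in> NN)"

lemma dlt_in: "inN f \<Longrightarrow> dlt L R e f l \<in> NN"
  by (auto simp: dlt_def N_diff N_add L_in R_in)
lemma eta_in: "inN f \<Longrightarrow> eta L R e f l \<in> NN"
  by (auto simp: eta_def N_diff N_add L_in R_in)
lemma tau_in: "inN f \<Longrightarrow> tau L R e f l \<in> NN"
  by (auto simp: tau_def Del_in)

lemma dlt_diff: "inN f \<Longrightarrow> inN g \<Longrightarrow> dlt L R e (f - g) = dlt L R e f - dlt L R e g"
  by (rule ext) (simp add: dlt_def L_diff R_diff)
lemma eta_diff: "inN f \<Longrightarrow> inN g \<Longrightarrow> eta L R e (f - g) = eta L R e f - eta L R e g"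
  by (rule ext) (simp add: eta_def L_diff R_diff)
lemma tau_diff: "inN f \<Longrightarrow> inN g \<Longrightarrow> tau L R e (f - g) = tau L R e f - tau L R e g"
  by (rule ext) (simp add: tau_def Del_diff)
lemma dlt_0 [simp]: "dlt L R e 0 = 0" by (rule ext) (simp add: dlt_def)
lemma eta_0 [simp]: "eta L R e 0 = 0" by (rule ext) (simp add: eta_def)
lemma tau_0 [simp]: "tau L R e 0 = 0" by (rule ext) (simp add: tau_def)

text \<open>\<open>dlt\<close> strips the first letter of a word to the left or the last one to the
  right. In the square the mixed terms cancel, and the two remaining terms are the polynomial
  \<open>al l\<close> evaluated at the left and at the twisted right copy of h. Their difference
  factors through \<open>eta\<close> by \<open>Del_eta\<close>.\<close>

lemma dlt_dlt: 
  assumes "inN f"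
  shows "dlt L R (\<not> e) (dlt L R e f) = tau L R e (eta L R e f)"
proof (rule ext)
  fix l
  have LL: "L (X l) (L (X (\<not> l)) (f l)) = L (hp (al l)) (f l)"
    using assms L_mul[of "f l" "X l" "X (\<not> l)"] by (simp add: X_X)
  have RR: "R (X (\<not> l)) (R (X l) (f l)) = R (hp (al l)) (f l)"
    using assms R_mul[of "f l" "X l" "X (\<not> l)"] by (simp add: X_X)
  have RR': "R (X l) (R (X (\<not> l)) (f l)) = R (hp (al (\<not> l))) (f l)"
    using assms R_mul[of "f l" "X (\<not> l)" "X l"] X_X[of "\<not> l"] by simp
  show "dlt L R (\<not> e) (dlt L R e f) l = tau L R e (eta L R e f) l"
  proof (cases e)
    case True
    then show ?thesis using assms LL RR
      by (simp add: dlt_def tau_def eta_def dg_def Del_eta L_diff R_diff L_in R_in LR)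
  next
    case False
    then show ?thesis using assms LL RR'
      by (simp add: dlt_def tau_def eta_def dg_def Del_eta sh_al' L_add R_add L_in R_in LR)
  qed
qed

text \<open>The twists of even and odd words differ by exactly the shift that h undergoes when it
  passes the added letter.\<close>

lemma eta_dlt:
  assumes "inN f"
  shows "eta L R (\<not> e) (dlt L R e f) = dlt L R e (eta L R e f)"
proof (rule ext)
  fix l
  have Lh: "L (X l) (L (hp [:0, 1:]) F) = L (hp [:0, 1:]) (L (X l) F) - R (hp [:ss l:]) (L (X l) F)"
    if "F \<in> NN" for F
  proof -
    have "sh (- ss l) [:0, 1:] + [:ss l:] = [:0, 1:]" by (simp add: sh_lin)
    then have "L (hp [:0, 1:]) (L (X l) F) = L (hp (sh (- ss l) [:0, 1:])) (L (X l) F) + L (hp [:ss l:]) (L (X l) F)"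
      using that by (metis L_in L_plus hp_add)
    then show ?thesis using that by (simp add: L_X_hp L_const L_in)
  qed
  have Rc: "R (hp [:c + e, 1:]) F = R (hp [:c:]) F + R (hp [:e, 1:]) F" if "F \<in> NN" for F c e
  proof -
    have "[:c + e, 1:] = [:c:] + [:e, 1:]" by simp
    then show ?thesis using that by (metis R_plus hp_add)
  qed
  show "eta L R (\<not> e) (dlt L R e f) l = dlt L R e (eta L R e f) l"
  proof (cases e)
    case True
    then show ?thesis using assms Rc[of "L (X l) (f (\<not> l))" "ss l" 0] 
      by (simp add: dlt_def eta_def dg_def L_diff R_diff L_in R_in LR Lh R_X_hp sh_lin)
  next
    case False
    then show ?thesis using assms Rc[of "L (X l) (f (\<not> l))" "ss l" "- ss l"]
      R_X_hp[of "f l" "\<not> l" "[:ss l, 1:]"]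
      by (simp add: dlt_def eta_def dg_def L_diff R_diff L_add R_add L_in R_in LR Lh sh_lin)
  qed
qed

lemma eta_tau:
  assumes "inN g"
  shows "eta L R e (tau L R e g) = tau L R e (eta L R e g)"
  by (rule ext) (use assms in \<open>simp add: eta_def tau_def Del_diff L_in R_in Del_L Del_R\<close>)

text \<open>Besides the shifts of the divided differences, this needs that passing
  \<open>X l\<close> takes \<open>al (\<not> l)\<close> to \<open>al l\<close>.\<close>

lemma dlt_tau:
  assumes "inN g"
  shows "dlt L R e (tau L R e g) = tau L R (\<not> e) (dlt L R e g)"
proof (rule ext)
  fix l
  show "dlt L R e (tau L R e g) l = tau L R (\<not> e) (dlt L R e g) l"
    using assms R_X_Del[of "g l" "\<not> l"]
    by (cases e) (simp_all add: dlt_def tau_def dg_def Del_diff Del_add L_in R_in L_X_Del R_X_Del sh_al)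
qed

abbreviation "KN \<equiv> Kc NN"

lemma Kc_inN: "(f, g) \<in> KN n \<Longrightarrow> inN f \<and> inN g" by (auto simp: Kc_def)

lemma sd_in: assumes "x \<in> KN n" shows "sd L R n x \<in> KN (Suc n)"
proof -
  obtain f g where x: "x = (f, g)" by (cases x)
  have fg: "inN f" "inN g" using assms by (auto simp: x Kc_def)
  then have "inN (dlt L R (even n) f - tau L R (odd n) g)" "inN (eta L R (even n) f - dlt L R (odd n) g)"
    by (auto intro!: N_diff dlt_in eta_in tau_in)
  then show ?thesis using assms by (auto simp: x Kc_def sd_def eta_def dg_def)
qed

lemma sd_diff: "x \<in> KN n \<Longrightarrow> y \<in> KN n \<Longrightarrow> sd L R n (x - y) = sd L R n x - sd L R n y"
  by (cases x; cases y) (auto dest!: Kc_inN simp: sd_def dlt_diff eta_diff tau_diff)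

lemma sd_sd:
  assumes "x \<in> KN n" shows "sd L R (Suc n) (sd L R n x) = 0"
proof -
  obtain f g where x: "x = (f, g)" by (cases x)
  have fg: "inN f" "inN g" using assms by (auto simp: x Kc_def)
  have in': "inN (dlt L R e f)" "inN (eta L R e f)" "inN (tau L R e g)" "inN (dlt L R e g)" for e
    using fg by (auto intro: dlt_in eta_in tau_in)
  show ?thesis unfolding x sd_def
    using dlt_dlt[OF fg(1), of "even n"] dlt_dlt[OF fg(2), of "odd n"] eta_dlt[OF fg(1), of "even n"]
      dlt_tau[OF fg(2), of "odd n"] eta_tau[OF fg(2), of "odd n"]
    by (simp add: dlt_diff eta_diff tau_diff in' zero_prod_def)
qed

end

section \<open>Naturality of the small complex in its coefficients\<close>

definition mapK :: "('n \<Rightarrow> 'm) \<Rightarrow> (bool \<Rightarrow> 'n) \<times> (bool \<Rightarrow> 'n) \<Rightarrow> (bool \<Rightarrow> 'm) \<times> (bool \<Rightarrow> 'm)" where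
  "mapK \<Theta> = (\<lambda>(f, g). (\<lambda>l. \<Theta> (f l), \<lambda>l. \<Theta> (g l)))"

text \<open>One naturality proof serves the slices of multilinear maps, the bar differential, the
  edge map \<open>alf\<close> and scalar multiplication, all of which must commute with
  \<open>sd\<close>.\<close>

locale bimod_hom = N: bimod mul one sm a h0 hp X bs bext ss al NN L R +
    M: bimod mul one sm a h0 hp X bs bext ss al MM L' R'
  for mul :: "'a::ab_group_add \<Rightarrow> 'a \<Rightarrow> 'a" (infixl "\<odot>" 70) and one :: 'a
    and sm :: "'k::field \<Rightarrow> 'a \<Rightarrow> 'a"
    and a h0 hp X bs bext ss al
    and NN :: "'n::ab_group_add set" and L R and MM :: "'m::ab_group_add set" and L' R' +
  fixes \<Theta> :: "'n \<Rightarrow> 'm"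
  assumes Th_in: "F \<in> NN \<Longrightarrow> \<Theta> F \<in> MM"
    and Th_add: "F \<in> NN \<Longrightarrow> G \<in> NN \<Longrightarrow> \<Theta> (F + G) = \<Theta> F + \<Theta> G"
    and Th_L: "F \<in> NN \<Longrightarrow> \<Theta> (L c F) = L' c (\<Theta> F)"
    and Th_R: "F \<in> NN \<Longrightarrow> \<Theta> (R c F) = R' c (\<Theta> F)"
begin

lemma Th_0: "\<Theta> 0 = 0" using Th_add[OF N.N_0 N.N_0] by simp

lemma Th_diff: "F \<in> NN \<Longrightarrow> G \<in> NN \<Longrightarrow> \<Theta> (F - G) = \<Theta> F - \<Theta> G"
  using Th_add[of "F - G" G] N.N_diff by (simp add: algebra_simps)

lemma Th_Del: "F \<in> NN \<Longrightarrow> \<Theta> (N.Del L R c p F) = N.Del L' R' c p (\<Theta> F)"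
  by (induction p) (auto simp: Th_0 N.Del_pCons M.Del_pCons Th_in Th_add Th_L Th_R N.L_in N.R_in N.Del_in)

lemma mapK_in: "x \<in> N.Kc NN n \<Longrightarrow> mapK \<Theta> x \<in> N.Kc MM n"
  by (auto simp: mapK_def N.Kc_def Th_in Th_0 M.N_0 split: if_splits)

lemma mapK_sd:
  assumes "x \<in> N.Kc NN n"
  shows "mapK \<Theta> (N.sd L R n x) = N.sd L' R' n (mapK \<Theta> x)"
proof -
  obtain f g where x: "x = (f, g)" by (cases x)
  have fg: "f l \<in> NN" "g l \<in> NN" for l using assms by (auto simp: x N.Kc_def)
  show ?thesis
    by (auto simp: x mapK_def N.sd_def N.dlt_def N.eta_def N.tau_def fg Th_diff Th_add Th_L Th_R Th_Del
       N.L_in N.R_in N.Del_in N.N_diff N.N_add fun_eq_iff)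
qed

end

section \<open>Exactness of the columns\<close>

context gwalg
begin

definition L1 :: "'a \<Rightarrow> ('a \<Rightarrow> 'a) \<Rightarrow> 'a \<Rightarrow> 'a" where "L1 c F = (\<lambda>b. c \<odot> F b)"
definition R1 :: "'a \<Rightarrow> ('a \<Rightarrow> 'a) \<Rightarrow> 'a \<Rightarrow> 'a" where "R1 c F = (\<lambda>b. F (c \<odot> b))"

text \<open>With coefficients Hom_k(A, A), Hochschild cohomology is Ext_A(A, A), that is A in degree
  0 and zero above. The contraction that follows makes this explicit for the small complex.\<close>

sublocale N1: bimod mul one sm a h0 hp X bs bext ss al "{F. lin F}" L1 R1
proof unfold_locales
  fix F G c
  assume F: "F \<in> {F. lin F}"
  show "L1 c F \<in> {F. lin F}" using F by (simp add: L1_def lin_mul_left)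
  show "R1 c F \<in> {F. lin F}" using lin_comp[OF _ lin_mul_left[OF lin_id], of F] F by (simp add: R1_def)
  show "G \<in> {F. lin F} \<Longrightarrow> F - G \<in> {F. lin F}" using F by (simp add: lin_minus fun_diff_def)
  show "L1 c (F + G) = L1 c F + L1 c G" by (simp add: L1_def fun_eq_iff mul_add_right)
  show "R1 c (F + G) = R1 c F + R1 c G" by (simp add: R1_def fun_eq_iff)
  fix e b
  show "L1 (c + e) F = L1 c F + L1 e F" by (simp add: L1_def fun_eq_iff mul_add_left)
  show "R1 (c + e) F = R1 c F + R1 e F" using F by (simp add: R1_def fun_eq_iff mul_add_left lin_add)
  show "L1 (c \<odot> e) F = L1 c (L1 e F)" by (simp add: L1_def mul_assoc)
  show "R1 (c \<odot> e) F = R1 e (R1 c F)" by (simp add: R1_def mul_assoc)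
  show "L1 c (R1 e F) = R1 e (L1 c F)" by (simp add: R1_def L1_def)
  show "L1 (hp [:b:]) F = R1 (hp [:b:]) F" using F by (simp add: R1_def L1_def hp_mul_const lin_sm)
qed (auto simp: zero_fun_def)

lemma hp_mul_add: "hp (p + q) \<odot> t = hp p \<odot> t + hp q \<odot> t" by (simp add: hp_add mul_add_left)
lemma hp_mul_smult: "hp (smult c p) \<odot> t = sm c (hp p \<odot> t)" by (simp add: hp_smult sm_mul_left)
lemma hp_mul_mul: "hp p \<odot> (hp q \<odot> t) = hp (p * q) \<odot> t" by (simp add: hp_mult mul_assoc)

text \<open>The solution \<open>F\<close> of \<open>hp h \<odot> F b - F (hp (h + c) \<odot> b) = \<phi> b\<close> that vanishes on the elements \<open>bs j\<close>, by recursion on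
  the power of \<open>h\<close>.\<close>

definition kp :: "'k \<Rightarrow> ('a \<Rightarrow> 'a) \<Rightarrow> int \<Rightarrow> 'k poly \<Rightarrow> 'a" where
  "kp c \<phi> j p = prec (\<lambda>q w. hp [:- c, 1:] \<odot> w - \<phi> (hp q \<odot> bs j)) p"

lemma kp_0 [simp]: "kp c \<phi> j 0 = 0" by (simp add: kp_def)

lemma kp_pCons: "lin \<phi> \<Longrightarrow> kp c \<phi> j (pCons b p) = hp [:- c, 1:] \<odot> kp c \<phi> j p - \<phi> (hp p \<odot> bs j)"
  unfolding kp_def by (rule prec_pCons) (simp add: lin_0)

lemma kp_add: "lin \<phi> \<Longrightarrow> kp c \<phi> j (p + q) = kp c \<phi> j p + kp c \<phi> j q"
proof (induction p q rule: poly_induct2)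
  case (pCons b p e q)
  then show ?case by (simp add: kp_pCons mul_add_right hp_mul_add lin_add)
qed simp

lemma kp_smult: "lin \<phi> \<Longrightarrow> kp c \<phi> j (smult e p) = sm e (kp c \<phi> j p)"
  by (induction p) (simp_all add: kp_pCons sm_mul_right hp_mul_smult lin_sm sm_diff_right)

lemma kp_plus: "lin \<phi> \<Longrightarrow> lin \<phi>' \<Longrightarrow> kp c (\<lambda>x. \<phi> x + \<phi>' x) j p = kp c \<phi> j p + kp c \<phi>' j p"
  by (induction p) (simp_all add: kp_pCons lin_plus mul_add_right)

lemma kp_scale: "lin \<phi> \<Longrightarrow> kp c (\<lambda>x. sm e (\<phi> x)) j p = sm e (kp c \<phi> j p)"
  by (induction p) (simp_all add: kp_pCons lin_scale sm_mul_right sm_diff_right)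

definition kap :: "'k \<Rightarrow> ('a \<Rightarrow> 'a) \<Rightarrow> 'a \<Rightarrow> 'a" where "kap c \<phi> = bext (kp c \<phi>)"

lemma kap_lin: "lin \<phi> \<Longrightarrow> lin (kap c \<phi>)"
  unfolding kap_def by (rule bext_lin) (auto simp: kp_add kp_smult)

lemma kap_bs: "lin \<phi> \<Longrightarrow> kap c \<phi> (hp p \<odot> bs j) = kp c \<phi> j p"
  unfolding kap_def by (rule bext_bs) (rule kp_add)

lemma kap_plus:
  assumes "lin \<phi>" "lin \<phi>'"
  shows "kap c (\<lambda>x. \<phi> x + \<phi>' x) = (\<lambda>x. kap c \<phi> x + kap c \<phi>' x)"
  by (rule basis_eq) (simp_all add: assms kap_lin lin_plus kap_bs kp_plus)

lemma kap_scale: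
  assumes "lin \<phi>"
  shows "kap c (\<lambda>x. sm e (\<phi> x)) = (\<lambda>x. sm e (kap c \<phi> x))"
  by (rule basis_eq) (simp_all add: assms kap_lin lin_scale kap_bs kp_scale)

text \<open>Because A is free over k[h], the commutator with h has a linear right inverse on
  Hom_k(A, A): the values on \<open>bs j\<close> may be prescribed, and the equation determines the
  others by recursion on the power of h.\<close>

lemma kap_eta:
  assumes "lin \<phi>"
  shows "L1 (hp [:0, 1:]) (kap c \<phi>) - R1 (hp [:c, 1:]) (kap c \<phi>) = \<phi>"
proof (rule basis_eq)
  let ?K = "kap c \<phi>"
  have K: "lin ?K" using assms by (rule kap_lin)
  show "lin (L1 (hp [:0, 1:]) ?K - R1 (hp [:c, 1:]) ?K)"
    using N1.N_diff[OF N1.L_in N1.R_in, of ?K ?K] K by simp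
  show "lin \<phi>" by fact
  fix p j
  \<comment> \<open>Splitting off \<open>pCons 0 p\<close>, which is h p, exposes the recursion step
    of \<open>kp\<close>.\<close>
  have "[:c, 1:] * p = smult c p + pCons 0 p" by simp
  then have "?K (hp [:c, 1:] \<odot> (hp p \<odot> bs j)) = ?K (hp (smult c p) \<odot> bs j) + ?K (hp (pCons 0 p) \<odot> bs j)"
    by (simp only: hp_mul_mul hp_mul_add lin_add[OF K])
  also have "\<dots> = sm c (kp c \<phi> j p) + (hp [:- c, 1:] \<odot> kp c \<phi> j p - \<phi> (hp p \<odot> bs j))"
    by (simp add: kap_bs assms kp_smult kp_pCons)
  also have "sm c (kp c \<phi> j p) + (hp [:- c, 1:] \<odot> kp c \<phi> j p - \<phi> (hp p \<odot> bs j))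
      = hp ([:c:] + [:- c, 1:]) \<odot> kp c \<phi> j p - \<phi> (hp p \<odot> bs j)"
    by (simp only: hp_mul_add hp_mul_const) simp
  finally show "(L1 (hp [:0, 1:]) ?K - R1 (hp [:c, 1:]) ?K) (hp p \<odot> bs j) = \<phi> (hp p \<odot> bs j)"
    by (simp add: L1_def R1_def kap_bs assms)
qed

text \<open>Kernel of the twisted commutator. Its members are k[h]-linear up to translation by -c,
  hence freely determined by their values on \<open>bs j\<close>.\<close>

definition rel :: "'k \<Rightarrow> ('a \<Rightarrow> 'a) \<Rightarrow> bool" where
  "rel c F \<longleftrightarrow> lin F \<and> L1 (hp [:0, 1:]) F - R1 (hp [:c, 1:]) F = 0"

lemma rel_hp:
  assumes "rel c F"
  shows "F (hp p \<odot> b) = hp (sh (- c) p) \<odot> F b"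
proof (induction p)
  case 0 then show ?case using assms by (simp add: rel_def lin_0)
next
  case (pCons e p)
  have F: "lin F" and h: "hp [:0, 1:] \<odot> F b = F (hp [:c, 1:] \<odot> b)" for b
    using assms by (auto simp: rel_def L1_def R1_def fun_eq_iff)
  have "pCons e p = [:e:] + (smult (- c) p + [:c, 1:] * p)" by simp
  then have "F (hp (pCons e p) \<odot> b) = sm e (F b) + (sm (- c) (F (hp p \<odot> b)) + F (hp [:c, 1:] \<odot> (hp p \<odot> b)))"
    by (simp only: hp_mul_mul hp_mul_add hp_mul_smult hp_mul_const lin_add[OF F] lin_sm[OF F])
  also have "\<dots> = sm e (F b) + (sm (- c) (hp (sh (- c) p) \<odot> F b) + hp [:0, 1:] \<odot> (hp (sh (- c) p) \<odot> F b))"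
    by (simp only: h[symmetric] pCons.IH)
  also have "\<dots> = hp ([:e:] + (smult (- c) (sh (- c) p) + [:0, 1:] * sh (- c) p)) \<odot> F b"
    by (simp only: hp_mul_mul hp_mul_add hp_mul_smult hp_mul_const)
  also have "[:e:] + (smult (- c) (sh (- c) p) + [:0, 1:] * sh (- c) p) = sh (- c) (pCons e p)"
    by (simp add: sh_pCons)
  finally show ?case .
qed

lemma rel_eq:
  assumes "rel c F" "rel c G" "\<And>j. F (bs j) = G (bs j)"
  shows "F = G"
  by (rule basis_eq) (use assms in \<open>auto simp: rel_hp[OF assms(1)] rel_hp[OF assms(2)] rel_def\<close>)

definition rext :: "'k \<Rightarrow> (int \<Rightarrow> 'a) \<Rightarrow> 'a \<Rightarrow> 'a" where
  "rext c G = bext (\<lambda>j p. hp (sh (- c) p) \<odot> G j)"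

lemma rext_hp: "rext c G (hp p \<odot> bs j) = hp (sh (- c) p) \<odot> G j"
  unfolding rext_def by (rule bext_bs) (simp add: sh_add hp_mul_add)

lemma rext_bs: "rext c G (bs j) = G j"
  using rext_hp[of c G 1 j] by (simp add: hp_1)

lemma rext_lin: "lin (rext c G)"
  unfolding rext_def by (rule bext_lin) (simp_all add: sh_add hp_mul_add sh_smult hp_mul_smult)

lemma rext_rel: "rel c (rext c G)"
  unfolding rel_def
proof (intro conjI rext_lin basis_eq)
  show "lin (L1 (hp [:0, 1:]) (rext c G) - R1 (hp [:c, 1:]) (rext c G))"
    using N1.N_diff[OF N1.L_in N1.R_in, of "rext c G" "rext c G"] rext_lin by simp
  show "lin 0" by (simp add: zero_fun_def)
  fix p j
  show "(L1 (hp [:0, 1:]) (rext c G) - R1 (hp [:c, 1:]) (rext c G)) (hp p \<odot> bs j) = 0 (hp p \<odot> bs j)"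
    by (simp add: L1_def R1_def hp_mul_mul rext_hp sh_mult[symmetric] del: mult_pCons_left)
      (simp add: sh_mult sh_lin del: mult_pCons_left)
qed

lemma rext_plus: "rext c (\<lambda>j. G j + G' j) = (\<lambda>x. rext c G x + rext c G' x)"
  by (rule basis_eq) (simp_all add: rext_lin lin_plus rext_hp mul_add_right)

lemma rext_scale: "rext c (\<lambda>j. sm e (G j)) = (\<lambda>x. sm e (rext c G x))"
  by (rule basis_eq) (simp_all add: rext_lin lin_scale rext_hp sm_mul_right)

text \<open>The relative resolution is contracted by moving a letter of the monomial \<open>bs j\<close> into the word in front of
  it whenever the longer word is again alternating.\<close>

primrec gz :: "(bool \<Rightarrow> 'a \<Rightarrow> 'a) \<Rightarrow> bool \<Rightarrow> nat \<Rightarrow> 'a" where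
  "gz f l 0 = 0"
| "gz f l (Suc k) = X l \<odot> gz f l k - f l (bs (sg l * int k))"

definition G0 :: "(bool \<Rightarrow> 'a \<Rightarrow> 'a) \<Rightarrow> int \<Rightarrow> 'a" where
  "G0 f j = gz f (0 \<le> j) (nat \<bar>j\<bar>)"

text \<open>An even word starting with \<open>l\<close> ends with the other letter, so it can absorb
  a leading \<open>l\<close> of the monomial; an odd one ends with \<open>l\<close> and absorbs the
  other letter. The empty word absorbs either, and there the telescoping recursion \<open>gz\<close>
  takes over.\<close>

definition G1 :: "bool \<Rightarrow> (bool \<Rightarrow> 'a \<Rightarrow> 'a) \<Rightarrow> bool \<Rightarrow> int \<Rightarrow> 'a" where
  "G1 e f l j = (if e then (if 0 < sg l * j then - f l (bs (j - sg l)) else 0)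
                 else (if sg l * j < 0 then f l (bs (j + sg l)) else 0))"

definition contr :: "nat \<Rightarrow> (bool \<Rightarrow> 'a \<Rightarrow> 'a) \<Rightarrow> bool \<Rightarrow> 'a \<Rightarrow> 'a" where
  "contr m f l = (if m = 0 then rext 0 (G0 f) else rext (dg (even m) l) (G1 (even m) f l))"

lemma gz_plus: "gz (\<lambda>l b. f l b + g l b) l k = gz f l k + gz g l k"
  by (induction k) (simp_all add: mul_add_right)
lemma gz_scale: "gz (\<lambda>l b. sm c (f l b)) l k = sm c (gz f l k)"
  by (induction k) (simp_all add: sm_diff_right sm_mul_right)

lemma contr_plus: "contr m (\<lambda>l b. f l b + g l b) = (\<lambda>l b. contr m f l b + contr m g l b)"
proof -
  have "G0 (\<lambda>l b. f l b + g l b) = (\<lambda>j. G0 f j + G0 g j)" by (simp add: G0_def gz_plus fun_eq_iff)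
  moreover have "G1 e (\<lambda>l b. f l b + g l b) l = (\<lambda>j. G1 e f l j + G1 e g l j)" for e l
    by (simp add: G1_def fun_eq_iff)
  ultimately show ?thesis by (intro HOL.ext) (simp add: contr_def rext_plus)
qed

lemma contr_scale: "contr m (\<lambda>l b. sm c (f l b)) = (\<lambda>l b. sm c (contr m f l b))"
proof -
  have "G0 (\<lambda>l b. sm c (f l b)) = (\<lambda>j. sm c (G0 f j))" by (simp add: G0_def gz_scale fun_eq_iff)
  moreover have "G1 e (\<lambda>l b. sm c (f l b)) l = (\<lambda>j. sm c (G1 e f l j))" for e l
    by (simp add: G1_def fun_eq_iff sm_minus_right)
  ultimately show ?thesis by (intro HOL.ext) (simp add: contr_def rext_scale)
qed

lemma contr_lin: "lin (contr m f l)" by (simp add: contr_def rext_lin)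

lemma contr_rel: "rel (dg (even m) l) (contr m f l)"
  by (auto simp: contr_def rext_rel) (simp add: dg_def rext_rel)

lemma contr_eta: "eta L1 R1 (even m) (contr m f) = 0"
  using contr_rel[of m _ f] by (simp add: eta_def rel_def fun_eq_iff)

lemma G0_sg: "G0 f (sg l * int k) = gz f l k"
  by (cases k) (auto simp: G0_def sg_def nat_add_distrib)

text \<open>Both sides lie in the kernel of the commutator, so it suffices to compare them on
  \<open>bs j\<close>. Where a letter lengthens the monomial, the definition of the contraction
  gives the value; where it cancels, the cocycle condition rewrites the other summand.\<close>

lemma contr_dlt:
  assumes f: "\<And>l. rel (dg (odd m) l) (f l)" and cyc: "dlt L1 R1 (odd m) f = 0"
  shows "dlt L1 R1 (even m) (contr m f) = f"
proof (rule HOL.ext)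
  fix l
  let ?F = "contr m f"
  have F: "N1.inN ?F" by (simp add: contr_lin)
  have "eta L1 R1 (\<not> even m) (dlt L1 R1 (even m) ?F) = 0"
    using N1.eta_dlt[OF F] by (simp add: contr_eta)
  then have rl: "rel (dg (odd m) l) (dlt L1 R1 (even m) ?F l)"
    using N1.dlt_in[OF F] by (auto simp: rel_def eta_def fun_eq_iff)
  have cyc': "dlt L1 R1 (odd m) f l b = 0" for b using cyc by simp
  show "dlt L1 R1 (even m) ?F l = f l"
  proof (rule rel_eq[OF rl f])
    fix j
    show "dlt L1 R1 (even m) ?F l (bs j) = f l (bs j)"
    proof (cases "even m")
      case True
      have c: "X l \<odot> f (\<not> l) b = - f l (X (\<not> l) \<odot> b)" for b
        using cyc'[of b] True by (simp add: dlt_def L1_def R1_def eq_neg_iff_add_eq_0)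
      have d: "dlt L1 R1 (even m) ?F l (bs j) = X l \<odot> ?F (\<not> l) (bs j) - ?F l (X l \<odot> bs j)"
        using True by (simp add: dlt_def L1_def R1_def)
      have rF: "rel 0 (?F l)" using contr_rel[of m l f] True by (simp add: dg_def)
      show ?thesis
      proof (cases "0 \<le> sg l * j")
        case jl: True
        show ?thesis
        proof (cases "m = 0")
          case m: True
          obtain k where k: "j = sg l * int k"
            using jl by (intro that[of "nat (sg l * j)"]) (auto simp: sg_def)
          have "j + sg l = sg l * int (Suc k)" by (simp add: k algebra_simps)
          then show ?thesis unfolding d X_bs[OF jl] using m k
            by (simp add: contr_def rext_bs G0_sg del: of_nat_Suc)
        next
          case m: False
          have "0 < sg l * (j + sg l)" "\<not> sg l * j < 0" using jl by (auto simp: sg_def split: if_splits)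
          then show ?thesis unfolding d X_bs[OF jl] using m True
            by (simp add: contr_def rext_bs G1_def)
        qed
      next
        case jl: False
        then have neg: "sg l * j < 0" by simp
        have Xb: "X (\<not> l) \<odot> bs (j + sg l) = bs j"
          using X_bs[of "\<not> l" "j + sg l"] neg by (auto simp: sg_def split: if_splits)
        show ?thesis
        proof (cases "m = 0")
          case m: True
          obtain k where k: "j = sg (\<not> l) * int (Suc k)"
            using neg by (intro that[of "nat (- sg l * j) - 1"]) (auto simp: sg_def split: if_splits)
          have jk: "j + sg l = sg (\<not> l) * int k" by (simp add: k algebra_simps)
          have "?F (\<not> l) (bs j) = X (\<not> l) \<odot> gz f (\<not> l) k - f (\<not> l) (bs (j + sg l))"
            unfolding jk unfolding k using m by (simp add: contr_def rext_bs G0_sg del: of_nat_Suc sg_not)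
          moreover have "?F l (X l \<odot> bs j) = hp (al l) \<odot> gz f (\<not> l) k"
            unfolding X_bs_neg[OF neg] rel_hp[OF rF] unfolding jk using m
            by (simp add: contr_def rext_bs G0_sg del: sg_not)
          ultimately show ?thesis unfolding d
            by (simp add: mul_diff_right mul_assoc[symmetric] X_X c Xb)
        next
          case m: False
          have "\<not> 0 < sg l * (j + sg l)" "0 < - (sg l * j)" using neg by (auto simp: sg_def split: if_splits)
          then show ?thesis unfolding d X_bs_neg[OF neg] rel_hp[OF rF] using m True
            by (simp add: contr_def rext_bs G1_def mul_minus_right c Xb)
        qed
      qed
    next
      case False
      then have m: "m \<noteq> 0" by (metis even_zero)
      have c: "X l \<odot> f (\<not> l) b = f l (X l \<odot> b)" for b
        using cyc'[of b] False by (simp add: dlt_def L1_def R1_def)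
      have d: "dlt L1 R1 (even m) ?F l (bs j) = X l \<odot> ?F (\<not> l) (bs j) + ?F l (X (\<not> l) \<odot> bs j)"
        using False by (simp add: dlt_def L1_def R1_def)
      show ?thesis
      proof (cases "sg l * j \<le> 0")
        case jl: True
        have "0 \<le> sg (\<not> l) * j" "sg l * (j - sg l) < 0" using jl by (auto simp: sg_def split: if_splits)
        then show ?thesis unfolding d using m False jl
          by (simp add: X_bs contr_def rext_bs G1_def)
      next
        case jl: False
        have neg: "sg (\<not> l) * j < 0" "\<not> sg l * (j - sg l) < 0" using jl by (auto simp: sg_def split: if_splits)
        have Xb: "X l \<odot> bs (j - sg l) = bs j"
          using X_bs[of l "j - sg l"] jl by (auto simp: sg_def split: if_splits)
        show ?thesis unfolding d X_bs_neg[OF neg(1)] rel_hp[OF contr_rel] using m False jl neg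
          by (simp add: contr_def rext_bs G1_def c Xb)
      qed
    qed
  qed
qed

definition kapd :: "nat \<Rightarrow> (bool \<Rightarrow> 'a \<Rightarrow> 'a) \<Rightarrow> bool \<Rightarrow> 'a \<Rightarrow> 'a" where
  "kapd m g l = kap (dg (even m) l) (g l)"

text \<open>The second component is removed first, by inverting the commutator. The corrected first
  component then lies in the kernel of the commutator, where the relative contraction applies. The
  resulting primitive has second component zero.\<close>

definition contraction :: "nat \<Rightarrow> (bool \<Rightarrow> 'a \<Rightarrow> 'a) \<times> (bool \<Rightarrow> 'a \<Rightarrow> 'a) \<Rightarrow> bool \<Rightarrow> 'a \<Rightarrow> 'a" where
  "contraction m x l b = contr m (fst x - dlt L1 R1 (even m) (kapd m (snd x))) l b + kapd m (snd x) l b"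

lemma contraction_sd:
  assumes x: "x \<in> Kc {F. lin F} (Suc m)" and d: "sd L1 R1 (Suc m) x = 0"
  shows "(contraction m x, 0) \<in> Kc {F. lin F} m" "sd L1 R1 m (contraction m x, 0) = x"
proof -
  obtain f g where xfg: "x = (f, g)" by (cases x)
  have fg: "N1.inN f" "N1.inN g" using x by (auto simp: xfg Kc_def)
  have d1: "dlt L1 R1 (odd m) f = tau L1 R1 (even m) g" and d2: "eta L1 R1 (odd m) f = dlt L1 R1 (even m) g"
    using d by (auto simp: xfg sd_def zero_prod_def)
  let ?k = "kapd m g"
  have k: "N1.inN ?k" using fg by (auto simp: kapd_def kap_lin)
  have ek: "eta L1 R1 (even m) ?k = g"
    by (rule HOL.ext) (use fg in \<open>simp add: eta_def kapd_def kap_eta\<close>)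
  define f1 where "f1 = f - dlt L1 R1 (even m) ?k"
  have f1: "N1.inN f1" unfolding f1_def using fg N1.dlt_in[OF k] N1.N_diff by simp
  have k': "N1.inN (dlt L1 R1 (even m) ?k)" using N1.dlt_in[OF k] by blast
  have "dlt L1 R1 (odd m) f1 = 0"
    unfolding f1_def N1.dlt_diff[OF fg(1) k'] using N1.dlt_dlt[OF k, of "even m"] by (simp add: d1 ek)
  moreover have "eta L1 R1 (odd m) f1 = 0"
    unfolding f1_def N1.eta_diff[OF fg(1) k'] using N1.eta_dlt[OF k, of "even m"] by (simp add: d2 ek)
  then have "rel (dg (odd m) l) (f1 l)" for l
    using f1 by (auto simp: rel_def eta_def fun_eq_iff)
  ultimately have cd: "dlt L1 R1 (even m) (contr m f1) = f1" by (intro contr_dlt)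
  have S: "contraction m x = contr m f1 - (0 - ?k)" by (auto simp: contraction_def xfg f1_def fun_eq_iff)
  have c: "N1.inN (contr m f1)" by (simp add: contr_lin)
  have mk: "N1.inN (0 - ?k)" using k N1.N_diff[OF N1.N_0] by simp
  have z: "N1.inN 0" using N1.N_0 by simp
  have "N1.inN (contraction m x)" unfolding S using c k N1.N_add by simp
  moreover have "m = 0 \<Longrightarrow> ?k False = ?k True" using x by (auto simp: xfg Kc_def kapd_def dg_def)
  ultimately show "(contraction m x, 0) \<in> Kc {F. lin F} m"
    using z by (auto simp: Kc_def S contr_def zero_fun_def)
  have "dlt L1 R1 (even m) (contraction m x) = f"
    unfolding S N1.dlt_diff[OF c mk] N1.dlt_diff[OF z k] cd by (simp add: f1_def)
  moreover have "eta L1 R1 (even m) (contraction m x) = g"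
    unfolding S N1.eta_diff[OF c mk] N1.eta_diff[OF z k] contr_eta by (simp add: ek)
  ultimately show "sd L1 R1 m (contraction m x, 0) = x" by (simp add: sd_def xfg)
qed

lemma dlt_kapd_plus:
  assumes "N1.inN g" "N1.inN g'"
  shows "dlt L1 R1 e (kapd m (\<lambda>l b. g l b + g' l b)) = (\<lambda>l b. dlt L1 R1 e (kapd m g) l b + dlt L1 R1 e (kapd m g') l b)"
  using assms by (auto simp: kapd_def kap_plus dlt_def L1_def R1_def fun_eq_iff mul_add_right)

lemma dlt_kapd_scale:
  assumes "N1.inN g"
  shows "dlt L1 R1 e (kapd m (\<lambda>l b. sm c (g l b))) = (\<lambda>l b. sm c (dlt L1 R1 e (kapd m g) l b))"
  using assms by (auto simp: kapd_def kap_scale dlt_def L1_def R1_def fun_eq_iff sm_mul_right sm_diff_right sm_add_right)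

lemma contraction_plus:
  assumes "N1.inN g" "N1.inN g'"
  shows "contraction m (\<lambda>l b. f l b + f' l b, \<lambda>l b. g l b + g' l b) l b = contraction m (f, g) l b + contraction m (f', g') l b"
proof -
  let ?D = "\<lambda>g. dlt L1 R1 (even m) (kapd m g)"
  have "(\<lambda>l b. f l b + f' l b) - ?D (\<lambda>l b. g l b + g' l b) = (\<lambda>l b. (f - ?D g) l b + (f' - ?D g') l b)"
    unfolding dlt_kapd_plus[OF assms] by (simp add: fun_eq_iff)
  then show ?thesis using assms unfolding contraction_def
    by (simp add: contr_plus kapd_def kap_plus fun_diff_def)
qed

lemma contraction_scale:
  assumes "N1.inN g"
  shows "contraction m (\<lambda>l b. sm c (f l b), \<lambda>l b. sm c (g l b)) l b = sm c (contraction m (f, g) l b)"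
proof -
  let ?D = "\<lambda>g. dlt L1 R1 (even m) (kapd m g)"
  have "(\<lambda>l b. sm c (f l b)) - ?D (\<lambda>l b. sm c (g l b)) = (\<lambda>l b. sm c ((f - ?D g) l b))"
    unfolding dlt_kapd_scale[OF assms] by (simp add: fun_eq_iff sm_diff_right)
  then show ?thesis using assms unfolding contraction_def
    by (simp add: contr_scale kapd_def kap_scale sm_add_right fun_diff_def)
qed

text \<open>A cocycle of degree 0 commutes with left multiplication by h, x and y, hence is right
  multiplication by its value at the unit.\<close>

lemma sd_exact0:
  assumes x: "(f, g) \<in> Kc {F. lin F} 0" and d: "sd L1 R1 0 (f, g) = 0"
  shows "f l b = b \<odot> f l one"
proof -
  define F where "F = f l"
  have F: "f = (\<lambda>_. F)" using x by (auto simp: Kc_def F_def fun_eq_iff) (metis (full_types))+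
  have g: "g = 0" and Fl: "lin F" using x by (auto simp: Kc_def F)
  have "dlt L1 R1 True f = 0" "eta L1 R1 True f = 0"
    using d N1.dlt_0[of False] N1.tau_0[of False] by (auto simp: sd_def g zero_prod_def)
  then have X: "X l \<odot> F b = F (X l \<odot> b)" and h: "L1 (hp [:0, 1:]) F - R1 (hp [:0, 1:]) F = 0" for l b
    by (auto simp: dlt_def eta_def dg_def L1_def R1_def F fun_eq_iff)
  have r: "rel 0 F" using Fl h by (simp add: rel_def)
  have bsn: "F (bs (sg l * int k)) = bs (sg l * int k) \<odot> F one" for l k
  proof (induction k)
    case 0 then show ?case by (simp add: bs_0)
  next
    case (Suc k)
    have "0 \<le> sg l * (sg l * int k)" by (simp add: sg_def)
    from X_bs[OF this] have "bs (sg l * int (Suc k)) = X l \<odot> bs (sg l * int k)" by (simp add: algebra_simps)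
    then show ?case using Suc by (simp add: X[symmetric] mul_assoc)
  qed
  have "F (bs j) = bs j \<odot> F one" for j
    using bsn[of "0 \<le> j" "nat \<bar>j\<bar>"] by (cases "0 \<le> j") (auto simp: sg_def)
  then have "F = (\<lambda>b. b \<odot> F one)"
    by (intro basis_eq Fl lin_mul_right lin_id) (simp add: rel_hp[OF r] mul_assoc)
  then show ?thesis unfolding F_def by (rule fun_cong)
qed

end

section \<open>Comparison with the Hochschild complex\<close>

context gwalg
begin

definition R0 :: "'a \<Rightarrow> 'a \<Rightarrow> 'a" where "R0 c F = F \<odot> c"

sublocale N0: bimod mul one sm a h0 hp X bs bext ss al UNIV mul R0
  by unfold_locales
    (auto simp: R0_def mul_add_left mul_add_right mul_assoc hp_mul_const mul_hp_const)

section \<open>Multilinear maps as bimodules, the first argument being the module slot\<close>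

definition LL :: "'a \<Rightarrow> ('a list \<Rightarrow> 'a) \<Rightarrow> 'a list \<Rightarrow> 'a" where "LL c f = (\<lambda>xs. c \<odot> f xs)"
definition RL :: "'a \<Rightarrow> ('a list \<Rightarrow> 'a) \<Rightarrow> 'a list \<Rightarrow> 'a" where
  "RL c f = (\<lambda>xs. case xs of [] \<Rightarrow> 0 | b # as \<Rightarrow> f (c \<odot> b # as))"

lemma mlin_LL: "mlin n f \<Longrightarrow> mlin n (LL c f)"
  by (auto simp: mlin_def LL_def lin_mul_left)

lemma mlin_headI:
  assumes "f [] = 0" "\<And>as. lin (\<lambda>b. f (b # as))" "\<And>b. mlin n (\<lambda>as. f (b # as))"
  shows "mlin (Suc n) f"
proof (rule mlinI)
  fix xs :: "'a list" assume "length xs \<noteq> Suc n"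
  then show "f xs = 0" using assms(1) mlin_off[OF assms(3)] by (cases xs) auto
next
  fix us vs
  show "lin (\<lambda>u. f (us @ u # vs))" using assms(2) mlin_lin[OF assms(3)] by (cases us) auto
qed

lemma mlin_RL: 
  assumes "mlin (Suc n) f" shows "mlin (Suc n) (RL c f)"
proof (rule mlin_headI)
  show "lin (\<lambda>b. RL c f (b # as))" for as
    using lin_comp[OF mlin_lin0[OF assms] lin_mul_left[OF lin_id]] by (simp add: RL_def)
  show "mlin n (\<lambda>as. RL c f (b # as))" for b using mlin_slice[OF assms] by (simp add: RL_def)
qed (simp add: RL_def)

abbreviation "mN p \<equiv> Collect (mlin (Suc p))"

sublocale NL: bimod mul one sm a h0 hp X bs bext ss al "mN p" LL RL for p :: nat
proof unfold_locales
  fix F G c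
  assume F: "F \<in> mN p"
  then have Fm: "mlin (Suc p) F" by simp
  show "LL c F \<in> mN p" using F by (simp add: mlin_LL)
  show "RL c F \<in> mN p" using F by (simp add: mlin_RL)
  show "G \<in> mN p \<Longrightarrow> F - G \<in> mN p" using F by (simp add: mlin_minus)
  show "LL c (F + G) = LL c F + LL c G" by (simp add: LL_def fun_eq_iff mul_add_right)
  show "RL c (F + G) = RL c F + RL c G" by (simp add: RL_def fun_eq_iff split: list.split)
  fix e b
  show "LL (c + e) F = LL c F + LL e F" by (simp add: LL_def fun_eq_iff mul_add_left)
  show "RL (c + e) F = RL c F + RL e F"
    by (simp add: RL_def fun_eq_iff mul_add_left lin_add[OF mlin_lin0[OF Fm]] split: list.split)
  show "LL (c \<odot> e) F = LL c (LL e F)" by (simp add: LL_def mul_assoc)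
  show "RL (c \<odot> e) F = RL e (RL c F)" by (simp add: RL_def mul_assoc fun_eq_iff split: list.split)
  show "LL c (RL e F) = RL e (LL c F)" by (simp add: RL_def LL_def fun_eq_iff split: list.split)
  show "LL (hp [:b:]) F = RL (hp [:b:]) F"
    by (simp add: RL_def LL_def hp_mul_const fun_eq_iff lin_sm[OF mlin_lin0[OF Fm]] mlin_Nil[OF Fm] split: list.split)
qed (auto simp: mlin_zero)

text \<open>Freezing all arguments but the first reduces the exactness of columns to coefficients
  Hom_k(A, A).\<close>

lemma slice_hom: "bimod_hom mul one sm a h0 hp X bs bext (mN p) LL RL {F. lin F} L1 R1
    (\<lambda>f b. f (b # as))"
  by unfold_locales (auto simp: mlin_lin0 LL_def RL_def L1_def R1_def fun_eq_iff)

lemma bar_RL: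
  assumes "mlin (Suc p) f" shows "bar (RL c f) = RL c (bar f)"
proof (rule HOL.ext)
  fix xs
  show "bar (RL c f) xs = RL c (bar f) xs"
  proof (cases xs)
    case (Cons x ys)
    then show ?thesis by (cases ys) (simp_all add: RL_def mul_assoc mlin_Nil[OF assms])
  qed (simp add: RL_def)
qed

lemma bar_hom: "bimod_hom mul one sm a h0 hp X bs bext (mN p) LL RL
    (mN (Suc p)) LL RL bar"
proof unfold_locales
  fix F G c
  assume F: "F \<in> mN p"
  show "bar F \<in> mN (Suc p)" using F by (simp add: mlin_bar)
  show "bar (F + G) = bar F + bar G" using bar_plus[of F G] by (simp add: fun_eq_iff plus_fun_def)
  show "bar (LL c F) = LL c (bar F)" by (simp add: LL_def bar_mul fun_eq_iff)
  show "bar (RL c F) = RL c (bar F)" using F by (simp add: bar_RL)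
qed

text \<open>Edge map of the small complex: it embeds A as the right linear maps, which are the
  linear maps killed by the first \<open>bar\<close>.\<close>

definition alf :: "'a \<Rightarrow> 'a list \<Rightarrow> 'a" where "alf k xs = (case xs of [b] \<Rightarrow> k \<odot> b | _ \<Rightarrow> 0)"

lemma alf_simps [simp]: "alf k [] = 0" "alf k [b] = k \<odot> b" "alf k (b # c # as) = 0"
  by (auto simp: alf_def)

lemma mlin_alf: "mlin (Suc 0) (alf k)"
proof (rule mlin_headI)
  show "lin (\<lambda>b. alf k (b # as))" for as by (cases as) (simp_all add: lin_mul_left[OF lin_id])
  show "mlin 0 (\<lambda>as. alf k (b # as))" for b
  proof (rule mlinI)
    show "lin (\<lambda>u. alf k (b # us @ u # vs))" for us vs by (cases us) simp_all
  qed (auto simp: alf_def split: list.split)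
qed simp

lemma alf_hom: "bimod_hom mul one sm a h0 hp X bs bext UNIV mul R0 (mN 0) LL RL alf"
  by unfold_locales
    (auto simp: mlin_alf LL_def RL_def R0_def alf_def fun_eq_iff mul_add_left mul_assoc split: list.split)

text \<open>Edge map of the Hochschild complex: it extends a cochain to be left linear in the module
  slot.\<close>

definition bet :: "('a list \<Rightarrow> 'a) \<Rightarrow> 'a list \<Rightarrow> 'a" where
  "bet c xs = (case xs of [] \<Rightarrow> 0 | b # as \<Rightarrow> b \<odot> c as)"

lemma bet_simps [simp]: "bet c [] = 0" "bet c (b # as) = b \<odot> c as" by (auto simp: bet_def)

lemma mlin_bet: "mlin p c \<Longrightarrow> mlin (Suc p) (bet c)"
  by (rule mlin_headI) (auto simp: lin_mul_right[OF lin_id] mlin_LL[unfolded LL_def])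

abbreviation "bb \<equiv> \<lambda>c. ((\<lambda>_::bool. bet c), 0 :: bool \<Rightarrow> 'a list \<Rightarrow> 'a)"

lemma Kc_diff: 
  assumes "\<And>F G. F \<in> N \<Longrightarrow> G \<in> N \<Longrightarrow> F - G \<in> N" "x \<in> Kc N n" "y \<in> Kc N n"
  shows "x - y \<in> Kc N n"
  using assms by (cases x; cases y) (auto simp: Kc_def)

lemma mapK_slice_zero:
  assumes "\<And>as. (\<lambda>(f, g). ((\<lambda>l b. f l (b # as)), (\<lambda>l b. g l (b # as)))) x = 0" "x \<in> Kc (mN p) q"
  shows "x = 0"
proof -
  obtain f g where x: "x = (f, g)" by (cases x)
  have "f l xs = 0 \<and> g l xs = 0" for l xs
    using assms mlin_Nil[of p "f l"] mlin_Nil[of p "g l"]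
    by (cases xs) (auto simp: x zero_prod_def fun_eq_iff Kc_def)
  then show ?thesis by (auto simp: x zero_prod_def fun_eq_iff)
qed

lemma sd_slice:
  assumes "(f, g) \<in> Kc (mN p) q"
  shows "sd L1 R1 q ((\<lambda>l b. f l (b # as)), (\<lambda>l b. g l (b # as))) =
    (\<lambda>(f, g). ((\<lambda>l b. f l (b # as)), (\<lambda>l b. g l (b # as)))) (sd LL RL q (f, g))"
  using bimod_hom.mapK_sd[OF slice_hom assms, of as] by (simp add: mapK_def)

lemma slice_in:
  assumes "(f, g) \<in> Kc (mN p) q"
  shows "((\<lambda>l b. f l (b # as)), (\<lambda>l b. g l (b # as))) \<in> Kc {F. lin F} q"
  using bimod_hom.mapK_in[OF slice_hom assms, of as] by (simp add: mapK_def)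

lemma sd_LL_exact0:
  assumes x: "x \<in> Kc (mN p) 0" and d: "sd LL RL 0 x = 0"
  shows "\<exists>c. mlin p c \<and> x = bb c"
proof -
  obtain f g where xx: "x = (f, g)" by (cases x)
  have fm: "mlin (Suc p) (f l)" and fl: "f False = f True" and g: "g = 0" for l
    using x by (auto simp: xx Kc_def)
  define c where "c = (\<lambda>as. f True (one # as))"
  have "f l (b # as) = b \<odot> f l (one # as)" for l b as
  proof (rule sd_exact0[OF slice_in])
    show "(f, g) \<in> Kc (mN p) 0" using x by (simp add: xx)
    then show "sd L1 R1 0 (\<lambda>l b. f l (b # as), \<lambda>l b. g l (b # as)) = 0"
      using d unfolding xx by (simp add: sd_slice zero_prod_def zero_fun_def)
  qed
  moreover have "f l (one # as) = c as" for l as unfolding c_def using fl by (cases l) simp_all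
  ultimately have fc: "f l (b # as) = b \<odot> c as" for l b as by metis
  have "f l xs = bet c xs" for l xs
    using mlin_Nil[OF fm] by (cases xs) (simp_all add: fc)
  then have "x = bb c" by (auto simp: xx g fun_eq_iff)
  moreover have "mlin p c" unfolding c_def by (rule mlin_slice[OF fm])
  ultimately show ?thesis by blast
qed

lemma sd_LL_exact:
  assumes x: "x \<in> Kc (mN p) (Suc q)" and d: "sd LL RL (Suc q) x = 0"
  shows "\<exists>y\<in>Kc (mN p) q. x = sd LL RL q y"
proof -
  obtain f g where xx: "x = (f, g)" by (cases x)
  have fm: "mlin (Suc p) (f l)" and gm: "mlin (Suc p) (g l)" for l
    using x by (auto simp: xx Kc_def)
  let ?sl = "\<lambda>as. ((\<lambda>l b. f l (b # as)), (\<lambda>l b. g l (b # as)))"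
  have sx: "?sl as \<in> Kc {F. lin F} (Suc q)" for as using x by (auto simp: xx intro: slice_in)
  have sd0: "sd L1 R1 (Suc q) (?sl as) = 0" for as
    using sd_slice[of f g p "Suc q" as] x d by (auto simp: xx zero_prod_def zero_fun_def)
  note S = contraction_sd[OF sx sd0]
  define y where "y l xs = (case xs of [] \<Rightarrow> 0 | b # as \<Rightarrow> contraction q (?sl as) l b)" for l xs
  have ym: "mlin (Suc p) (y l)" for l
  proof (rule mlin_headI)
    show "lin (\<lambda>b. y l (b # as))" for as using S(1)[of as] by (auto simp: y_def Kc_def)
    show "mlin p (\<lambda>as. y l (b # as))" for b
    proof -
      \<comment> \<open>Two components on two letters each are packed into a single family indexed
        by pairs of booleans.\<close>
      define \<psi> where "\<psi> H = contraction q (\<lambda>l. H (True, l), \<lambda>l. H (False, l)) l b" for H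
      have "mlin p (\<lambda>as. \<psi> (\<lambda>i b. (if fst i then f (snd i) else g (snd i)) (b # as)))"
        by (rule mlin_functional) (auto simp: fm gm \<psi>_def contraction_plus contraction_scale)
      then show ?thesis by (simp add: y_def \<psi>_def)
    qed
  qed (simp add: y_def)
  have y0: "q = 0 \<Longrightarrow> y False = y True"
    using S(1) by (auto simp: Kc_def y_def fun_eq_iff split: list.split)
  have yK: "(y, 0) \<in> Kc (mN p) q"
    using ym y0 mlin_zero by (auto simp: Kc_def)
  have "x - sd LL RL q (y, 0) = 0"
  proof (rule mapK_slice_zero)
    show "x - sd LL RL q (y, 0) \<in> Kc (mN p) (Suc q)"
      using NL.sd_in[OF yK] x by (intro Kc_diff) (auto simp: mlin_minus)
    fix as
    have "(\<lambda>l b. y l (b # as), \<lambda>l b. (0 :: bool \<Rightarrow> 'a list \<Rightarrow> 'a) l (b # as)) = (contraction q (?sl as), 0)"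
      by (simp add: y_def zero_fun_def)
    then have "(\<lambda>(f, g). (\<lambda>l b. f l (b # as), \<lambda>l b. g l (b # as))) (sd LL RL q (y, 0)) = ?sl as"
      using sd_slice[OF yK, of as] S(2)[of as] by simp
    then show "(\<lambda>(f, g). (\<lambda>l b. f l (b # as), \<lambda>l b. g l (b # as))) (x - sd LL RL q (y, 0)) = 0"
      by (cases "sd LL RL q (y, 0)") (auto simp: xx zero_prod_def fun_eq_iff)
  qed
  then show ?thesis using yK by auto
qed

section \<open>Exactness of the rows by inserting the unit\<close>

lemma bar_exact:
  assumes f: "mlin (Suc (Suc p)) f" and b: "bar f = 0"
  shows "f = bar (\<lambda>as. f (one # as))"
proof (rule HOL.ext)
  fix xs
  show "f xs = bar (\<lambda>as. f (one # as)) xs"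
  proof (cases xs)
    case Nil then show ?thesis using mlin_Nil[OF f] by simp
  next
    case (Cons x as)
    \<comment> \<open>With the unit in the module slot the first term of \<open>bar f\<close> is
      \<open>f\<close> itself, and the remaining ones form the bar differential of the slice at
      \<open>one\<close>.\<close>
    have "bar f (one # x # as) = 0" by (simp add: b)
    then show ?thesis by (simp add: Cons)
  qed
qed

lemma bar_exact0:
  assumes f: "mlin (Suc 0) f" and b: "bar f = 0"
  shows "f = alf (f [one])"
proof (rule HOL.ext)
  fix xs
  show "f xs = alf (f [one]) xs"
  proof (cases "length xs = 1")
    case True
    then obtain x where x: "xs = [x]" by (auto simp: length_Suc_conv)
    have "bar f [one, x] = 0" by (simp add: b)
    then show ?thesis by (simp add: x)
  next
    case False
    then show ?thesis using mlin_off[OF f] mlin_off[OF mlin_alf] by simp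
  qed
qed

text \<open>The first term of \<open>hoch\<close>, absent from \<open>bar\<close>, arises when the
  module slot absorbs the next argument.\<close>

lemma bar_bet: "bar (bet c) = bet (hoch c)"
proof (rule HOL.ext)
  fix xs
  show "bar (bet c) xs = bet (hoch c) xs"
  proof (cases xs)
    case (Cons x ys)
    then show ?thesis by (cases ys) (simp_all add: hoch_def bar_mul mul_diff_right mul_assoc)
  qed (simp add: hoch_def)
qed

lemma bar_alf: "bar (alf k) = 0"
proof (rule HOL.ext)
  fix xs
  show "bar (alf k) xs = 0 xs"
  proof (cases "length xs = 2")
    case True
    then obtain x y where "xs = [x, y]" by (auto simp: length_Suc_conv numeral_2_eq_2)
    then show ?thesis by (simp add: mul_assoc)
  next
    case False
    then show ?thesis using mlin_off[OF mlin_bar[OF mlin_alf]] by simp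
  qed
qed

lemma bar_bar_fun: "bar (bar f) = 0" using bar_bar by (auto simp: fun_eq_iff)

text \<open>Fixing \<open>p\<close> gives the small complex with coefficients in the (p+1)-linear
  maps, augmented by the Hochschild p-cochains. The other edge is the small complex with
  coefficients A.\<close>

lemma bar_small_bicomplex:
  "bicomplex (\<lambda>p q. Kc (mN p) q) (\<lambda>p. mapK bar) (sd LL RL)
     (\<lambda>p. Collect (mlin p)) (\<lambda>p. hoch) bb (Kc UNIV) (sd mul R0) (mapK alf)"
proof unfold_locales
  fix p q x y
  assume x: "x \<in> Kc (mN p) q"
  obtain f g where xx: "x = (f, g)" by (cases x)
  show "mapK bar x \<in> Kc (mN (Suc p)) q" by (rule bimod_hom.mapK_in[OF bar_hom x])
  show "sd LL RL q x \<in> Kc (mN p) (Suc q)" by (rule NL.sd_in[OF x])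
  show "mapK bar (sd LL RL q x) = sd LL RL q (mapK bar x)" by (rule bimod_hom.mapK_sd[OF bar_hom x])
  show "sd LL RL (Suc q) (sd LL RL q x) = 0" by (rule NL.sd_sd[OF x])
  show "mapK bar (mapK bar x) = 0" by (simp add: xx mapK_def bar_bar_fun zero_prod_def zero_fun_def)
  assume y: "y \<in> Kc (mN p) q"
  obtain f' g' where yy: "y = (f', g')" by (cases y)
  show "x - y \<in> Kc (mN p) q" using x y by (intro Kc_diff) (auto simp: mlin_minus)
  show "sd LL RL q (x - y) = sd LL RL q x - sd LL RL q y" by (rule NL.sd_diff[OF x y])
  show "mapK bar (x - y) = mapK bar x - mapK bar y"
    by (simp add: xx yy mapK_def fun_eq_iff fun_diff_def bar_minus)
next
  fix p c assume c: "c \<in> Collect (mlin p)"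
  then show "bb c \<in> Kc (mN p) 0" by (auto simp: Kc_def mlin_bet mlin_zero)
  show "hoch c \<in> mN p" using c by (simp add: mlin_hoch)
  show "bb (hoch c) = mapK bar (bb c)"
    by (simp add: mapK_def bar_bet bar_zero zero_fun_def fun_eq_iff)
  have "tau LL RL False 0 = 0" "dlt LL RL False 0 = 0" by (rule NL.tau_0 NL.dlt_0)+
  moreover have "dlt LL RL True (\<lambda>_. bet c) = 0"
    by (auto simp: dlt_def LL_def RL_def fun_eq_iff mul_assoc bet_def split: list.split)
  moreover have "eta LL RL True (\<lambda>_. bet c) = 0"
    by (auto simp: eta_def dg_def LL_def RL_def fun_eq_iff mul_assoc bet_def split: list.split)
  ultimately show "sd LL RL 0 (bb c) = 0" by (simp add: sd_def zero_prod_def)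
  fix c' assume "bb c = bb c'"
  then have "bet c (one # xs) = bet c' (one # xs)" for xs by (metis prod.inject)
  then show "c = c'" by (simp add: fun_eq_iff)
next
  fix q k assume k: "k \<in> Kc (UNIV :: 'a set) q"
  then show "mapK alf k \<in> Kc (mN 0) q" by (rule bimod_hom.mapK_in[OF alf_hom])
  show "sd mul R0 q k \<in> Kc UNIV (Suc q)" using k by (rule N0.sd_in)
  show "mapK alf (sd mul R0 q k) = sd LL RL q (mapK alf k)" using k by (rule bimod_hom.mapK_sd[OF alf_hom])
  show "mapK bar (mapK alf k) = 0"
    by (cases k) (simp add: mapK_def mapK_def bar_alf zero_prod_def zero_fun_def)
  fix k' assume e: "mapK alf k = mapK alf k'"
  obtain f g f' g' where kk: "k = (f, g)" "k' = (f', g')" by (cases k; cases k')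
  have "alf (f l) [one] = alf (f' l) [one]" "alf (g l) [one] = alf (g' l) [one]" for l
    using e unfolding kk mapK_def prod.inject split fun_eq_iff by blast+
  then show "k = k'" by (simp add: kk fun_eq_iff)
next
  fix q x assume x: "x \<in> Kc (mN 0) q" and d: "mapK bar x = 0"
  obtain f g where xx: "x = (f, g)" by (cases x)
  have m: "mlin (Suc 0) (f l)" "mlin (Suc 0) (g l)" for l using x by (auto simp: xx Kc_def)
  have b: "bar (f l) = 0" "bar (g l) = 0" for l
    using d by (auto simp: xx mapK_def zero_prod_def fun_eq_iff)
  show "\<exists>k\<in>Kc UNIV q. x = mapK alf k"
  proof
    show "x = mapK alf (\<lambda>l. f l [one], \<lambda>l. g l [one])"
      using bar_exact0[OF m(1) b(1)] bar_exact0[OF m(2) b(2)] by (simp add: xx mapK_def)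
    show "(\<lambda>l. f l [one], \<lambda>l. g l [one]) \<in> Kc UNIV q"
      using x by (auto simp: xx Kc_def zero_fun_def)
  qed
next
  fix p q x assume x: "x \<in> Kc (mN (Suc p)) q" and d: "mapK bar x = 0"
  obtain f g where xx: "x = (f, g)" by (cases x)
  have m: "mlin (Suc (Suc p)) (f l)" "mlin (Suc (Suc p)) (g l)" for l using x by (auto simp: xx Kc_def)
  have b: "bar (f l) = 0" "bar (g l) = 0" for l
    using d by (auto simp: xx mapK_def zero_prod_def fun_eq_iff)
  show "\<exists>y\<in>Kc (mN p) q. x = mapK bar y"
  proof
    show "x = mapK bar (\<lambda>l as. f l (one # as), \<lambda>l as. g l (one # as))"
      using bar_exact[OF m(1) b(1)] bar_exact[OF m(2) b(2)] by (simp add: xx mapK_def)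
    show "(\<lambda>l as. f l (one # as), \<lambda>l as. g l (one # as)) \<in> Kc (mN p) q"
      using x m[THEN mlin_slice] by (auto simp: xx Kc_def zero_fun_def)
  qed
next
  fix p x assume "x \<in> Kc (mN p) 0" "sd LL RL 0 x = 0"
  then show "\<exists>c\<in>Collect (mlin p). x = bb c" using sd_LL_exact0 by auto
next
  fix p q x assume "x \<in> Kc (mN p) (Suc q)" "sd LL RL (Suc q) x = 0"
  then show "\<exists>y\<in>Kc (mN p) q. x = sd LL RL q y" by (rule sd_LL_exact)
next
  show "bb 0 = 0" by (auto simp: zero_prod_def fun_eq_iff bet_def split: list.split)
  show "mapK alf 0 = 0" by (auto simp: mapK_def zero_prod_def fun_eq_iff alf_def split: list.split)
qed (auto simp: mlin_zero Kc_def zero_prod_def)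

definition ksc :: "'k \<Rightarrow> (bool \<Rightarrow> 'a) \<times> (bool \<Rightarrow> 'a) \<Rightarrow> (bool \<Rightarrow> 'a) \<times> (bool \<Rightarrow> 'a)" where
  "ksc c = (\<lambda>(f, g). (\<lambda>l. sm c (f l), \<lambda>l. sm c (g l)))"

theorem qdim_hoch:
  assumes "qdim ksc (cyc (Kc UNIV) (sd mul R0) n) (cob (Kc UNIV) (sd mul R0) n) m"
  shows "qdim (\<lambda>c f xs. sm c (f xs)) (cyc (\<lambda>p. Collect (mlin p)) (\<lambda>p. hoch) n) (cob (\<lambda>p. Collect (mlin p)) (\<lambda>p. hoch) n) m"
proof (rule bicomplex.qdim_eq[OF bar_small_bicomplex assms, where sD = "\<lambda>c. (\<lambda>(f, g). (\<lambda>l xs. sm c (f l xs), \<lambda>l xs. sm c (g l xs)))"],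
    goal_cases)
  case (1 c c') then show ?case by (simp add: mlin_minus)
next
  case (2 c c') then show ?case by (intro Kc_diff) auto
next
  case (3 c c') show ?case by (auto simp: fun_eq_iff bet_def mul_diff_right split: list.split)
next
  case (4 c c') show ?case
    by (cases c; cases c') (auto simp: fun_eq_iff mapK_def alf_def mul_diff_left split: list.split)
next
  case (5 r c) then show ?case by (simp add: mlin_scale)
next
  case (6 r c) then show ?case by (cases c) (auto simp: ksc_def Kc_def fun_eq_iff)
next
  case (7 r x p q) then show ?case by (cases x) (auto simp: Kc_def mlin_scale fun_eq_iff)
next
  case (8 r c) show ?case by (auto simp: fun_eq_iff bet_def sm_mul_right split: list.split)
next
  case (9 r c) show ?case
    by (cases c) (auto simp: fun_eq_iff ksc_def mapK_def alf_def sm_mul_left split: list.split)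
next
  case (10 r x p q) show ?case by (cases x) (auto simp: mapK_def bar_sm fun_eq_iff)
next
  case (11 r x p q)
  have "bimod_hom mul one sm a h0 hp X bs bext (mN p) LL RL (mN p) LL RL (\<lambda>f xs. sm r (f xs))"
    by unfold_locales (auto simp: mlin_scale LL_def RL_def fun_eq_iff sm_add_right sm_mul_right split: list.split)
  from bimod_hom.mapK_sd[OF this 11] show ?case by (simp add: mapK_def)
qed

end

section \<open>A model of the generalized Weyl algebra\<close>

definition pext :: "('i \<Rightarrow> 'p::ab_group_add \<Rightarrow> 'b::ab_group_add) \<Rightarrow> ('i \<Rightarrow>\<^sub>0 'p) \<Rightarrow> 'b" where
  "pext F t = (\<Sum>j\<in>Poly_Mapping.keys t. F j (Poly_Mapping.lookup t j))"

lemma pext_superset: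
  assumes "\<And>j. F j 0 = 0" "finite S" "Poly_Mapping.keys t \<subseteq> S"
  shows "pext F t = (\<Sum>j\<in>S. F j (Poly_Mapping.lookup t j))"
  unfolding pext_def using assms
  by (intro sum.mono_neutral_left) (auto simp: in_keys_iff)

lemma pext_single [simp]: "F j 0 = 0 \<Longrightarrow> pext F (Poly_Mapping.single j p) = F j p"
  by (simp add: pext_def)

lemma pext_add:
  assumes F: "\<And>j p q. F j (p + q) = F j p + F j q"
  shows "pext F (s + t) = pext F s + pext F t"
proof -
  have F0: "F j 0 = 0" for j using F[of j] by (rule additive_zero)
  let ?S = "Poly_Mapping.keys s \<union> Poly_Mapping.keys t"
  have "pext F (s + t) = (\<Sum>j\<in>?S. F j (Poly_Mapping.lookup (s + t) j))"
    using Poly_Mapping.keys_add[of s t] by (intro pext_superset F0) auto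
  also have "\<dots> = pext F s + pext F t"
    by (simp add: lookup_add F sum.distrib pext_superset[of F ?S] F0)
  finally show ?thesis .
qed

lemma additive_eqI:
  fixes F G :: "('i \<Rightarrow>\<^sub>0 'p::ab_group_add) \<Rightarrow> 'b::ab_group_add"
  assumes F: "\<And>s t. F (s + t) = F s + F t" and G: "\<And>s t. G (s + t) = G s + G t"
    and eq: "\<And>j p. F (Poly_Mapping.single j p) = G (Poly_Mapping.single j p)"
  shows "F t = G t"
proof (induction t rule: update_induct)
  case const show ?case using additive_zero[of F] additive_zero[of G] F G by metis
next
  case (update f j p)
  have "Poly_Mapping.update j p f = f + Poly_Mapping.single j p"
    using update(1) by (intro poly_mapping_eqI) (auto simp: lookup_update lookup_add lookup_single in_keys_iff when_def)
  then show ?case using update by (simp add: F G eq)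
qed

type_synonym 'k gwt = "int \<Rightarrow>\<^sub>0 'k poly"

text \<open>In the model \<open>sng j p\<close> stands for p x^j, or p y^(-j) if j is negative. It
  yields the k[h]-basis of A, which the presentation does not exhibit.\<close>

locale gw =
  fixes a :: "'k::field poly" and h0 :: 'k
begin

text \<open>The type also carries the convolution product, whose unit must not replace
  \<open>sng 0 1\<close>.\<close>

declare single_one [simp del]

abbreviation sng :: "int \<Rightarrow> 'k poly \<Rightarrow> 'k gwt" where "sng \<equiv> Poly_Mapping.single"

definition ss :: "bool \<Rightarrow> 'k" where "ss = (\<lambda>l. if l then h0 else - h0)"
definition al :: "bool \<Rightarrow> 'k poly" where "al = (\<lambda>l. if l then sh (- h0) a else a)"

definition pop :: "'k poly \<Rightarrow> ('k gwt) \<Rightarrow> 'k gwt" where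
  "pop p = pext (\<lambda>j q. sng j (p * q))"

text \<open>Left multiplication by a letter on normal forms: the coefficient is translated as the
  letter passes it, and a letter meeting its opposite leaves the factor \<open>al l\<close>.\<close>

definition Xo :: "bool \<Rightarrow> ('k gwt) \<Rightarrow> 'k gwt" where
  "Xo l = pext (\<lambda>j q. sng (j + sg l) (sh (- ss l) q * (if 0 \<le> sg l * j then 1 else al l)))"

definition XX :: "int \<Rightarrow> ('k gwt) \<Rightarrow> 'k gwt" where
  "XX j = (Xo (0 \<le> j)) ^^ (nat \<bar>j\<bar>)"

text \<open>Multiplication from the left acts through the operators \<open>pop\<close> and \<open>Xo\<close>, so associativity reduces to the
  defining relations between these operators.\<close>

definition tmul :: "('k gwt) \<Rightarrow> ('k gwt) \<Rightarrow> 'k gwt" (infixl "\<odot>" 70) where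
  "t \<odot> s = pext (\<lambda>j p. pop p (XX j s)) t"

lemma pop_add: "pop p (s + t) = pop p s + pop p t"
  unfolding pop_def by (rule pext_add) (simp add: distrib_left single_add)

lemma Xo_add: "Xo l (s + t) = Xo l s + Xo l t"
  unfolding Xo_def by (rule pext_add) (simp add: sh_add distrib_right single_add)

lemma pop_single [simp]: "pop p (sng j q) = sng j (p * q)" by (simp add: pop_def)
lemma Xo_single: "Xo l (sng j q) = sng (j + sg l) (sh (- ss l) q * (if 0 \<le> sg l * j then 1 else al l))"
  by (simp add: Xo_def)

lemma pop_0 [simp]: "pop p 0 = 0" by (rule additive_zero) (rule pop_add)
lemma Xo_0 [simp]: "Xo l 0 = 0" by (rule additive_zero) (rule Xo_add)

lemma pop_pop: "pop p (pop q t) = pop (p * q) t"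
  by (rule additive_eqI[of "\<lambda>t. pop p (pop q t)"]) (simp_all add: pop_add mult.assoc)

lemma pop_plus: "pop (p + q) t = pop p t + pop q t"
  by (rule additive_eqI[of "pop (p + q)" "\<lambda>t. pop p t + pop q t"])
     (simp_all add: pop_add algebra_simps single_add)

lemma pop_1 [simp]: "pop 1 t = t"
  by (rule additive_eqI[of "pop 1" "\<lambda>t. t"]) (simp_all add: pop_add)

lemma pop_zero [simp]: "pop 0 t = 0" by (metis add_cancel_right_right add_0 pop_plus)

lemma Xo_pop: "Xo l (pop p t) = pop (sh (- ss l) p) (Xo l t)"
  by (rule additive_eqI[of "\<lambda>t. Xo l (pop p t)"])
     (simp_all add: pop_add Xo_add Xo_single sh_mult mult.assoc)

lemma al_sh: "sh (- ss l) (al (\<not> l)) = al l" by (simp add: ss_def al_def sh_sh)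
lemma ss_Not: "ss (\<not> l) = - ss l" by (simp add: ss_def)

text \<open>Exactly one of the two letters cancels, depending on the sign of the degree. If it is
  the inner one, passing the outer letter turns \<open>al (\<not> l)\<close> into
  \<open>al l\<close>.\<close>

lemma Xo_Xo: "Xo l (Xo (\<not> l) t) = pop (al l) t"
proof (rule additive_eqI[of "\<lambda>t. Xo l (Xo (\<not> l) t)"])
  fix j q
  have e: "sg l * (j - sg l) = sg l * j - 1" by (simp add: sg_def)
  show "Xo l (Xo (\<not> l) (sng j q)) = pop (al l) (sng j q)"
  proof (cases "sg l * j \<le> 0")
    case True
    then show ?thesis by (simp add: Xo_single e ss_Not sh_sh mult.commute)
  next
    case False
    then show ?thesis by (simp add: Xo_single e ss_Not sh_sh sh_mult al_sh mult.commute)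
  qed
qed (simp_all add: Xo_add pop_add)

lemma XX_sg: "XX (sg l * int k) = (Xo l) ^^ k"
  by (cases k) (auto simp: XX_def sg_def nat_add_distrib)

lemma XX_add: "XX j (s + t) = XX j s + XX j t"
proof -
  have "(Xo l ^^ k) (s + t) = (Xo l ^^ k) s + (Xo l ^^ k) t" for l k
    by (induction k) (simp_all add: Xo_add)
  then show ?thesis by (simp add: XX_def)
qed

lemma sg_cases:
  obtains k where "j = sg l * int k" | k where "j = sg (\<not> l) * int (Suc k)"
proof (cases "0 \<le> sg l * j")
  case True
  then show ?thesis by (intro that(1)[of "nat (sg l * j)"]) (auto simp: sg_def)
next
  case False
  then show ?thesis by (intro that(2)[of "nat (- sg l * j) - 1"]) (auto simp: sg_def split: if_splits)
qed

text \<open>Lifts the rule defining \<open>Xo\<close> from normal forms to operators, which is what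
  associativity needs.\<close>

lemma Xo_XX: "Xo l (XX j s) = (if 0 \<le> sg l * j then XX (j + sg l) s else pop (al l) (XX (j + sg l) s))"
proof (cases j rule: sg_cases[of _ l])
  case (1 k)
  have "j + sg l = sg l * int (Suc k)" by (simp add: 1 algebra_simps)
  moreover have "0 \<le> sg l * j" by (simp add: 1 sg_def)
  ultimately show ?thesis by (simp only: 1 XX_sg if_True) (simp add: XX_sg)
next
  case (2 k)
  have "j + sg l = sg (\<not> l) * int k" by (simp add: 2 algebra_simps)
  moreover have "\<not> 0 \<le> sg l * j" by (simp add: 2 sg_def)
  ultimately show ?thesis by (simp only: 2 XX_sg if_False) (simp add: XX_sg Xo_Xo del: sg_not)
qed

lemma tmul_add_left: "(s + t) \<odot> r = s \<odot> r + t \<odot> r"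
  unfolding tmul_def by (rule pext_add) (rule pop_plus)

lemma tmul_single: "sng j p \<odot> s = pop p (XX j s)"
  by (simp add: tmul_def)

lemma tmul_add_right: "t \<odot> (r + s) = t \<odot> r + t \<odot> s"
  by (rule additive_eqI[of "\<lambda>t. t \<odot> (r + s)" "\<lambda>t. t \<odot> r + t \<odot> s"])
     (simp_all add: tmul_add_left tmul_single XX_add pop_add algebra_simps)

lemma tmul_pop: "pop p t \<odot> s = pop p (t \<odot> s)"
  by (rule additive_eqI[of "\<lambda>t. pop p t \<odot> s"])
     (simp_all add: tmul_add_left pop_add tmul_single pop_pop)

lemma tmul_Xo: "Xo l t \<odot> s = Xo l (t \<odot> s)"
  by (rule additive_eqI[of "\<lambda>t. Xo l t \<odot> s"])
     (simp_all add: tmul_add_left Xo_add Xo_single tmul_single Xo_pop Xo_XX pop_pop)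

lemma tmul_XX: "XX j t \<odot> s = XX j (t \<odot> s)"
proof -
  have "(Xo l ^^ k) t \<odot> s = (Xo l ^^ k) (t \<odot> s)" for l k
    by (induction k) (simp_all add: tmul_Xo)
  then show ?thesis by (simp add: XX_def)
qed

lemma tmul_assoc: "(t \<odot> s) \<odot> r = t \<odot> (s \<odot> r)"
  by (rule additive_eqI[of "\<lambda>t. (t \<odot> s) \<odot> r"])
     (simp_all add: tmul_add_left tmul_single tmul_pop tmul_XX)

lemma XX_hp: "XX j (sng 0 q) = sng j (sh (- (of_int j * h0)) q)"
proof -
  have "(Xo l ^^ k) (sng 0 q) = sng (sg l * int k) (sh (- (of_int (sg l * int k) * h0)) q)" for l k
  proof (induction k)
    case (Suc k)
    have "0 \<le> sg l * (sg l * int k)" by (simp add: sg_def)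
    moreover have "- ss l + - (of_int (sg l * int k) * h0) = - (of_int (sg l * int (Suc k)) * h0)"
      by (simp add: ss_def sg_def algebra_simps)
    ultimately show ?case using Suc by (simp add: Xo_single sh_sh) (simp add: algebra_simps)
  qed simp
  then show ?thesis
    using XX_sg[of True "nat j"] XX_sg[of False "nat (- j)"] by (cases "0 \<le> j") (auto simp: sg_def XX_def)
qed

lemma XX_one: "XX j (sng 0 1) = sng j 1" by (simp add: XX_hp)

lemma tmul_one: "t \<odot> sng 0 1 = t"
  by (rule additive_eqI[of "\<lambda>t. t \<odot> sng 0 1" "\<lambda>t. t"])
    (simp_all add: tmul_add_left tmul_single XX_one)

lemma XX_0 [simp]: "XX 0 s = s" by (simp add: XX_def)
lemma XX_sg1 [simp]: "XX (sg l) s = Xo l s" using XX_sg[of l 1] by simp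

lemma XX_pop_const: "XX j (pop [:c:] s) = pop [:c:] (XX j s)"
proof -
  have "(Xo l ^^ k) (pop [:c:] s) = pop [:c:] ((Xo l ^^ k) s)" for l k
    by (induction k) (simp_all add: Xo_pop)
  then show ?thesis by (simp add: XX_def)
qed

lemma tmul_sm: "t \<odot> pop [:c:] s = pop [:c:] (t \<odot> s)"
  by (rule additive_eqI[of "\<lambda>t. t \<odot> pop [:c:] s" "\<lambda>t. pop [:c:] (t \<odot> s)"])
    (simp_all add: tmul_add_left pop_add tmul_single XX_pop_const pop_pop mult.commute)

lemma pext_scale:
  assumes F: "\<And>j p q. F j (p + q) = F j p + F j q" and s: "\<And>j p. F j (smult c p) = pop [:c:] (F j p)"
  shows "pext F (pop [:c:] t) = pop [:c:] (pext F t)"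
proof -
  have F0: "F j 0 = 0" for j using F[of j] by (rule additive_zero)
  show ?thesis
    by (rule additive_eqI[of "\<lambda>t. pext F (pop [:c:] t)" "\<lambda>t. pop [:c:] (pext F t)"])
      (simp_all add: pop_add pext_add F F0 s)
qed

sublocale G: alg tmul "sng 0 1" "\<lambda>c. pop [:c:]"
proof unfold_locales
  fix c e :: 'k and x :: "'k gwt"
  show "sng 0 1 \<odot> x = x" by (simp add: tmul_single)
  show "pop [:c + e:] x = pop [:c:] x + pop [:e:] x" using pop_plus[of "[:c:]" "[:e:]" x] by simp
  show "pop [:1:] x = x" using pop_1 by (simp add: one_pCons)
qed (simp_all add: tmul_add_left tmul_add_right tmul_assoc tmul_one pop_add pop_pop tmul_pop tmul_sm mult.commute)

sublocale G: gwalg tmul "sng 0 1" "\<lambda>c. pop [:c:]" a h0 "sng 0" "\<lambda>l. sng (sg l) 1" "\<lambda>j. sng j 1" pext ss al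
proof (unfold_locales)
  fix l :: bool and j :: int and p q :: "'k poly" and c :: 'k
  show "sng 0 (p + q) = sng 0 p + sng 0 q" by (simp add: single_add)
  show "sng 0 (p * q) = sng 0 p \<odot> sng 0 q" by (simp add: tmul_single)
  show "sng 0 [:c:] = pop [:c:] (sng 0 1)" by simp
  show "sng (sg l) 1 \<odot> sng 0 p = sng 0 (sh (- (if l then h0 else - h0)) p) \<odot> sng (sg l) 1"
    by (simp add: tmul_single Xo_single ss_def)
  show "sng (sg l) 1 \<odot> sng (sg (\<not> l)) 1 = sng 0 (if l then sh (- h0) a else a)"
  proof -
    have "\<not> 0 \<le> sg l * sg (\<not> l)" by (simp add: sg_def)
    then show ?thesis by (simp add: tmul_single Xo_single al_def)
  qed
  show "0 \<le> sg l * j \<Longrightarrow> sng (sg l) 1 \<odot> sng j 1 = sng (j + sg l) 1"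
    by (simp add: tmul_single Xo_single)
next
  fix F :: "int \<Rightarrow> 'k poly \<Rightarrow> 'k gwt" and p j
  assume F: "\<And>j p q. F j (p + q) = F j p + F j q"
  have F0: "F j 0 = 0" for j using F[of j] by (rule additive_zero)
  show "pext F (sng 0 p \<odot> sng j 1) = F j p" by (simp add: tmul_single F0)
  assume "\<And>j c p. F j (smult c p) = pop [:c:] (F j p)"
  then show "G.lin (pext F)" by (intro G.linI pext_add pext_scale F)
next
  fix H H' assume H: "G.lin H" "G.lin H'" "\<And>p j. H (sng 0 p \<odot> sng j 1) = H' (sng 0 p \<odot> sng j 1)"
  show "H = H'"
    by (rule ext, rule additive_eqI[of H H'])
      (use H in \<open>simp_all add: G.lin_add tmul_single\<close>)
qed (simp_all only: ss_def al_def)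

end

section \<open>Cohomology of the small complex\<close>

lemma pderiv_sh: "pderiv (sh c p) = sh c (pderiv p)"
  unfolding sh_def by (simp add: pderiv_pcompose pderiv_pCons)

lemma sh_monom: "sh c (monom 1 n) = [:c, 1:] ^ n"
  by (induction n) (simp_all add: monom_Suc sh_pCons sh_def[of _ 1])

text \<open>An invariant polynomial takes its value at 0 at all natural multiples of
  \<open>c\<close>, which are infinitely many in characteristic zero.\<close>

lemma sh_fixed_const:
  fixes t :: "'k::field_char_0 poly"
  assumes "sh c t = t" "c \<noteq> 0"
  shows "t = [:coeff t 0:]"
proof -
  have "poly t (x + c) = poly t x" for x
    using arg_cong[OF assms(1), of "\<lambda>p. poly p x"] by (simp add: sh_def poly_pcompose add.commute)
  then have "poly t (of_nat n * c) = poly t 0" for n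
    by (induction n) (simp_all add: distrib_right add.commute[of c])
  then have "poly (t - [:coeff t 0:]) (of_nat n * c) = 0" for n by (simp add: poly_0_coeff_0)
  then have "range (\<lambda>n::nat. of_nat n * c) \<subseteq> {x. poly (t - [:coeff t 0:]) x = 0}" by auto
  moreover have "infinite (range (\<lambda>n::nat. of_nat n * c))"
    by (rule range_inj_infinite) (use assms(2) in \<open>auto intro!: injI\<close>)
  ultimately have "t - [:coeff t 0:] = 0" using poly_roots_finite finite_subset by blast
  then show ?thesis by simp
qed

text \<open>Degree induction: the difference of h^(n+1) has leading term (n+1) c h^n, nonzero in
  characteristic zero, which clears the leading coefficient of \<open>q\<close>.\<close>

lemma sh_diff_surj:
  fixes q :: "'k::field_char_0 poly"
  assumes "c \<noteq> 0"
  shows "\<exists>t. sh c t - t = q"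
\<comment> \<open>The measure puts the zero polynomial below the nonzero constants, although both
  have degree 0.\<close>
proof (induction "if q = 0 then 0 else Suc (degree q)" arbitrary: q rule: less_induct)
  case less
  show ?case
  proof (cases "q = 0")
    case True then show ?thesis by (intro exI[of _ 0]) simp
  next
    case False
    let ?n = "degree q"
    define M where "M = sh c (monom 1 (Suc ?n)) - monom (1::'k) (Suc ?n)"
    have M: "M = [:c, 1:] ^ Suc ?n - monom 1 (Suc ?n)"
      unfolding M_def sh_monom by simp
    have cM: "coeff M i = of_nat (Suc ?n choose i) * c ^ (Suc ?n - i) - (if i = Suc ?n then 1 else 0)" for i
      proof (cases "i \<le> Suc ?n")
      case True then show ?thesis unfolding M by (simp add: coeff_linear_poly_power del: power_Suc)
    next
      case False
      then have "coeff ([:c, 1:] ^ Suc ?n) i = 0" by (intro coeff_eq_0) (simp add: degree_linear_power del: power_Suc)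
      then show ?thesis unfolding M using False by (simp add: binomial_eq_0 del: power_Suc)
    qed
    have cn: "coeff M ?n = of_nat (Suc ?n) * c" unfolding cM by simp
    have M0: "coeff M i = 0" if "i > ?n" for i unfolding cM using that by (auto simp: not_less binomial_eq_0 le_Suc_eq)
    define e where "e = lead_coeff q / (of_nat (Suc ?n) * c)"
    define q' where "q' = q - smult e M"
    have ce: "e * coeff M ?n = lead_coeff q" unfolding cn e_def using assms by (simp del: of_nat_Suc)
    have q'0: "coeff q' i = 0" if "i \<ge> ?n" for i
      using that ce M0[of i] coeff_eq_0[of q i] by (cases "i = ?n") (auto simp: q'_def)
    have "\<exists>t. sh c t - t = q'"
    proof (rule less)
      show "(if q' = 0 then 0 else Suc (degree q')) < (if q = 0 then 0 else Suc (degree q))"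
      proof (cases "q' = 0")
        case False
        then have "degree q' < ?n" using q'0[of "degree q'"] by (metis leading_coeff_0_iff not_le)
        then show ?thesis using \<open>q \<noteq> 0\<close> by simp
      qed (use False in simp)
    qed
    then obtain t where "sh c t - t = q'" by blast
    then have "sh c (t + smult e (monom 1 (Suc ?n))) - (t + smult e (monom 1 (Suc ?n))) = q"
      by (simp add: sh_add sh_smult q'_def M_def algebra_simps smult_diff_right)
    then show ?thesis by blast
  qed
qed

text \<open>From degree 2 on, each cohomology group is k[h] modulo a subspace \<open>I\<close>
  complementary to the polynomials of degree below \<open>m\<close>; the images of the powers h^i
  with i < m form the basis.\<close>

lemma qdim_poly:
  fixes E :: "'k::field poly \<Rightarrow> 'v::ab_group_add"
  assumes add: "\<And>s t. E (s + t) = E s + E t" and scale: "\<And>c t. E (smult c t) = s c (E t)"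
    and Z: "\<And>t. E t \<in> Z" and surj: "\<And>z. z \<in> Z \<Longrightarrow> \<exists>t. z - E t \<in> B"
    and B: "\<And>t. E t \<in> B \<longleftrightarrow> t \<in> I" and B_add: "\<And>x y. x \<in> B \<Longrightarrow> y \<in> B \<Longrightarrow> x + y \<in> B"
    and rem: "\<And>t. \<exists>r. (\<forall>i\<ge>m. coeff r i = 0) \<and> t - r \<in> I"
    and indep: "\<And>t. t \<in> I \<Longrightarrow> (\<forall>i\<ge>m. coeff t i = 0) \<Longrightarrow> t = 0"
  shows "qdim s Z B m"
proof -
  have sums: "(\<Sum>i<m. s (c i) (E (monom 1 i))) = E (\<Sum>i<m. monom (c i) i)" for c
  proof -
    have E0: "E 0 = 0" using additive_zero[of E] add by blast
    have "E (\<Sum>i\<in>S. monom (c i) i) = (\<Sum>i\<in>S. E (monom (c i) i))" if "finite S" for S :: "nat set"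
      using that by (induction S rule: finite_induct) (simp_all add: add E0)
    moreover have "E (monom (c i) i) = s (c i) (E (monom 1 i))" for i
      using scale[of "c i" "monom 1 i"] by (simp add: smult_monom)
    ultimately show ?thesis by simp
  qed
  have cf: "coeff (\<Sum>i<m. monom (c i) i) j = (if j < m then c j else 0)" for c :: "nat \<Rightarrow> 'k" and j
    by (simp add: coeff_sum)
  show ?thesis unfolding qdim_def sums
  proof (intro exI[of _ "\<lambda>i. E (monom 1 i)"] conjI allI impI ballI)
    fix c i assume "(\<Sum>i<m. s (c i) (E (monom 1 i))) \<in> B" "i < m"
    then have "(\<Sum>i<m. monom (c i) i) = 0" unfolding sums B by (intro indep) (auto simp: cf)
    then show "c i = 0" using cf[of c i] \<open>i < m\<close> by simp
  next
    fix z assume "z \<in> Z"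
    then obtain t where t: "z - E t \<in> B" using surj by blast
    obtain r where r: "\<forall>i\<ge>m. coeff r i = 0" "t - r \<in> I" using rem by blast
    have "r = (\<Sum>i<m. monom (coeff r i) i)" by (rule poly_eqI) (use r in \<open>simp add: cf\<close>)
    then have "(\<Sum>i<m. s (coeff r i) (E (monom 1 i))) = E r" unfolding sums by metis
    moreover have "E (t - r) = E t - E r" by (rule additive_diff) (rule add)
    then have "z - E r = (z - E t) + E (t - r)" by simp
    then have "z - E r \<in> B" using B_add[OF t] B r by metis
    ultimately show "\<exists>c. z - (\<Sum>i<m. s (c i) (E (monom 1 i))) \<in> B" by metis
  qed (use Z in auto)
qed

context gw
begin

section \<open>Weight decomposition of the small complex\<close>

abbreviation "dl \<equiv> G.dlt tmul G.R0"
abbreviation "et \<equiv> G.eta tmul G.R0"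
abbreviation "ta \<equiv> G.tau tmul G.R0"
abbreviation "lk \<equiv> Poly_Mapping.lookup"

text \<open>The weight spaces on which \<open>et e\<close> vanishes; \<open>iv\<close> inverts it on the others (\<open>inverse 0 = 0\<close> takes care of the
  excluded weight).\<close>

definition wt :: "bool \<Rightarrow> bool \<Rightarrow> int" where "wt e l = (if e then 0 else sg l)"

definition wgt :: "bool \<Rightarrow> (bool \<Rightarrow> 'k poly) \<Rightarrow> bool \<Rightarrow> 'k gwt" where
  "wgt e s l = sng (wt e l) (s l)"

definition pr :: "bool \<Rightarrow> (bool \<Rightarrow> 'k gwt) \<Rightarrow> bool \<Rightarrow> 'k gwt" where
  "pr e f = wgt e (\<lambda>l. lk (f l) (wt e l))"

definition iv :: "bool \<Rightarrow> (bool \<Rightarrow> 'k gwt) \<Rightarrow> bool \<Rightarrow> 'k gwt" where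
  "iv e f l = pext (\<lambda>j q. sng j (smult (inverse (of_int (j - wt e l) * h0)) q)) (f l)"

text \<open>\<open>dlt\<close> on the matching weights, where a cochain is a pair of polynomials.
  From odd to even words two opposite letters meet, whence the factor \<open>al l\<close>.\<close>

definition pd :: "bool \<Rightarrow> (bool \<Rightarrow> 'k poly) \<Rightarrow> bool \<Rightarrow> 'k poly" where
  "pd e s l = (if e then sh (- ss l) (s (\<not> l)) - s l else (sh (- ss l) (s (\<not> l)) + s l) * al l)"

lemma wgt_add: "wgt e s + wgt e t = wgt e (s + t)" by (simp add: wgt_def fun_eq_iff single_add)
lemma wgt_diff: "wgt e s - wgt e t = wgt e (s - t)" by (simp add: wgt_def fun_eq_iff single_diff)
lemma wgt_0 [simp]: "wgt e 0 = 0" by (simp add: wgt_def fun_eq_iff)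
lemma wgt_inj: "wgt e s = wgt e t \<longleftrightarrow> s = t"
  by (metis (no_types, lifting) ext lookup_single_eq wgt_def)
lemma pr_wgt [simp]: "pr e (wgt e s) = wgt e s" by (simp add: pr_def wgt_def)
lemma pr_pr [simp]: "pr e (pr e f) = pr e f" by (simp only: pr_def[of e f] pr_wgt)
lemma pr_diff: "pr e (f - g) = pr e f - pr e g" by (simp add: pr_def wgt_def fun_eq_iff lookup_minus single_diff)

lemma lk_pop: "lk (pop p t) j = p * lk t j"
  by (rule additive_eqI[of "\<lambda>t. lk (pop p t) j"])
    (auto simp: pop_add lookup_add algebra_simps lookup_single when_def)

lemma lk_tmul_hp: "lk (t \<odot> sng 0 q) j = lk t j * sh (- (of_int j * h0)) q"
  by (rule additive_eqI[of "\<lambda>t. lk (t \<odot> sng 0 q) j" "\<lambda>t. lk t j * sh (- (of_int j * h0)) q"])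
    (auto simp: tmul_add_left lookup_add algebra_simps lookup_single when_def tmul_single XX_hp)

lemma dg_wt: "G.dg e l = of_int (wt e l) * h0"
  by (simp add: G.dg_def wt_def ss_def sg_def)

text \<open>In each degree the left and the twisted right copy of h differ by a scalar, so the
  commutator is diagonal.\<close>

lemma lk_et: "lk (et e f l) j = smult (of_int (j - wt e l) * h0) (lk (f l) j)"
proof -
  let ?p = "lk (f l) j"
  have "lk (et e f l) j = [:0, 1:] * ?p - ?p * [:of_int (wt e l) * h0 + - (of_int j * h0), 1:]"
    by (simp only: G.eta_def G.R0_def lookup_minus tmul_single XX_0 lk_pop lk_tmul_hp sh_lin dg_wt)
  also have "\<dots> = ([:0, 1:] - [:of_int (wt e l) * h0 + - (of_int j * h0), 1:]) * ?p"
    by (simp only: left_diff_distrib right_diff_distrib mult.commute)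
  finally show ?thesis by (simp add: algebra_simps)
qed

lemma lk_iv: "lk (iv e f l) j = smult (inverse (of_int (j - wt e l) * h0)) (lk (f l) j)"
proof -
  have "lk (pext (\<lambda>j q. sng j (smult (c j) q)) t) j = smult (c j) (lk t j)" for c :: "int \<Rightarrow> 'k" and t
    by (rule additive_eqI[of "\<lambda>t. lk (pext (\<lambda>j q. sng j (smult (c j) q)) t) j"])
      (auto simp: pext_add smult_add_right single_add lookup_add lookup_single when_def)
  then show ?thesis unfolding iv_def .
qed

lemma lk_pr: "lk (pr e f l) j = (if j = wt e l then lk (f l) j else 0)"
  by (auto simp: pr_def wgt_def lookup_single when_def)

end

locale gw0 = gw a h0 for a :: "'k::{field_char_0,field_gcd} poly" and h0 :: 'k +
  assumes h0: "h0 \<noteq> 0" and dega: "degree a \<ge> 1"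
begin

lemma et_iv: "et e (iv e f) = f - pr e f"
proof (intro HOL.ext poly_mapping_eqI)
  fix l j
  \<comment> \<open>Characteristic zero and the nonvanishing of \<open>h0\<close> make every
    eigenvalue off the matching weight invertible.\<close>
  have "of_int (j - wt e l) * h0 * inverse (of_int (j - wt e l) * h0) = 1" if "j \<noteq> wt e l"
    by (rule right_inverse) (use that h0 in \<open>simp del: of_int_diff\<close>)
  then show "lk (et e (iv e f) l) j = lk ((f - pr e f) l) j"
    by (cases "j = wt e l") (simp_all add: lk_et lk_iv lookup_minus lk_pr del: of_int_diff inverse_mult_distrib)
qed

lemma et_wgt [simp]: "et e (wgt e s) = 0"
  by (intro HOL.ext poly_mapping_eqI) (auto simp: lk_et wgt_def lookup_single when_def)

lemma et_pr [simp]: "et e (pr e f) = 0" by (simp add: pr_def)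

lemma pr_et [simp]: "pr e (et e f) = 0"
  by (intro HOL.ext poly_mapping_eqI) (auto simp: lk_et lk_pr)

lemma et_0_pr: "et e f = 0 \<Longrightarrow> f = pr e f"
proof (intro HOL.ext poly_mapping_eqI)
  fix l j assume "et e f = 0"
  then have "smult (of_int (j - wt e l) * h0) (lk (f l) j) = 0" by (metis lk_et lookup_zero zero_fun_def)
  then show "lk (f l) j = lk (pr e f l) j" by (auto simp: lk_pr h0)
qed

lemma inN: "\<forall>l. f l \<in> UNIV" by simp

lemmas dl_diff = G.N0.dlt_diff[OF inN inN] and et_diff = G.N0.eta_diff[OF inN inN] and ta_diff = G.N0.tau_diff[OF inN inN]
lemmas et_dl = G.N0.eta_dlt[OF inN] and et_ta = G.N0.eta_tau[OF inN]

text \<open>\<open>dl\<close> commutes with the commutator and so preserves its image and its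
  kernel, which are the kernel and the image of \<open>pr\<close>.\<close>

lemma pr_dl: "pr (\<not> e) (dl e f) = dl e (pr e f)"
proof -
  have "dl e f - dl e (pr e f) = et (\<not> e) (dl e (iv e f))"
    by (simp add: et_dl et_iv dl_diff)
  then have "pr (\<not> e) (dl e f) - pr (\<not> e) (dl e (pr e f)) = 0"
    by (simp only: pr_diff[symmetric] pr_et)
  then have "pr (\<not> e) (dl e f) = pr (\<not> e) (dl e (pr e f))" by simp
  also have "\<dots> = dl e (pr e f)" by (rule et_0_pr[symmetric]) (simp add: et_dl)
  finally show ?thesis .
qed

lemma pr_ta: "pr e (ta e f) = ta e (pr e f)"
proof -
  have "ta e f - ta e (pr e f) = et e (ta e (iv e f))"
    by (simp add: et_ta et_iv ta_diff)
  then have "pr e (ta e f) - pr e (ta e (pr e f)) = 0"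
    by (simp only: pr_diff[symmetric] pr_et)
  then have "pr e (ta e f) = pr e (ta e (pr e f))" by simp
  also have "\<dots> = ta e (pr e f)" by (rule et_0_pr[symmetric]) (simp add: et_ta)
  finally show ?thesis .
qed

lemma dl_wgt: "dl e (wgt e s) = wgt (\<not> e) (pd e s)"
proof (rule HOL.ext)
  fix l
  have "\<not> 0 \<le> sg l * sg (\<not> l)" by (simp add: sg_def)
  then show "dl e (wgt e s) l = wgt (\<not> e) (pd e s) l"
    by (simp add: G.dlt_def G.R0_def wgt_def pd_def wt_def tmul_single Xo_single single_diff single_add distrib_right)
qed

text \<open>On matching weights the two copies of h coincide, so the divided difference of
  \<open>al l\<close> becomes its derivative.\<close>

lemma ta_wgt: "ta e (wgt e s) = wgt e (\<lambda>l. pderiv (al l) * s l)"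
proof (rule HOL.ext)
  fix l
  let ?F = "wgt e s l"
  have F: "sng 0 [:0, 1:] \<odot> ?F = ?F \<odot> sng 0 [:G.dg e l, 1:]"
    using fun_cong[OF et_wgt[of e s], of l] unfolding G.eta_def G.R0_def by simp
  have "G.Del tmul G.R0 (G.dg e l) p ?F = sng 0 (pderiv p) \<odot> ?F" for p
  proof (induction p)
    case 0 then show ?case by (simp add: G.N0.Del_0)
  next
    case (pCons b p)
    have "G.Del tmul G.R0 (G.dg e l) (pCons b p) ?F = sng 0 p \<odot> ?F + (sng 0 (pderiv p) \<odot> ?F) \<odot> sng 0 [:G.dg e l, 1:]"
      unfolding G.N0.Del_pCons[OF UNIV_I] pCons.IH by (simp add: G.R0_def)
    also have "(sng 0 (pderiv p) \<odot> ?F) \<odot> sng 0 [:G.dg e l, 1:] = sng 0 (pderiv p) \<odot> (sng 0 [:0, 1:] \<odot> ?F)"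
      unfolding F by (simp add: tmul_assoc)
    also have "\<dots> = sng 0 (pCons 0 (pderiv p)) \<odot> ?F"
      by (simp add: G.hp_mul_mul)
    finally show ?case by (simp add: pderiv_pCons G.hp_mul_add)
  qed
  then show "ta e (wgt e s) l = wgt e (\<lambda>l. pderiv (al l) * s l) l"
    by (simp add: G.tau_def tmul_single) (simp add: wgt_def)
qed

section \<open>Reduction to cochains given by pairs of polynomials\<close>

abbreviation "KK \<equiv> G.Kc (UNIV :: ('k gwt) set)"
abbreviation "dd \<equiv> G.sd tmul G.R0"
abbreviation "KZ \<equiv> cyc KK dd"
abbreviation "KB \<equiv> cob KK dd"

definition cst :: "nat \<Rightarrow> (bool \<Rightarrow> 'k poly) \<Rightarrow> (bool \<Rightarrow> 'k poly) \<Rightarrow> bool" where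
  "cst n s r \<longleftrightarrow> (n = 0 \<longrightarrow> s False = s True \<and> r = 0) \<and> (n = 1 \<longrightarrow> r False = r True)"

lemma wgt_KK: "cst n s r \<Longrightarrow> (wgt (even n) s, wgt (odd n) r) \<in> KK n"
  by (auto simp: cst_def G.Kc_def wgt_def wt_def zero_fun_def)

lemma wgt_KK_iff: "(wgt (even n) s, wgt (odd n) r) \<in> KK n \<longleftrightarrow> cst n s r"
  using wgt_inj[of False r 0] lookup_single_eq
  by (auto simp: cst_def G.Kc_def wgt_def wt_def) (metis lookup_single_eq)+

abbreviation "pal r \<equiv> (\<lambda>l. pderiv (al l) * r l)"

lemma dd_wgt: "dd n (wgt (even n) s, wgt (odd n) r) =
    (wgt (odd n) (pd (even n) s - pal r), wgt (even n) (- pd (odd n) r))"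
  using wgt_diff[of "even n" 0 "pd (odd n) r"]
  by (simp add: G.sd_def dl_wgt[of "even n"] dl_wgt[of "odd n", simplified] ta_wgt wgt_diff)

lemma wgt_KZ:
  "(wgt (even n) s, wgt (odd n) r) \<in> KZ n \<longleftrightarrow>
    cst n s r \<and> pd (even n) s = pal r \<and> pd (odd n) r = 0"
  using wgt_inj[of "odd n" _ 0] wgt_inj[of "even n" _ 0]
  by (auto simp: cyc_def wgt_KK_iff dd_wgt zero_prod_def)

text \<open>Subtracting the coboundary of \<open>(iv (odd n) g, 0)\<close> leaves only the matching
  weights of \<open>g\<close>. The commutator of the new first component is then both of matching
  weight and in the image of \<open>et\<close>, hence zero, so this component has matching weight
  too.\<close>

lemma KZ_reduce:
  assumes "z \<in> KZ n"
  shows "\<exists>s r. (wgt (even n) s, wgt (odd n) r) \<in> KZ n \<and> z - (wgt (even n) s, wgt (odd n) r) \<in> KB n"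
proof -
  obtain f g where z: "z = (f, g)" by (cases z)
  have zK: "(f, g) \<in> KK n" and zd: "dd n (f, g) = 0" using assms by (auto simp: z cyc_def)
  \<comment> \<open>In degree 0 the second component is already zero and nothing is
    subtracted.\<close>
  define y where "y = (if n = 0 then (f, g) else (f, g) - dd (n - 1) (iv (odd n) g, 0))"
  have "iv True g False = iv True g True" if "n = 1"
    using zK that by (simp add: G.Kc_def iv_def wt_def)
  then have ivK: "(iv (odd n) g, 0) \<in> KK (n - 1)" if "n \<noteq> 0"
    using that by (cases "n = 1") (simp_all add: G.Kc_def)
  have yB: "(f, g) - y \<in> KB n"
  proof (cases n)
    case 0 then show ?thesis by (simp add: y_def cob_def)
  next
    case (Suc m)
    then have "(f, g) - y = dd m (iv (odd n) g, 0)" by (simp add: y_def)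
    then show ?thesis using ivK Suc by (simp add: cob_def)
  qed
  have yZ: "y \<in> KZ n"
  proof (cases n)
    case 0 then show ?thesis using assms by (simp add: y_def z)
  next
    case (Suc m)
    have i: "(iv (odd n) g, 0) \<in> KK m" using ivK Suc by simp
    have "dd m (iv (odd n) g, 0) \<in> KK n" using G.N0.sd_in[OF i] Suc by simp
    then have "(f, g) - dd m (iv (odd n) g, 0) \<in> KK n" "dd n ((f, g) - dd m (iv (odd n) g, 0)) = 0"
      using zK zd G.N0.sd_sd[OF i] Suc G.N0.sd_diff[of "(f, g)" n "dd m (iv (odd n) g, 0)"]
      by (auto intro!: G.Kc_diff)
    then show ?thesis using Suc by (simp add: y_def cyc_def)
  qed
  have "snd y = pr (odd n) g"
  proof (cases n)
    case 0
    then show ?thesis using zK by (auto simp: y_def G.Kc_def pr_def wgt_def fun_eq_iff)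
  next
    case (Suc m)
    then show ?thesis using et_iv[of "even m" g] by (simp add: y_def G.sd_def)
  qed
  then obtain f1 where y: "y = (f1, pr (odd n) g)" by (cases y) simp
  have "dd n (f1, pr (odd n) g) = 0" using yZ by (simp add: cyc_def y)
  then have e1: "et (even n) f1 = dl (odd n) (pr (odd n) g)" by (simp add: G.sd_def zero_prod_def)
  have "dl (odd n) (pr (odd n) g) = pr (even n) (dl (odd n) (pr (odd n) g))"
    using pr_dl[of "odd n" "pr (odd n) g"] by simp
  also have "\<dots> = 0" by (simp only: e1[symmetric] pr_et)
  finally have "et (even n) f1 = 0" by (simp only: e1)
  then have "f1 = pr (even n) f1" by (rule et_0_pr)
  then obtain s r where "y = (wgt (even n) s, wgt (odd n) r)"
    unfolding y pr_def[of "odd n"] by (simp only: pr_def[of "even n"]) blast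
  then show ?thesis using yZ yB by (auto simp: z)
qed

text \<open>Projecting a primitive to the matching weights gives a primitive again, since
  \<open>pr\<close> commutes with \<open>dl\<close> and \<open>ta\<close> and kills the image of
  \<open>et\<close>.\<close>

lemma wgt_KB:
  "(wgt (odd m) s, wgt (even m) r) \<in> KB (Suc m) \<longleftrightarrow>
    (\<exists>s' r'. cst m s' r' \<and> s = pd (even m) s' - pal r' \<and> r = - pd (odd m) r')"
    (is "_ \<longleftrightarrow> ?ex")
proof
  assume ?ex
  then obtain s' r' where "cst m s' r'" "s = pd (even m) s' - pal r'" "r = - pd (odd m) r'"
    by blast
  then have "(wgt (odd m) s, wgt (even m) r) = dd m (wgt (even m) s', wgt (odd m) r')"
      "(wgt (even m) s', wgt (odd m) r') \<in> KK m"
    by (simp_all add: dd_wgt wgt_KK)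
  then show "(wgt (odd m) s, wgt (even m) r) \<in> KB (Suc m)" unfolding cob_def by auto
next
  assume "(wgt (odd m) s, wgt (even m) r) \<in> KB (Suc m)"
  then obtain f g where fg: "(f, g) \<in> KK m" and e: "(wgt (odd m) s, wgt (even m) r) = dd m (f, g)"
    by (auto simp: cob_def)
  obtain s' r' where sr: "pr (even m) f = wgt (even m) s'" "pr (odd m) g = wgt (odd m) r'" unfolding pr_def by blast
  have e12: "wgt (odd m) s = dl (even m) f - ta (odd m) g" "wgt (even m) r = et (even m) f - dl (odd m) g"
    using e by (simp_all add: G.sd_def)
  have "wgt (odd m) s = pr (odd m) (dl (even m) f - ta (odd m) g)"
    unfolding e12(1)[symmetric] by simp
  also have "\<dots> = dl (even m) (pr (even m) f) - ta (odd m) (pr (odd m) g)"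
    using pr_dl[of "even m" f] by (simp add: pr_diff pr_ta)
  finally have 1: "wgt (odd m) s = dl (even m) (pr (even m) f) - ta (odd m) (pr (odd m) g)" .
  have "wgt (even m) r = pr (even m) (et (even m) f - dl (odd m) g)"
    unfolding e12(2)[symmetric] by simp
  also have "\<dots> = - dl (odd m) (pr (odd m) g)"
    using pr_dl[of "odd m" g] by (simp add: pr_diff)
  finally have 2: "wgt (even m) r = - dl (odd m) (pr (odd m) g)" .
  have K: "(wgt (even m) s', wgt (odd m) r') \<in> KK m"
    unfolding sr[symmetric] using fg by (auto simp: G.Kc_def pr_def wgt_def wt_def fun_eq_iff)
  have "(wgt (odd m) s, wgt (even m) r) = dd m (wgt (even m) s', wgt (odd m) r')"
    unfolding 1 2 sr G.sd_def by simp
  then show ?ex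
    using K unfolding dd_wgt wgt_KK_iff by (auto simp: wgt_inj)
qed

lemma KB_add:
  assumes "x \<in> KB n" "y \<in> KB n" shows "x + y \<in> KB n"
proof (cases n)
  case 0 then show ?thesis using assms by (simp add: cob_def)
next
  case (Suc m)
  obtain u v where u: "u \<in> KK m" "x = dd m u" and v: "v \<in> KK m" "y = dd m v" using assms Suc by (auto simp: cob_def)
  have z: "0 \<in> KK m" by (auto simp: G.Kc_def zero_prod_def)
  have v': "0 - v \<in> KK m" using z v by (intro G.Kc_diff) auto
  have "dd m (u - (0 - v)) = dd m u - (dd m 0 - dd m v)"
    using G.N0.sd_diff[OF u(1) v'] G.N0.sd_diff[OF z v(1)] by simp
  moreover have "dd m 0 = 0" using G.N0.sd_diff[OF z z] by simp
  moreover have "u - (0 - v) \<in> KK m" using G.Kc_diff[OF _ u(1) v'] by simp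
  ultimately show ?thesis using u v Suc by (force simp: cob_def)
qed

end

lemma bool_fun_const:
  assumes "s False = s True"
  obtains c where "s = (\<lambda>_. c)"
proof
  show "s = (\<lambda>_. s True)"
  proof
    fix l show "s l = s True" using assms by (cases l) simp_all
  qed
qed

context gw0
begin

text \<open>The pair of polynomials on the two words of even length determined by its value at the word starting with \<open>y\<close>.\<close>

definition ev :: "'k poly \<Rightarrow> bool \<Rightarrow> 'k poly" where "ev t l = (if l then sh (- h0) t else t)"

lemma ev_False [simp]: "ev t False = t" by (simp add: ev_def)
lemma ev_add: "ev (s + t) = ev s + ev t" by (auto simp: ev_def sh_add)
lemma ev_diff: "ev (s - t) = ev s - ev t" by (auto simp: ev_def sh_diff)
lemma ev_0 [simp]: "ev 0 = 0" by (auto simp: ev_def)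
lemma ev_inj: "ev s = ev t \<longleftrightarrow> s = t" by (metis ev_False)

lemma a_nonzero [simp]: "a \<noteq> 0" using dega by auto

text \<open>On even words the coboundaries are the multiples of a: this is the origin of the
  relative cohomology k[h]/(a).\<close>

lemma pd_False: "pd False s = ev ((sh h0 (s True) + s False) * a)"
  by (auto simp: pd_def ev_def fun_eq_iff ss_def al_def sh_add sh_mult sh_sh add.commute)

lemma pderiv_al_ev: "pal (ev t) = ev (pderiv a * t)"
  by (auto simp: ev_def al_def fun_eq_iff pderiv_sh sh_mult)

lemma pd_True_0: "pd True r = 0 \<longleftrightarrow> r = ev (r False)"
proof
  assume "pd True r = 0"
  then have "pd True r True = 0" by simp
  then have "r True = sh (- h0) (r False)" by (simp add: pd_def ss_def)
  then show "r = ev (r False)" by (auto simp: fun_eq_iff ev_def)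
next
  assume "r = ev (r False)"
  then obtain t where "r = ev t" by blast
  then show "pd True r = 0" by (auto simp: pd_def ev_def ss_def sh_sh fun_eq_iff)
qed

text \<open>One difference equation solves both components. The primitive has the same value for
  both letters, so it is available in degree 0 as well.\<close>

lemma pd_False_0:
  assumes "pd False q = 0"
  obtains s0 where "q = pd True (\<lambda>_. s0)"
proof -
  have "(sh h0 (q True) + q False) * a = 0" using assms ev_inj[of _ 0] unfolding pd_False by simp
  then have "q False = - sh h0 (q True)" using a_nonzero by (simp add: eq_neg_iff_add_eq_0 add.commute)
  then have qF: "q False = sh h0 (- q True)" by (simp add: sh_minus)
  obtain s0 where s0: "sh h0 s0 - s0 = q False" using sh_diff_surj[OF h0] by blast
  have "sh (- h0) s0 - s0 = q True"
    using arg_cong[OF s0[unfolded qF], of "sh (- h0)"] by (simp add: sh_diff sh_sh sh_minus algebra_simps)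
  then have "q = pd True (\<lambda>_. s0)" using s0 by (auto simp: pd_def ss_def fun_eq_iff)
  then show ?thesis by (rule that)
qed

lemma pd_True_const_0: "pd True (\<lambda>_. s0) = 0 \<Longrightarrow> s0 = [:coeff s0 0:]"
proof -
  assume "pd True (\<lambda>_. s0) = 0"
  then have "pd True (\<lambda>_. s0) False = 0" by simp
  then have "sh h0 s0 = s0" by (simp add: pd_def ss_def)
  then show "s0 = [:coeff s0 0:]" using h0 by (rule sh_fixed_const)
qed

lemma pd_0 [simp]: "pd e 0 = 0" by (auto simp: pd_def fun_eq_iff)

lemma degree_pderiv_a: "degree (pderiv a) = degree a - 1" by (rule degree_pderiv)

lemma pderiv_nz [simp]: "pderiv a \<noteq> 0" using dega by (simp add: pderiv_eq_0_iff)

lemma ksc_wgt: "G.ksc c (wgt e s, wgt e' r) = (wgt e (\<lambda>l. smult c (s l)), wgt e' (\<lambda>l. smult c (r l)))"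
  by (simp add: G.ksc_def wgt_def fun_eq_iff)

lemma coeffs_high_eq_0:
  fixes p q :: "'k poly"
  assumes "p dvd q" "\<forall>i\<ge>degree p. coeff q i = 0" shows "q = 0"
proof (rule ccontr)
  assume "q \<noteq> 0"
  then have "degree p \<le> degree q" using assms(1) by (rule dvd_imp_degree_le[rotated])
  then show False using assms(2) \<open>q \<noteq> 0\<close> by (metis leading_coeff_0_iff)
qed

lemma mod_high: "(p::'k poly) \<noteq> 0 \<Longrightarrow> i \<ge> degree p \<Longrightarrow> coeff (t mod p) i = 0"
  using degree_mod_less[of p t] by (auto intro: coeff_eq_0)

section \<open>Dimensions degree by degree\<close>

lemma KH0: "qdim G.ksc (KZ 0) (KB 0) 1"
  unfolding qdim_def
proof (intro exI[of _ "\<lambda>_. (wgt True (\<lambda>_. 1), 0)"] conjI allI impI ballI)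
  have e: "(\<Sum>i<1. G.ksc (c i) (wgt True (\<lambda>_. 1), 0)) = (wgt True (\<lambda>_. [:c 0:]), 0)" for c :: "nat \<Rightarrow> 'k"
    using ksc_wgt[of "c 0" True "\<lambda>_. 1" False 0] wgt_0[of False] by (simp add: zero_fun_def)
  have Z: "(wgt True (\<lambda>_. s0), 0) \<in> KZ 0 \<longleftrightarrow> pd True (\<lambda>_. s0) = 0" for s0
    using wgt_KZ[of 0 "\<lambda>_. s0" 0] by (simp add: cst_def zero_fun_def[symmetric])
  show "(wgt True (\<lambda>_. 1), 0) \<in> KZ 0" unfolding Z by (simp add: pd_def fun_eq_iff)
  {
    fix c :: "nat \<Rightarrow> 'k" and i :: nat
    assume "(\<Sum>i<1. G.ksc (c i) (wgt True (\<lambda>_. 1), 0)) \<in> KB 0" "i < 1"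
    then have "wgt True (\<lambda>_. [:c 0:]) = wgt True 0" "i = 0" unfolding e by (auto simp: cob_def zero_prod_def)
    then have "(\<lambda>_::bool. [:c 0:]) = 0" "i = 0" by (simp_all only: wgt_inj)
    then show "c i = 0" by (auto simp: fun_eq_iff)
  next
    fix z assume z: "z \<in> KZ 0"
    obtain s r where sr: "(wgt True s, wgt False r) \<in> KZ 0" "z - (wgt True s, wgt False r) \<in> KB 0"
      using KZ_reduce[OF z] by auto
    have cst: "s False = s True" "r = 0" and pd: "pd True s = 0"
      using sr(1) wgt_KZ[of 0 s r] by (auto simp: cst_def zero_fun_def)
    obtain s0 where s: "s = (\<lambda>_. s0)" using cst(1) by (rule bool_fun_const)
    have "s0 = [:coeff s0 0:]" using pd unfolding s by (rule pd_True_const_0)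
    then obtain k where k: "s0 = [:k:]" by blast
    have "(\<Sum>i<1. G.ksc ((\<lambda>_::nat. k) i) (wgt True (\<lambda>_. 1), 0)) = (wgt True s, wgt False r)"
      unfolding s cst(2) k wgt_0 by (rule e[of "\<lambda>_. k"])
    then have "z - (\<Sum>i<1. G.ksc ((\<lambda>_::nat. k) i) (wgt True (\<lambda>_. 1), 0)) \<in> KB 0" using sr(2) by (simp only:)
    then show "\<exists>c::nat \<Rightarrow> 'k. z - (\<Sum>i<1. G.ksc (c i) (wgt True (\<lambda>_. 1), 0)) \<in> KB 0"
      by (rule exI[of _ "\<lambda>_. k"])
  }
qed

lemma KB_boundary: "cst m s' r' \<Longrightarrow> (wgt (odd m) (pd (even m) s' - pal r'), wgt (even m) (- pd (odd m) r')) \<in> KB (Suc m)"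
  using wgt_KB by blast

text \<open>The component on the empty word is a constant c such that a divides c a', so c = 0 by
  degree. What remains is a relative cocycle on odd words, hence a coboundary.\<close>

lemma KH1: "qdim G.ksc (KZ 1) (KB 1) 0"
proof -
  have "z \<in> KB 1" if z: "z \<in> KZ 1" for z
  proof -
    obtain s r where sr: "(wgt False s, wgt True r) \<in> KZ 1" "z - (wgt False s, wgt True r) \<in> KB 1"
      using KZ_reduce[OF z] by auto
    have cst: "r False = r True" and pd: "pd False s = pal r" "pd True r = 0"
      using sr(1) wgt_KZ[of 1 s r] by (auto simp: cst_def)
    obtain c where rc: "r False = [:c:]"
    proof -
      obtain r0 where r0: "r = (\<lambda>_. r0)" using cst by (rule bool_fun_const)
      have "r0 = [:coeff r0 0:]" using pd(2) unfolding r0 by (rule pd_True_const_0)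
      then show ?thesis using that[of "coeff r0 0"] by (simp add: r0)
    qed
    define r1 where "r1 = r False"
    have r: "r = ev r1" using pd(2) pd_True_0 unfolding r1_def by blast
    have "ev ((sh h0 (s True) + s False) * a) = ev (pderiv a * r1)"
      using pd(1) unfolding r pd_False pderiv_al_ev .
    then have "(sh h0 (s True) + s False) * a = smult c (pderiv a)" unfolding ev_inj using rc by (simp add: r1_def)
    then have "a dvd smult c (pderiv a)" by (metis dvd_triv_right)
    then have "smult c (pderiv a) = 0"
      by (rule coeffs_high_eq_0) (use dega in \<open>auto simp: coeff_eq_0 degree_pderiv_a\<close>)
    then have "r = 0" using r rc by (simp add: r1_def)
    then have "pd False s = 0" using pd(1) by (simp add: zero_fun_def)
    then obtain s0 where "s = pd True (\<lambda>_. s0)" using pd_False_0 by blast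
    then have "(wgt False s, wgt True r) \<in> KB 1"
      using KB_boundary[of 0 "\<lambda>_. s0" 0] \<open>r = 0\<close> by (simp add: cst_def zero_fun_def[symmetric])
    from KB_add[OF sr(2) this] show ?thesis by (simp only: diff_add_cancel)
  qed
  then show ?thesis by (auto simp: qdim_def)
qed

text \<open>Even classes are polynomials modulo a and modulo a' times the relative classes two
  degrees lower. In degree 2 the multiplier of a' lives on the empty word, so it is invariant under
  translation, that is constant.\<close>

lemma KH_even_if_ideal:
  assumes "even m" and n: "n = Suc (Suc m)"
    and rem: "\<And>t. \<exists>r. (\<forall>i\<ge>k. coeff r i = 0) \<and> t - r \<in> I"
    and indep: "\<And>t. t \<in> I \<Longrightarrow> (\<forall>i\<ge>k. coeff t i = 0) \<Longrightarrow> t = 0"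
    and I: "I = {u * a - pderiv a * v | u v. m = 0 \<longrightarrow> (\<exists>c. v = [:c:])}"
  shows "qdim G.ksc (KZ n) (KB n) k"
proof -
  have nn: "even n" "n \<noteq> 0" "n \<noteq> 1" using assms by auto
  define E where "E t = (wgt True (ev t), wgt False 0 :: bool \<Rightarrow> 'k gwt)" for t
  have EB: "E t \<in> KB n \<longleftrightarrow> t \<in> I" for t
  proof -
    have "E t \<in> KB n \<longleftrightarrow> (\<exists>s' r'. cst (Suc m) s' r' \<and> ev t = pd False s' - pal r' \<and> 0 = - pd True r')"
      (is "_ \<longleftrightarrow> ?ex")
      using wgt_KB[of "Suc m" "ev t" 0] assms by (simp add: E_def)
    also have "\<dots> \<longleftrightarrow> t \<in> I"
    proof
      assume ?ex
      then obtain s' r' where *: "cst (Suc m) s' r'" "ev t = pd False s' - pal r'" "pd True r' = 0"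
        by auto
      have r': "r' = ev (r' False)" using *(3) pd_True_0 by blast
      have "pal r' = ev (pderiv a * r' False)"
        by (subst r') (rule pderiv_al_ev)
      then have t: "t = (sh h0 (s' True) + s' False) * a - pderiv a * r' False"
        using *(2) unfolding pd_False by (simp only: ev_diff[symmetric] ev_inj)
      moreover have "\<exists>c. r' False = [:c:]" if "m = 0"
      proof -
        have "r' False = r' True" using *(1) that by (simp add: cst_def)
        then obtain r0 where r0: "r' = (\<lambda>_. r0)" by (rule bool_fun_const)
        have "r0 = [:coeff r0 0:]" using *(3) unfolding r0 by (rule pd_True_const_0)
        then show ?thesis unfolding r0 by blast
      qed
      ultimately show "t \<in> I" unfolding I by blast
    next
      assume "t \<in> I"
      then obtain u v where t: "t = u * a - pderiv a * v" and v: "m = 0 \<longrightarrow> (\<exists>c. v = [:c:])" unfolding I by blast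
      \<comment> \<open>Only \<open>sh h0 (s True) + s False\<close> enters
        \<open>pd False s\<close>, so \<open>u\<close> may be placed on one letter.\<close>
      let ?s = "\<lambda>l. if l then 0 else u"
      have "cst (Suc m) ?s (ev v)" using v by (auto simp: cst_def ev_def)
      moreover have "ev t = pd False ?s - pal (ev v)"
        unfolding pderiv_al_ev pd_False by (simp add: t ev_diff)
      moreover have "pd True (ev v) = 0" by (subst pd_True_0) simp
      ultimately show ?ex
        by (intro exI[of _ ?s] exI[of _ "ev v"]) simp
    qed
    finally show ?thesis .
  qed
  have EZ: "(wgt True s, wgt False 0) \<in> KZ n \<longleftrightarrow> s = ev (s False)" for s
    using wgt_KZ[of n s 0] nn pd_True_0 by (simp add: cst_def zero_fun_def[symmetric])
  show ?thesis
  proof (rule qdim_poly[of E _ _ _ I])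
    show "E (s + t) = E s + E t" for s t by (simp add: E_def ev_add wgt_add)
    show "E (smult c t) = G.ksc c (E t)" for c t
      unfolding E_def ksc_wgt by (auto simp: ev_def sh_smult zero_fun_def intro!: arg_cong[of _ _ "wgt True"])
    show "E t \<in> KZ n" for t unfolding E_def EZ by simp
    show "E t \<in> KB n \<longleftrightarrow> t \<in> I" for t by (rule EB)
    show "\<exists>r. (\<forall>i\<ge>k. coeff r i = 0) \<and> t - r \<in> I" for t by (rule rem)
    show "t \<in> I \<Longrightarrow> (\<forall>i\<ge>k. coeff t i = 0) \<Longrightarrow> t = 0" for t by (rule indep)
    show "x \<in> KB n \<Longrightarrow> y \<in> KB n \<Longrightarrow> x + y \<in> KB n" for x y by (rule KB_add)
    fix z assume z: "z \<in> KZ n"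
    obtain s r where sr: "(wgt True s, wgt False r) \<in> KZ n" "z - (wgt True s, wgt False r) \<in> KB n"
      using KZ_reduce[OF z] nn by auto
    have pd: "pd True s = pal r" "pd False r = 0"
      using sr(1) wgt_KZ[of n s r] nn by auto
    \<comment> \<open>The component \<open>r\<close> is a relative coboundary. The boundary of
      \<open>(0, - q)\<close> on weight components removes it and changes the even component by a
      multiple of a', namely \<open>?D\<close>.\<close>
    obtain q where q: "r = pd True (\<lambda>_. q)" using pd_False_0[OF pd(2)] by blast
    let ?D = "\<lambda>l. pderiv (al l) * (- q)"
    have B: "(wgt True (- ?D), wgt False r) \<in> KB n"
    proof -
      have "- pd True (\<lambda>_. - q) = r" unfolding q by (auto simp: pd_def fun_eq_iff sh_minus)
      moreover have "cst (Suc m) 0 (\<lambda>_. - q)" by (simp add: cst_def)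
      ultimately show ?thesis using KB_boundary[of "Suc m" 0 "\<lambda>_. - q"] assms by (simp add: fun_diff_def fun_Compl_def)
    qed
    have "pd True (s + ?D) = pd True s - pal r"
    proof (rule HOL.ext)
      fix l
      have "sh (- ss l) (pderiv (al (\<not> l))) = pderiv (al l)" by (simp add: pderiv_sh[symmetric] al_sh)
      then show "pd True (s + ?D) l = (pd True s - pal r) l"
        by (simp add: pd_def q sh_add sh_mult sh_minus sh_diff algebra_simps)
    qed
    then have "pd True (s + ?D) = 0" using pd by simp
    then have "s + ?D = ev ((s + ?D) False)" by (subst (asm) pd_True_0)
    then obtain t where t: "s + ?D = ev t" by blast
    have "(wgt True s, wgt False r) - E t = (wgt True (- ?D), wgt False r)"
      unfolding E_def t[symmetric] using wgt_diff[of True s "s + ?D"] by (simp add: fun_diff_def fun_Compl_def)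
    then have "z - E t = (z - (wgt True s, wgt False r)) + (wgt True (- ?D), wgt False r)"
      by (simp add: algebra_simps)
    then have "z - E t \<in> KB n" using KB_add[OF sr(2) B] by (simp only:)
    then show "\<exists>t. z - E t \<in> KB n" ..
  qed
qed

text \<open>Division by a leaves degree below n, and a', of exact degree n - 1, clears one more
  coefficient.\<close>

lemma KH2: "qdim G.ksc (KZ 2) (KB 2) (degree a - 1)"
proof (rule KH_even_if_ideal[of 0 _ _ "{u * a - pderiv a * v | u v. \<exists>c. v = [:c:]}"])
  fix t
  let ?r = "t mod a"
  let ?c = "coeff ?r (degree a - 1) / lead_coeff (pderiv a)"
  let ?q = "?r - smult ?c (pderiv a)"
  have "coeff ?q i = 0" if "i \<ge> degree a - 1" for i
  proof (cases "i = degree a - 1")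
    case True
    then show ?thesis using degree_pderiv_a pderiv_nz by (simp add: leading_coeff_0_iff[symmetric] del: leading_coeff_0_iff pderiv_nz)
  next
    case False
    then have "i \<ge> degree a" "i > degree (pderiv a)" using that degree_pderiv_a by auto
    then show ?thesis by (simp add: mod_high coeff_eq_0)
  qed
  moreover have "t - ?q = (t div a) * a - pderiv a * [:- ?c:]"
    using div_mult_mod_eq[of t a] by (simp add: algebra_simps)
  ultimately show "\<exists>r. (\<forall>i\<ge>degree a - 1. coeff r i = 0) \<and> t - r \<in> {u * a - pderiv a * v | u v. \<exists>c. v = [:c:]}"
    by blast
next
  fix t assume "t \<in> {u * a - pderiv a * v | u v. \<exists>c. v = [:c:]}" and h: "\<forall>i\<ge>degree a - 1. coeff t i = 0"
  then obtain u c where t: "t = u * a - smult c (pderiv a)" by auto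
  then have "a dvd t + smult c (pderiv a)" by simp
  then have "t + smult c (pderiv a) = 0"
    by (rule coeffs_high_eq_0) (use h dega degree_pderiv_a in \<open>auto simp: coeff_eq_0\<close>)
  then have 0: "t = - smult c (pderiv a)" by (simp add: eq_neg_iff_add_eq_0)
  have "coeff t (degree a - 1) = 0" using h by simp
  then have "c * lead_coeff (pderiv a) = 0" unfolding 0 degree_pderiv_a by simp
  then show "t = 0" using 0 by simp
qed auto

abbreviation "gg \<equiv> gcd a (pderiv a)"

lemma gg_nz [simp]: "gg \<noteq> 0" by simp

text \<open>Bezout identifies the subspace with the ideal generated by the gcd, and remainders
  modulo the gcd represent the classes.\<close>

lemma KH_even:
  assumes "even n" "n \<ge> 4" shows "qdim G.ksc (KZ n) (KB n) (degree gg)"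
proof (rule KH_even_if_ideal[of "n - 2" _ _ "{u * a - pderiv a * v | u v. True}"])
  fix t
  obtain x y where xy: "x * a + y * pderiv a = gg" using bezout_coefficients_fst_snd by metis
  have "t - t mod gg = (t div gg) * gg" by (simp add: minus_mod_eq_div_mult)
  also have "\<dots> = (t div gg * x) * a - pderiv a * (- (t div gg * y))" by (simp add: xy[symmetric] algebra_simps)
  finally show "\<exists>r. (\<forall>i\<ge>degree gg. coeff r i = 0) \<and> t - r \<in> {u * a - pderiv a * v | u v. True}"
    using mod_high[OF gg_nz] by blast
next
  fix t assume "t \<in> {u * a - pderiv a * v | u v. True}" and h: "\<forall>i\<ge>degree gg. coeff t i = 0"
  then have "gg dvd t" by (auto intro!: dvd_diff)
  then show "t = 0" using h by (rule coeffs_high_eq_0)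
qed (use assms in auto)

text \<open>Write a = b g and a' = c g with b, c coprime. The kernel of a' on k[h]/(a) consists of
  the multiples b w, and b w vanishes there iff g divides w, so the kernel is a copy of
  k[h]/(g).\<close>

lemma KH_odd:
  assumes "odd n" "n \<ge> 3" shows "qdim G.ksc (KZ n) (KB n) (degree gg)"
proof -
  obtain m where m: "n = Suc (Suc m)" "odd m" using assms 
    by (intro that[of "n - 2"]) auto
  then have nn: "odd n" "n \<noteq> 0" "n \<noteq> 1" "m \<noteq> 0" using odd_pos[of m] by auto
  obtain g b c where g: "g = gg" and bc: "a = b * g" "pderiv a = c * g" and cop: "coprime b c"
  proof
    show "gg = gg" ..
    show "a = a div gg * gg" "pderiv a = pderiv a div gg * gg" by simp_all
    show "coprime (a div gg) (pderiv a div gg)" by (rule div_gcd_coprime) simp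
  qed
  have gnz: "g \<noteq> 0" by (simp add: g)
  have bnz: "b \<noteq> 0" using bc(1) a_nonzero by auto
  have ca: "c * a = pderiv a * b" by (simp only: bc(2)) (subst bc(1), simp only: mult_ac)
  \<comment> \<open>\<open>F w\<close> witnesses a' (b w) = (c w) a, which completes b w to a
    cocycle of the total complex.\<close>
  define F where "F w l = (if l then 0 else c * w)" for w l
  define E where "E w = (wgt False (F w), wgt True (ev (b * w)))" for w
  have FE: "pd False (F w) = pal (ev (b * w))" for w
  proof -
    have "(sh h0 (F w True) + F w False) * a = (c * a) * w" by (simp add: F_def mult_ac)
    also have "\<dots> = pderiv a * (b * w)" unfolding ca by (simp only: mult_ac)
    finally show ?thesis unfolding pd_False pderiv_al_ev ev_inj .
  qed
  have EB: "E w \<in> KB n \<longleftrightarrow> g dvd w" for w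
  proof -
    have "E w \<in> KB n \<longleftrightarrow> (\<exists>s' r'. cst (Suc m) s' r' \<and> F w = pd True s' - pal r' \<and> ev (b * w) = - pd False r')"
      (is "_ \<longleftrightarrow> ?ex")
      using wgt_KB[of "Suc m" "F w" "ev (b * w)"] m by (simp add: E_def)
    also have "\<dots> \<longleftrightarrow> g dvd w"
    proof
      assume ?ex
      then obtain r' where "ev (b * w) = 0 - pd False r'" by auto
      then have "b * w = 0 - (sh h0 (r' True) + r' False) * a"
        unfolding pd_False ev_0[symmetric] by (simp only: ev_diff[symmetric] ev_inj)
      then have "b * w = b * (g * - (sh h0 (r' True) + r' False))" by (simp add: bc(1) algebra_simps)
      then show "g dvd w" using bnz by simp
    next
      assume "g dvd w"
      then obtain v where w: "w = g * v" by blast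
      let ?r = "\<lambda>l. if l then 0 else - v"
      have "cst (Suc m) 0 ?r" using nn by (simp add: cst_def)
      moreover have "F w = pd True 0 - pal ?r"
      proof -
        have "c * w = pderiv a * v" by (simp only: w bc(2) mult_ac)
        then show ?thesis by (auto simp: F_def fun_eq_iff al_def)
      qed
      moreover have "ev (b * w) = 0 - pd False ?r"
      proof -
        have "b * w = v * a" unfolding w by (subst bc(1)) (simp only: mult_ac)
        then show ?thesis unfolding pd_False ev_0[symmetric] ev_diff[symmetric] ev_inj by simp
      qed
      ultimately show ?ex
        by (intro exI[of _ 0] exI[of _ ?r]) simp
    qed
    finally show ?thesis .
  qed
  show ?thesis
  proof (rule qdim_poly[of E _ _ _ "{w. g dvd w}"])
    have "F (s + t) = F s + F t" for s t by (auto simp: F_def fun_eq_iff distrib_left)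
    then show "E (s + t) = E s + E t" for s t by (simp add: E_def distrib_left ev_add wgt_add)
    show "E (smult k t) = G.ksc k (E t)" for k t
      unfolding E_def ksc_wgt by (auto simp: ev_def F_def sh_smult intro!: arg_cong[of _ _ "wgt _"])
    show "E t \<in> KZ n" for t
      using wgt_KZ[of n "F t" "ev (b * t)"] nn FE pd_True_0 by (simp add: E_def cst_def)
    show "E t \<in> KB n \<longleftrightarrow> t \<in> {w. g dvd w}" for t by (simp add: EB)
    show "\<exists>r. (\<forall>i\<ge>degree gg. coeff r i = 0) \<and> t - r \<in> {w. g dvd w}" for t
      unfolding g using mod_high[OF gg_nz] dvd_minus_mod[of gg t] by blast
    show "t \<in> {w. g dvd w} \<Longrightarrow> (\<forall>i\<ge>degree gg. coeff t i = 0) \<Longrightarrow> t = 0" for t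
      unfolding g using coeffs_high_eq_0[of gg t] by simp
    show "x \<in> KB n \<Longrightarrow> y \<in> KB n \<Longrightarrow> x + y \<in> KB n" for x y by (rule KB_add)
    fix z assume z: "z \<in> KZ n"
    obtain s r where sr: "(wgt False s, wgt True r) \<in> KZ n" "z - (wgt False s, wgt True r) \<in> KB n"
      using KZ_reduce[OF z] nn by auto
    have pd: "pd False s = pal r" "pd True r = 0"
      using sr(1) wgt_KZ[of n s r] nn by auto
    have "r = ev (r False)" using pd(2) pd_True_0 by blast
    then obtain t where t: "r = ev t" by blast
    have eq: "(sh h0 (s True) + s False) * a = pderiv a * t"
      using pd(1) unfolding t pd_False pderiv_al_ev ev_inj .
    have "g * ((sh h0 (s True) + s False) * b) = (sh h0 (s True) + s False) * a"
      by (subst bc(1)) (simp only: mult_ac)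
    also have "\<dots> = g * (c * t)" unfolding eq bc(2) by (simp only: mult_ac)
    finally have eq': "(sh h0 (s True) + s False) * b = c * t" using gnz by simp
    then have "b dvd t" using cop by (metis coprime_dvd_mult_right_iff dvd_triv_right)
    then obtain w where w: "t = b * w" by blast
    have "(sh h0 (s True) + s False) = c * w" using eq' bnz by (simp add: w mult_ac)
    then have "pd False (s - F w) = 0" unfolding pd_False by (simp add: F_def add_diff_eq)
    then obtain s0 where s0: "s - F w = pd True (\<lambda>_. s0)" using pd_False_0 by blast
    have "(wgt False (s - F w), 0) \<in> KB n"
      using KB_boundary[of "Suc m" "\<lambda>_. s0" 0] m s0 by (simp add: cst_def zero_fun_def[symmetric])
    moreover have "(wgt False s, wgt True r) - E w = (wgt False (s - F w), 0)"
      by (simp add: E_def t w wgt_diff)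
    then have "z - E w = (z - (wgt False s, wgt True r)) + (wgt False (s - F w), 0)"
      by (simp add: algebra_simps)
    ultimately have "z - E w \<in> KB n" using KB_add[OF sr(2)] by (simp only:)
    then show "\<exists>t. z - E t \<in> KB n" ..
  qed
qed

end

section \<open>Transfer to the presented algebra\<close>

context alg
begin

text \<open>Each step of the recursion moves the index by one and flips all later signs.\<close>

lemma bar_sum_list:
  "length ys = Suc n \<Longrightarrow> - bar f ys = sum_list (map (\<lambda>j. sm ((-1) ^ (j + 1))
     (f (take j ys @ (ys ! j) \<odot> (ys ! (j + 1)) # drop (j + 2) ys))) [0..<n] @
     [sm ((-1) ^ (n + 1)) (f (take n ys) \<odot> (ys ! n))])"
proof (induction n arbitrary: f ys)
  case 0
  then obtain y where "ys = [y]" by (auto simp: length_Suc_conv)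
  then show ?case by (simp add: sm_minus_left)
next
  case (Suc n)
  then obtain x y zs where ys: "ys = x # y # zs" by (auto simp: length_Suc_conv)
  let ?S = "sum_list (map (\<lambda>j. sm ((-1) ^ (j + 1))
     (f (x # take j (y # zs) @ ((y # zs) ! j) \<odot> ((y # zs) ! (j + 1)) # drop (j + 2) (y # zs)))) [0..<n] @
     [sm ((-1) ^ (n + 1)) (f (x # take n (y # zs)) \<odot> ((y # zs) ! n))])"
  have "- bar (\<lambda>ws. f (x # ws)) (y # zs) = ?S"
    by (rule Suc.IH) (use Suc.prems in \<open>simp add: ys\<close>)
  then have IH: "bar (\<lambda>ws. f (x # ws)) (y # zs) = - ?S" by (rule minus_equation_iff[THEN iffD1, THEN sym])
  have neg: "sum_list (map (\<lambda>j. - g j) xs) = - sum_list (map g xs)" for g :: "nat \<Rightarrow> 'a" and xs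
    by (induction xs) simp_all
  have "[0..<Suc n] = 0 # map Suc [0..<n]" by (simp add: upt_conv_Cons map_Suc_upt del: upt_Suc)
  then show ?case unfolding ys
    using IH by (simp add: sm_minus_left comp_def neg del: upt_Suc)
qed

end

section \<open>Transport of cochains along an isomorphism of algebras\<close>

lemma cochain_in: "is_cochain A n f \<Longrightarrow> length xs = n \<Longrightarrow> set xs \<subseteq> kcar A \<Longrightarrow> f xs \<in> kcar A"
  by (simp add: is_cochain_def)

lemma cochain_off: "is_cochain A n f \<Longrightarrow> \<not> (length xs = n \<and> set xs \<subseteq> kcar A) \<Longrightarrow> f xs = kzero A"
  by (simp add: is_cochain_def)

lemma cochain_add_sm:
  assumes "is_cochain A n f" "length us + length vs + 1 = n" "set us \<subseteq> kcar A" "set vs \<subseteq> kcar A" "u \<in> kcar A" "v \<in> kcar A"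
  shows "f (us @ kadd A u v # vs) = kadd A (f (us @ u # vs)) (f (us @ v # vs))"
    and "f (us @ ksm A c u # vs) = ksm A c (f (us @ u # vs))"
  using assms unfolding is_cochain_def by blast+

locale kalg_iso = alg mul one sm
  for mul :: "'a::ab_group_add \<Rightarrow> 'a \<Rightarrow> 'a" (infixl "\<odot>" 70) and one :: 'a
    and sm :: "'k::field \<Rightarrow> 'a \<Rightarrow> 'a" +
  fixes A :: "('b, 'k) kalg" and \<Psi> :: "'a \<Rightarrow> 'b"
  assumes inj: "inj \<Psi>" and car: "kcar A = range \<Psi>"
    and P_add: "kadd A (\<Psi> s) (\<Psi> t) = \<Psi> (s + t)"
    and P_mul: "kmul A (\<Psi> s) (\<Psi> t) = \<Psi> (s \<odot> t)"
    and P_0: "kzero A = \<Psi> 0"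
    and P_sm: "ksm A c (\<Psi> t) = \<Psi> (sm c t)"
begin

text \<open>The value off the carrier is the transported zero, as \<open>is_cochain\<close> demands,
  so a transported cochain is determined on lists \<open>map \<Psi> ys\<close>.\<close>

definition Up :: "('a list \<Rightarrow> 'a) \<Rightarrow> 'b list \<Rightarrow> 'b" where
  "Up f xs = (if set xs \<subseteq> range \<Psi> then \<Psi> (f (map (inv \<Psi>) xs)) else \<Psi> 0)"

lemma inv_P [simp]: "inv \<Psi> (\<Psi> t) = t" using inj by simp

lemma P_inj [simp]: "\<Psi> s = \<Psi> t \<longleftrightarrow> s = t" using inj by (simp add: inj_eq)

lemma set_range: "set xs \<subseteq> range \<Psi> \<longleftrightarrow> (\<exists>ys. xs = map \<Psi> ys)"
proof
  assume "set xs \<subseteq> range \<Psi>"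
  then have "map \<Psi> (map (inv \<Psi>) xs) = xs" by (auto simp: f_inv_into_f intro!: map_idI)
  then show "\<exists>ys. xs = map \<Psi> ys" by metis
qed auto

lemma Up_map [simp]: "Up f (map \<Psi> ys) = \<Psi> (f ys)"
  by (auto simp: Up_def comp_def)

lemma Up_off: "\<not> set xs \<subseteq> range \<Psi> \<Longrightarrow> Up f xs = \<Psi> 0" by (simp add: Up_def)

lemma Up_eqI:
  assumes "\<And>ys. F (map \<Psi> ys) = \<Psi> (f ys)" "\<And>xs. \<not> set xs \<subseteq> range \<Psi> \<Longrightarrow> F xs = \<Psi> 0"
  shows "F = Up f"
proof
  fix xs show "F xs = Up f xs"
    using assms by (cases "set xs \<subseteq> range \<Psi>") (auto simp: set_range Up_off)
qed

lemma Up_inj: "Up f = Up g \<longleftrightarrow> f = g"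
proof
  assume e: "Up f = Up g"
  have "Up f (map \<Psi> ys) = Up g (map \<Psi> ys)" for ys by (simp only: e)
  then show "f = g" by (simp add: fun_eq_iff)
qed simp

lemma Up_zero: "Up 0 = (\<lambda>_. kzero A)" by (rule Up_eqI[symmetric]) (simp_all add: P_0)

lemma is_cochain_Up: "is_cochain A n (Up f) \<longleftrightarrow> mlin n f"
proof
  assume c: "is_cochain A n (Up f)"
  show "mlin n f"
  proof (rule mlinI)
    fix ys :: "'a list" assume "length ys \<noteq> n"
    then have "Up f (map \<Psi> ys) = kzero A" by (intro cochain_off[OF c]) simp
    then show "f ys = 0" by (simp add: P_0)
  next
    fix us vs
    show "lin (\<lambda>u. f (us @ u # vs))"
    proof (cases "length us + length vs + 1 = n")
      case True
      have r: "set (map \<Psi> us) \<subseteq> kcar A" "set (map \<Psi> vs) \<subseteq> kcar A" "\<Psi> u \<in> kcar A" for u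
        by (auto simp: car)
      have e: "Up f (map \<Psi> us @ \<Psi> w # map \<Psi> vs) = \<Psi> (f (us @ w # vs))" for w
        using Up_map[of f "us @ w # vs"] by (simp del: Up_map)
      have l: "length (map \<Psi> us) + length (map \<Psi> vs) + 1 = n" using True by simp
      show ?thesis
      proof (rule linI)
        show "f (us @ (u + v) # vs) = f (us @ u # vs) + f (us @ v # vs)" for u v
          using cochain_add_sm(1)[OF c l r(1,2) r(3)[of u] r(3)[of v]] by (simp add: P_add e)
        show "f (us @ sm k u # vs) = sm k (f (us @ u # vs))" for k u
          using cochain_add_sm(2)[OF c l r(1,2) r(3)[of u] r(3)[of u]] by (simp add: P_sm e)
      qed
    next
      case False
      have "f (us @ u # vs) = 0" for u
      proof -
        have "length (map \<Psi> (us @ u # vs)) \<noteq> n" using False by simp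
        then have "Up f (map \<Psi> (us @ u # vs)) = kzero A" by (intro cochain_off[OF c]) simp
        then show ?thesis by (simp only: P_0 Up_map P_inj)
      qed
      then show ?thesis by simp
    qed
  qed
next
  assume m: "mlin n f"
  have e: "Up f (map \<Psi> us @ \<Psi> w # map \<Psi> vs) = \<Psi> (f (us @ w # vs))" for us w vs
    using Up_map[of f "us @ w # vs"] by (simp del: Up_map)
  show "is_cochain A n (Up f)" unfolding is_cochain_def car
  proof (intro conjI allI impI)
    fix xs assume "length xs = n \<and> set xs \<subseteq> range \<Psi>"
    then show "Up f xs \<in> range \<Psi>" by (simp add: Up_def)
  next
    fix xs assume "\<not> (length xs = n \<and> set xs \<subseteq> range \<Psi>)"
    then show "Up f xs = kzero A" using mlin_off[OF m] by (auto simp: Up_def P_0)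
  next
    fix us vs u v and r :: 'k
    assume "length us + length vs + 1 = n \<and> set us \<subseteq> range \<Psi> \<and> set vs \<subseteq> range \<Psi> \<and> u \<in> range \<Psi> \<and> v \<in> range \<Psi>"
    then obtain us' vs' u' v' where "us = map \<Psi> us'" "vs = map \<Psi> vs'" "u = \<Psi> u'" "v = \<Psi> v'"
      unfolding set_range by blast
    then show "Up f (us @ kadd A u v # vs) = kadd A (Up f (us @ u # vs)) (Up f (us @ v # vs))"
      "Up f (us @ ksm A r u # vs) = ksm A r (Up f (us @ u # vs))"
      by (simp_all add: P_add P_sm e lin_add[OF mlin_lin[OF m]] lin_sm[OF mlin_lin[OF m]])
  qed
qed

lemma is_cochain_Up_ex:
  assumes "is_cochain A n F" shows "\<exists>f. F = Up f"
proof
  show "F = Up (\<lambda>ys. inv \<Psi> (F (map \<Psi> ys)))"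
  proof (rule Up_eqI)
    fix ys
    have "F (map \<Psi> ys) \<in> range \<Psi>"
    proof (cases "length ys = n")
      case True
      have "F (map \<Psi> ys) \<in> kcar A" by (rule cochain_in[OF assms]) (auto simp: True car)
      then show ?thesis by (simp add: car)
    next
      case False
      then have "F (map \<Psi> ys) = kzero A" by (intro cochain_off[OF assms]) simp
      then show ?thesis by (simp add: P_0)
    qed
    then show "F (map \<Psi> ys) = \<Psi> (inv \<Psi> (F (map \<Psi> ys)))" by (simp add: f_inv_into_f)
  next
    fix xs assume "\<not> set xs \<subseteq> range \<Psi>"
    then have "F xs = kzero A" by (intro cochain_off[OF assms]) (simp add: car)
    then show "F xs = \<Psi> 0" by (simp add: P_0)
  qed
qed

lemma ksum_map: "ksum A (map \<Psi> ts) = \<Psi> (sum_list ts)"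
  by (induction ts) (simp_all add: ksum_def P_0 P_add)

lemma hdiff_Up:
  assumes m: "mlin n f"
  shows "hdiff A n (Up f) = Up (hoch f)"
proof (rule Up_eqI)
  fix xs assume "\<not> set xs \<subseteq> range \<Psi>"
  then show "hdiff A n (Up f) xs = \<Psi> 0" by (simp add: hdiff_def car P_0)
next
  fix ys
  show "hdiff A n (Up f) (map \<Psi> ys) = \<Psi> (hoch f ys)"
  proof (cases "length ys = Suc n")
    case True
    then obtain y zs where ys: "ys = y # zs" by (cases ys) auto
    let ?F = "\<lambda>j. Up f (take j (map \<Psi> ys) @ kmul A (map \<Psi> ys ! j) (map \<Psi> ys ! (j + 1)) # drop (j + 2) (map \<Psi> ys))"
    let ?f = "\<lambda>j. f (take j ys @ (ys ! j) \<odot> (ys ! (j + 1)) # drop (j + 2) ys)"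
    let ?l = "[y \<odot> f zs] @ map (\<lambda>j. sm ((-1) ^ (j + 1))
     (?f j)) [0..<n] @
     [sm ((-1) ^ (n + 1)) (f (take n ys) \<odot> (ys ! n))]"
    have s: "set (map \<Psi> ys) \<subseteq> kcar A" by (auto simp: car)
    have 1: "kmul A (hd (map \<Psi> ys)) (Up f (tl (map \<Psi> ys))) = \<Psi> (y \<odot> f zs)"
      by (simp add: ys P_mul)
    have 2: "ksm A ((-1) ^ (j + 1)) (?F j)
        = \<Psi> (sm ((-1) ^ (j + 1)) (?f j))" if "j < n" for j
    proof -
      have "take j (map \<Psi> ys) @ kmul A (map \<Psi> ys ! j) (map \<Psi> ys ! (j + 1)) # drop (j + 2) (map \<Psi> ys)
        = map \<Psi> (take j ys @ (ys ! j) \<odot> (ys ! (j + 1)) # drop (j + 2) ys)"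
        using that True by (simp add: take_map drop_map P_mul)
      then show ?thesis by (simp only: Up_map P_sm)
    qed
    have 3: "ksm A ((-1) ^ (n + 1)) (kmul A (Up f (take n (map \<Psi> ys))) (map \<Psi> ys ! n))
        = \<Psi> (sm ((-1) ^ (n + 1)) (f (take n ys) \<odot> (ys ! n)))"
      using True by (simp add: take_map P_mul P_sm del: power_Suc)
    have m2: "map (\<lambda>j. ksm A ((-1) ^ (j + 1)) (?F j)) [0..<n]
       = map (\<lambda>j. \<Psi> (sm ((-1) ^ (j + 1)) (?f j))) [0..<n]"
      by (rule map_cong[OF refl], rule 2) simp
    have "hdiff A n (Up f) (map \<Psi> ys) = ksum A (map \<Psi> ?l)"
      unfolding hdiff_def using s True unfolding 1 m2 3 by (simp add: comp_def del: power_Suc)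
    also have "\<dots> = \<Psi> (y \<odot> f zs + - bar f ys)"
      unfolding ksum_map bar_sum_list[OF True] by simp
    finally show ?thesis by (simp add: hoch_def ys)
  next
    case False
    then have "hdiff A n (Up f) (map \<Psi> ys) = \<Psi> 0" by (simp add: hdiff_def P_0)
    then show ?thesis using mlin_off[OF mlin_hoch[OF m] False] by simp
  qed
qed

abbreviation "CZ \<equiv> cyc (\<lambda>p. Collect (mlin p)) (\<lambda>p. hoch)"
abbreviation "CB \<equiv> cob (\<lambda>p. Collect (mlin p)) (\<lambda>p. hoch)"

lemma hcocycles_Up: "hcocycles A n = Up ` CZ n"
proof -
  have "Up f \<in> hcocycles A n \<longleftrightarrow> f \<in> CZ n" for f
    unfolding hcocycles_def cyc_def using hdiff_Up[of n f] Up_zero Up_inj[of "hoch f" 0]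
    by (auto simp: is_cochain_Up)
  moreover have "F \<in> hcocycles A n \<Longrightarrow> \<exists>f. F = Up f" for F
    using is_cochain_Up_ex by (auto simp: hcocycles_def)
  ultimately show ?thesis by blast
qed

lemma hcoboundaries_Up: "hcoboundaries A n = Up ` CB n"
proof (cases n)
  case 0 then show ?thesis by (simp add: hcoboundaries_def cob_def Up_zero)
next
  case (Suc m)
  have "hdiff A m ` {g. is_cochain A m g} = Up ` hoch ` Collect (mlin m)"
  proof (intro equalityI subsetI)
    fix F assume "F \<in> hdiff A m ` {g. is_cochain A m g}"
    then obtain G where G: "is_cochain A m G" "F = hdiff A m G" by blast
    obtain g where g: "G = Up g" using is_cochain_Up_ex[OF G(1)] by blast
    then show "F \<in> Up ` hoch ` Collect (mlin m)" using G by (auto simp: is_cochain_Up hdiff_Up)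
  next
    fix F assume "F \<in> Up ` hoch ` Collect (mlin m)"
    then obtain g where g: "mlin m g" "F = Up (hoch g)" by blast
    then have "F = hdiff A m (Up g)" "is_cochain A m (Up g)" by (simp_all add: is_cochain_Up hdiff_Up)
    then show "F \<in> hdiff A m ` {g. is_cochain A m g}" by blast
  qed
  then show ?thesis by (simp add: hcoboundaries_def cob_def Suc)
qed

lemma fnadd_Up: "fnadd A (Up f) (Up g) = Up (f + g)"
  by (rule Up_eqI) (simp_all add: fnadd_def P_add Up_off)

lemma fnsm_Up: "fnsm A c (Up f) = Up (\<lambda>xs. sm c (f xs))"
  by (rule Up_eqI) (simp_all add: fnsm_def P_sm Up_off)

lemma lincomb_Up: "length cs = length fs \<Longrightarrow>
  lincomb A cs (map Up fs) = Up (\<Sum>i<length fs. (\<lambda>xs. sm (cs ! i) ((fs ! i) xs)))"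
proof (induction cs fs rule: list_induct2)
  case Nil then show ?case by (simp add: lincomb_def Up_zero[symmetric] zero_fun_def)
next
  case (Cons c cs f fs)
  have "lincomb A (c # cs) (map Up (f # fs)) = fnadd A (fnsm A c (Up f)) (lincomb A cs (map Up fs))"
    by (simp add: lincomb_def)
  also have "\<dots> = Up ((\<lambda>xs. sm c (f xs)) + (\<Sum>i<length fs. (\<lambda>xs. sm (cs ! i) ((fs ! i) xs))))"
    by (simp only: Cons.IH fnsm_Up fnadd_Up)
  finally show ?case by (simp only: list.size add_0_right add_Suc_right Nat.add_0_right length_Cons sum.lessThan_Suc_shift nth_Cons_0 nth_Cons_Suc)
qed

theorem hh_dim_if_qdim:
  assumes "qdim (\<lambda>c f xs. sm c (f xs)) (CZ n) (CB n) m"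
  shows "hh_dim A n m"
proof -
  obtain b where *: "(\<forall>i<m. b i \<in> CZ n) \<and>
      (\<forall>c. (\<Sum>i<m. (\<lambda>xs. sm (c i) (b i xs))) \<in> CB n \<longrightarrow> (\<forall>i<m. c i = 0)) \<and>
      (\<forall>z\<in>CZ n. \<exists>c. z - (\<Sum>i<m. (\<lambda>xs. sm (c i) (b i xs))) \<in> CB n)"
    using assms unfolding qdim_def by (rule exE)
  let ?S = "\<lambda>c. \<Sum>i<m. (\<lambda>xs. sm (c i) (b i xs))"
  have b: "\<forall>i<m. b i \<in> CZ n" using * by (rule conjunct1)
  note ind = *[THEN conjunct2, THEN conjunct1, rule_format]
  note span = *[THEN conjunct2, THEN conjunct2, rule_format]
  define fs where "fs = map b [0..<m]"
  have len: "length fs = m" by (simp add: fs_def)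
  have lc: "lincomb A cs (map Up fs) = Up (?S (\<lambda>i. cs ! i))" if "length cs = m" for cs
  proof -
    have "(\<Sum>i<m. (\<lambda>xs. sm (cs ! i) ((fs ! i) xs))) = ?S (\<lambda>i. cs ! i)"
      by (rule sum.cong) (simp_all add: fs_def)
    then show ?thesis using lincomb_Up[of cs fs] that by (simp only: len)
  qed
  have UB: "Up f \<in> hcoboundaries A n \<longleftrightarrow> f \<in> CB n" for f
    unfolding hcoboundaries_Up image_iff Up_inj by simp
  show ?thesis unfolding hh_dim_def
  proof (intro exI[of _ "map Up fs"] conjI allI impI ballI)
    show "length (map Up fs) = m" by (simp add: len)
    show "set (map Up fs) \<subseteq> hcocycles A n" using b by (auto simp: fs_def hcocycles_Up)
  next
    fix cs c assume cs: "length cs = m \<and> lincomb A cs (map Up fs) \<in> hcoboundaries A n" and c: "c \<in> set cs"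
    have "?S (\<lambda>i. cs ! i) \<in> CB n" using conjunct2[OF cs] unfolding lc[OF conjunct1[OF cs]] UB .
    then have "\<forall>i<m. cs ! i = 0" using ind[of "\<lambda>i. cs ! i"] by blast
    then show "c = 0" using c cs by (auto simp: in_set_conv_nth)
  next
    fix F assume "F \<in> hcocycles A n"
    then obtain f where f: "F = Up f" "f \<in> CZ n" unfolding hcocycles_Up by (rule imageE)
    obtain c where c: "f - ?S c \<in> CB n" using span[OF f(2)] by blast
    let ?cs = "map c [0..<m]"
    have "?S (\<lambda>i. ?cs ! i) = ?S c"
      by (rule sum.cong) simp_all
    then have l: "lincomb A ?cs (map Up fs) = Up (?S c)"
      using lc[of ?cs] by (simp only: length_map length_upt diff_zero)
    show "\<exists>cs b. length cs = m \<and> b \<in> hcoboundaries A n \<and> F = fnadd A (lincomb A cs (map Up fs)) b"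
    proof (intro exI conjI)
      show "length ?cs = m" by simp
      show "Up (f - ?S c) \<in> hcoboundaries A n" using c UB by blast
      show "F = fnadd A (lincomb A ?cs (map Up fs)) (Up (f - ?S c))"
        unfolding l fnadd_Up f(1) by simp
    qed
  qed
qed

end

section \<open>The free algebra with its basis of words\<close>

definition fw :: "gen list \<Rightarrow> 'k::{zero,one} fa" where "fw w = (\<lambda>v. if v = w then 1 else 0)"

lemma fadd_eq: "fadd f g = f + g" for f g :: "'k::ab_group_add fa" by (simp add: fadd_def fun_eq_iff)
lemma fsub_eq: "fsub f g = f - g" for f g :: "'k::ab_group_add fa" by (simp add: fsub_def fun_eq_iff)
lemma fzero_eq: "fzero = (0 :: 'k::ab_group_add fa)" by (simp add: fzero_def fun_eq_iff)
lemma fgen_eq: "fgen g = fw [g]" by (simp add: fgen_def fw_def)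

lemma Fset_zero [simp]: "0 \<in> Fset" by (simp add: Fset_def)
lemma Fset_fw [simp]: "fw w \<in> Fset" by (simp add: Fset_def fw_def)
lemma Fset_add: "f \<in> Fset \<Longrightarrow> g \<in> Fset \<Longrightarrow> f + g \<in> Fset" for f g :: "'k::ab_group_add fa"
  unfolding Fset_def by (auto intro: finite_subset[of _ "{w. f w \<noteq> 0} \<union> {w. g w \<noteq> 0}"])
lemma Fset_diff: "f \<in> Fset \<Longrightarrow> g \<in> Fset \<Longrightarrow> f - g \<in> Fset" for f g :: "'k::ab_group_add fa"
  unfolding Fset_def by (auto intro: finite_subset[of _ "{w. f w \<noteq> 0} \<union> {w. g w \<noteq> 0}"])
lemma Fset_fsm: "f \<in> Fset \<Longrightarrow> fsm c f \<in> Fset" for f :: "'k::comm_ring_1 fa"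
  unfolding Fset_def fsm_def by (auto intro: finite_subset[of _ "{w. f w \<noteq> 0}"])

lemma Fset_fmul:
  fixes f g :: "'k::comm_ring_1 fa"
  assumes "f \<in> Fset" "g \<in> Fset" shows "fmul f g \<in> Fset"
proof -
  have "{w. fmul f g w \<noteq> 0} \<subseteq> (\<lambda>(u, v). u @ v) ` ({w. f w \<noteq> 0} \<times> {w. g w \<noteq> 0})"
  proof
    fix w assume "w \<in> {w. fmul f g w \<noteq> 0}"
    then have "(\<Sum>i\<le>length w. f (take i w) * g (drop i w)) \<noteq> 0" by (simp add: fmul_def)
    then obtain i where "f (take i w) * g (drop i w) \<noteq> 0" by (rule sum.not_neutral_contains_not_neutral)
    then have "(take i w, drop i w) \<in> {w. f w \<noteq> 0} \<times> {w. g w \<noteq> 0}" by auto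
    then show "w \<in> (\<lambda>(u, v). u @ v) ` ({w. f w \<noteq> 0} \<times> {w. g w \<noteq> 0})"
      by (rule rev_image_eqI) simp
  qed
  moreover have "finite ((\<lambda>(u, v). u @ v) ` ({w. f w \<noteq> 0} \<times> {w. g w \<noteq> 0}))"
    using assms by (simp add: Fset_def)
  ultimately show ?thesis unfolding Fset_def using finite_subset by blast
qed

lemma fmul_add_left: "fmul (f + g) h = fmul f h + fmul g h" for f g :: "'k::comm_ring_1 fa"
  by (simp add: fmul_def fun_eq_iff distrib_right sum.distrib)
lemma fmul_add_right: "fmul h (f + g) = fmul h f + fmul h g" for f g :: "'k::comm_ring_1 fa"
  by (simp add: fmul_def fun_eq_iff distrib_left sum.distrib)
lemma fmul_diff_left: "fmul (f - g) h = fmul f h - fmul g h" for f g :: "'k::comm_ring_1 fa"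
  by (rule additive_diff[of "\<lambda>f. fmul f h"]) (rule fmul_add_left)
lemma fmul_diff_right: "fmul h (f - g) = fmul h f - fmul h g" for f g :: "'k::comm_ring_1 fa"
  by (rule additive_diff[of "fmul h"]) (rule fmul_add_right)
lemma fmul_zero_left [simp]: "fmul 0 h = 0" for h :: "'k::comm_ring_1 fa"
  by (simp add: fmul_def fun_eq_iff)
lemma fmul_zero_right [simp]: "fmul h 0 = 0" for h :: "'k::comm_ring_1 fa"
  by (simp add: fmul_def fun_eq_iff)
lemma fmul_fsm_left: "fmul (fsm c f) h = fsm c (fmul f h)" for f :: "'k::comm_ring_1 fa"
  by (simp add: fmul_def fsm_def fun_eq_iff sum_distrib_left mult.assoc)
lemma fmul_fsm_right: "fmul h (fsm c f) = fsm c (fmul h f)" for f :: "'k::comm_ring_1 fa"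
  by (simp add: fmul_def fsm_def fun_eq_iff sum_distrib_left mult.left_commute)
lemma fsm_add: "fsm c (f + g) = fsm c f + fsm c g" for f g :: "'k::comm_ring_1 fa"
  by (simp add: fsm_def fun_eq_iff distrib_left)
lemma fsm_zero [simp]: "fsm c 0 = 0" for c :: "'k::comm_ring_1" by (simp add: fsm_def fun_eq_iff)

lemma fmul_fw: "fmul (fw u) (fw v) = (fw (u @ v) :: 'k::comm_ring_1 fa)"
proof
  fix w
  have "fmul (fw u) (fw v) w = (\<Sum>i\<le>length w. if take i w = u \<and> drop i w = v then 1 else (0::'k))"
    unfolding fmul_def fw_def by (rule sum.cong) auto
  also have "\<dots> = (if w = u @ v then 1 else 0)"
  proof (cases "w = u @ v")
    case True
    have "take i w = u \<and> drop i w = v \<longleftrightarrow> i = length u" if "i \<le> length w" for i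
    proof
      assume "take i w = u \<and> drop i w = v"
      then have "length (take i w) = length u" by simp
      then show "i = length u" using that by simp
    qed (simp add: True)
    then have "(\<Sum>i\<le>length w. if take i w = u \<and> drop i w = v then 1 else (0::'k)) = (\<Sum>i\<le>length w. if i = length u then 1 else 0)"
      by (intro sum.cong) auto
    then show ?thesis using True by simp
  next
    case False
    have "\<not> (take i w = u \<and> drop i w = v)" for i using False append_take_drop_id[of i w] by metis
    then have "(\<Sum>i\<le>length w. if take i w = u \<and> drop i w = v then 1 else (0::'k)) = 0"
      by (intro sum.neutral) auto
    then show ?thesis using False by simp
  qed
  finally show "fmul (fw u) (fw v) w = (fw (u @ v) :: 'k fa) w" by (simp add: fw_def)
qed

lemma fmul_fw_single: "fmul (fw [g]) f w = (case w of [] \<Rightarrow> 0 | x # w' \<Rightarrow> if x = g then f w' else 0)"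
  for f :: "'k::comm_ring_1 fa"
proof (cases w)
  case Nil then show ?thesis by (simp add: fmul_def fw_def)
next
  case (Cons x w')
  have "fmul (fw [g]) f w = (\<Sum>i\<le>length w. if i = 1 then (if x = g then f w' else 0) else 0)"
    unfolding fmul_def
  proof (rule sum.cong)
    fix i assume "i \<in> {..length w}"
    show "fw [g] (take i w) * f (drop i w) = (if i = 1 then if x = g then f w' else 0 else 0)"
    proof (cases i)
      case (Suc j)
      then show ?thesis using Cons \<open>i \<in> _\<close> by (cases j) (auto simp: fw_def Suc_le_eq)
    qed (simp add: fw_def)
  qed simp
  also have "\<dots> = (if x = g then f w' else 0)" by (simp add: Cons Suc_le_eq)
  finally show ?thesis by (simp add: Cons)
qed

text \<open>Adding one monomial at a time reduces multilinear identities, such as associativity of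
  \<open>fmul\<close>, to words.\<close>

lemma Fset_induct [consumes 1, case_names zero add]:
  fixes f :: "'k::comm_ring_1 fa"
  assumes f: "f \<in> Fset" and z: "P 0"
    and a: "\<And>f c w. f \<in> Fset \<Longrightarrow> P f \<Longrightarrow> P (f + fsm c (fw w))"
  shows "P f"
proof -
  have "P f" if "finite S" "{w. f w \<noteq> 0} \<subseteq> S" for S
    using that f
  proof (induction S arbitrary: f rule: finite_induct)
    case empty
    then have "f = 0" by (auto simp: fun_eq_iff)
    then show ?case using z by (simp add: zero_fun_def)
  next
    case (insert w S)
    define g where "g = f - fsm (f w) (fw w)"
    have gF: "g \<in> Fset" unfolding g_def using insert.prems by (intro Fset_diff Fset_fsm Fset_fw)
    have "g w = 0" by (simp add: g_def fsm_def fw_def)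
    moreover have "g v = f v" if "v \<noteq> w" for v using that by (simp add: g_def fsm_def fw_def)
    ultimately have "{v. g v \<noteq> 0} \<subseteq> S" using insert.prems by auto (metis (mono_tags) insertE mem_Collect_eq subsetD)
    then have "P (g + fsm (f w) (fw w))" using insert.IH gF by (intro a)
    then show ?case by (simp add: g_def)
  qed
  then show ?thesis using f by (auto simp: Fset_def)
qed

lemma fmul_fw_fw:
  fixes h :: "'k::comm_ring_1 fa"
  assumes "h \<in> Fset" shows "fmul (fw (u @ v)) h = fmul (fw u) (fmul (fw v) h)"
  by (rule Fset_induct[where P = "\<lambda>h. fmul (fw (u @ v)) h = fmul (fw u) (fmul (fw v) h)", OF assms])
    (simp_all add: fmul_add_right fmul_fsm_right fmul_fw)

lemma fmul_fw_assoc: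
  fixes g h :: "'k::comm_ring_1 fa"
  assumes "g \<in> Fset" "h \<in> Fset" shows "fmul (fmul (fw u) g) h = fmul (fw u) (fmul g h)"
  by (rule Fset_induct[where P = "\<lambda>g. fmul (fmul (fw u) g) h = fmul (fw u) (fmul g h)", OF assms(1)])
    (simp_all add: fmul_add_left fmul_add_right fmul_fsm_left fmul_fsm_right fmul_fw fmul_fw_fw assms(2))

lemma fmul_assoc:
  fixes f g h :: "'k::comm_ring_1 fa"
  assumes "f \<in> Fset" "g \<in> Fset" "h \<in> Fset"
  shows "fmul (fmul f g) h = fmul f (fmul g h)"
  by (rule Fset_induct[where P = "\<lambda>f. fmul (fmul f g) h = fmul f (fmul g h)", OF assms(1)])
    (simp_all add: fmul_add_left fmul_fsm_left fmul_fw_assoc assms(2,3))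

lemma fpoly_0 [simp]: "fpoly 0 = (0 :: 'k::comm_ring_1 fa)" by (simp add: fpoly_def fun_eq_iff)

lemma fpoly_pCons: "fpoly (pCons c p) = fsm c (fw []) + fmul (fw [Gh]) (fpoly p)" for c :: "'k::comm_ring_1"
proof
  fix w :: "gen list"
  show "fpoly (pCons c p) w = (fsm c (fw []) + fmul (fw [Gh]) (fpoly p)) w"
    by (cases w) (auto simp: fmul_fw_single fpoly_def fsm_def fw_def[of "[]"])
qed

lemma fpoly_pCons_0: "fpoly (pCons 0 p) = fmul (fw [Gh]) (fpoly p :: 'k::comm_ring_1 fa)"
proof -
  have "fsm 0 (fw []) = (0 :: 'k fa)" by (simp add: fsm_def fun_eq_iff)
  then show ?thesis unfolding fpoly_pCons by (simp only: add_0_left)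
qed

lemma fpoly_add: "fpoly (p + q) = fpoly p + (fpoly q :: 'k::comm_ring_1 fa)"
  by (simp add: fpoly_def fun_eq_iff)

lemma fpoly_smult: "fpoly (smult c p) = fsm c (fpoly p :: 'k::comm_ring_1 fa)"
  by (simp add: fpoly_def fsm_def fun_eq_iff)

lemma Fset_fpoly [simp]: "fpoly (p :: 'k::comm_ring_1 poly) \<in> Fset"
proof (induction p)
  case (pCons c p)
  then show ?case unfolding fpoly_pCons by (intro Fset_add Fset_fsm Fset_fmul Fset_fw)
qed (simp only: fpoly_0 Fset_zero)

lemma fmul_fw_Nil [simp]: "f \<in> Fset \<Longrightarrow> fmul (fw []) f = f" for f :: "'k::comm_ring_1 fa"
  by (erule Fset_induct[where P = "\<lambda>f. fmul (fw []) f = f"]) (simp_all add: fmul_add_right fmul_fsm_right fmul_fw)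

lemma fpoly_mult: "fpoly (p * q) = fmul (fpoly p) (fpoly q :: 'k::comm_ring_1 fa)"
proof (induction p)
  case (pCons c p)
  have "fpoly (pCons c p * q) = fsm c (fpoly q) + fpoly (pCons 0 (p * q))"
    by (simp only: mult_pCons_left fpoly_add fpoly_smult)
  also have "\<dots> = fsm c (fmul (fw []) (fpoly q)) + fmul (fmul (fw [Gh]) (fpoly p)) (fpoly q)"
    by (simp only: fpoly_pCons_0 pCons.IH fmul_fw_Nil fmul_assoc Fset_fpoly Fset_fw)
  finally show ?case by (simp only: fpoly_pCons fmul_add_left fmul_fsm_left)
qed (simp only: mult_zero_left fpoly_0 fmul_zero_left)

lemma fideal_fsm: 
  fixes S :: "'k::comm_ring_1 fa set"
  assumes "f \<in> fideal S" "f \<in> Fset" shows "fsm c f \<in> fideal S"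
proof -
  have "fmul (fsm c (fw [])) f \<in> fideal S" using assms by (intro fideal.lmul Fset_fsm) auto
  then show ?thesis using assms by (simp add: fmul_fsm_left)
qed

lemma fideal_Fset:
  fixes S :: "'k::comm_ring_1 fa set"
  assumes "S \<subseteq> Fset" "f \<in> fideal S" shows "f \<in> Fset"
  using assms(2,1) by (induction rule: fideal.induct) (auto simp: fzero_eq fadd_eq Fset_add Fset_fmul)

context gw
begin

section \<open>Normal forms in the presented algebra\<close>

definition gop :: "gen \<Rightarrow> ('k gwt) \<Rightarrow> 'k gwt" where
  "gop g = (case g of Gh \<Rightarrow> pop [:0, 1:] | Gx \<Rightarrow> Xo True | Gy \<Rightarrow> Xo False)"

definition wel :: "gen list \<Rightarrow> 'k gwt" where "wel w = foldr gop w (sng 0 1)"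

text \<open>Evaluation of noncommutative polynomials in the model, where a word acts on the unit by
  left multiplications. Its kernel turns out to be the ideal of relations.\<close>

definition phi :: "'k fa \<Rightarrow> 'k gwt" where
  "phi f = (\<Sum>w | f w \<noteq> 0. pop [:f w:] (wel w))"

lemma gop_tmul: "gop g t \<odot> s = gop g (t \<odot> s)"
  by (cases g) (simp_all add: gop_def tmul_pop tmul_Xo)

lemma wel_append: "wel (u @ v) = wel u \<odot> wel v"
  by (induction u) (simp_all add: wel_def gop_tmul)

lemma phi_superset: "finite S \<Longrightarrow> {w. f w \<noteq> 0} \<subseteq> S \<Longrightarrow> phi f = (\<Sum>w\<in>S. pop [:f w:] (wel w))"
  unfolding phi_def by (rule sum.mono_neutral_left) auto

lemma phi_add:
  assumes "f \<in> Fset" "g \<in> Fset" shows "phi (f + g) = phi f + phi g"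
proof -
  let ?S = "{w. f w \<noteq> 0} \<union> {w. g w \<noteq> 0}"
  have S: "finite ?S" using assms by (simp add: Fset_def)
  have "pop [:(f + g) w:] t = pop [:f w:] t + pop [:g w:] t" for w t
    using pop_plus[of "[:f w:]" "[:g w:]" t] by simp
  then show ?thesis using S
    by (subst (1 2 3) phi_superset[OF S]) (auto simp: sum.distrib)
qed

lemma phi_0 [simp]: "phi 0 = 0" by (simp add: phi_def)

lemma pop_sum: "pop p (\<Sum>w\<in>S. g w) = (\<Sum>w\<in>S. pop p (g w))"
  by (induction S rule: infinite_finite_induct) (simp_all add: pop_add)

lemma phi_fsm:
  assumes "f \<in> Fset" shows "phi (fsm c f) = pop [:c:] (phi f)"
proof -
  let ?S = "{w. f w \<noteq> 0}"
  have S: "finite ?S" using assms by (simp add: Fset_def)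
  have "phi (fsm c f) = (\<Sum>w\<in>?S. pop [:c:] (pop [:f w:] (wel w)))"
    by (subst phi_superset[OF S]) (auto simp: fsm_def pop_pop mult.commute)
  also have "\<dots> = pop [:c:] (phi f)" unfolding phi_def by (rule pop_sum[symmetric])
  finally show ?thesis .
qed

lemma phi_fw [simp]: "phi (fw w) = wel w"
proof -
  have "{v. fw w v \<noteq> (0::'k)} = {w}" by (auto simp: fw_def)
  then show ?thesis by (simp add: phi_def) (simp add: fw_def pCons_one)
qed

lemma phi_diff: "f \<in> Fset \<Longrightarrow> g \<in> Fset \<Longrightarrow> phi (f - g) = phi f - phi g"
  using phi_add[of "f - g" g] Fset_diff[of f g] by (simp add: algebra_simps)

lemma phi_fmul:
  assumes "f \<in> Fset" "g \<in> Fset" shows "phi (fmul f g) = phi f \<odot> phi g"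
proof -
  have g: "phi (fmul (fw u) g) = wel u \<odot> phi g" for u
    by (rule Fset_induct[where P = "\<lambda>g. phi (fmul (fw u) g) = wel u \<odot> phi g", OF assms(2)])
      (simp_all add: fmul_add_right fmul_fsm_right fmul_fw phi_add phi_fsm Fset_fmul Fset_fsm wel_append tmul_add_right tmul_sm)
  show ?thesis
    by (rule Fset_induct[where P = "\<lambda>f. phi (fmul f g) = phi f \<odot> phi g", OF assms(1)])
      (simp_all add: g assms(2) fmul_add_left fmul_fsm_left phi_add phi_fsm Fset_fmul Fset_fsm tmul_add_left tmul_pop)
qed

lemma wel_Nil: "wel [] = sng 0 1" by (simp add: wel_def)

lemma phi_fpoly [simp]: "phi (fpoly p) = sng 0 p"
proof (induction p)
  case (pCons c p)
  have "phi (fpoly (pCons c p)) = pop [:c:] (sng 0 1) + wel [Gh] \<odot> sng 0 p"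
    using pCons by (simp add: fpoly_pCons phi_add phi_fsm phi_fmul Fset_fsm Fset_fmul wel_Nil)
  also have "\<dots> = sng 0 ([:c:] + [:0, 1:] * p)"
    by (simp add: wel_def gop_def tmul_single single_add[symmetric] del: single_add)
  finally show ?case by simp
qed (simp only: fpoly_0 phi_0 single_zero)

definition gl :: "bool \<Rightarrow> gen" where "gl l = (if l then Gx else Gy)"

lemma gop_gl: "gop (gl l) = Xo l" by (simp add: gop_def gl_def)
lemma wel_gl: "wel [gl l] = sng (sg l) 1" by (simp add: wel_def gop_gl Xo_single)

abbreviation "rels \<equiv> gwa_rels a (shift_aut h0)"
abbreviation "II \<equiv> fideal rels"

lemma shift_sh: "shift_aut h0 = sh (- h0)" by (simp add: fun_eq_iff shift_aut_def sh_def)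

lemma rels_eq: "rels = {fmul (fw [gl l]) (fw [gl (\<not> l)]) - fpoly (al l) | l. True} \<union>
  {fmul (fw [Gx]) (fpoly r) - fmul (fpoly (sh (- h0) r)) (fw [Gx]) | r. True} \<union>
  {fmul (fpoly r) (fw [Gy]) - fmul (fw [Gy]) (fpoly (sh (- h0) r)) | r. True}"
proof -
  have "{fmul (fw [gl l]) (fw [gl (\<not> l)]) - fpoly (al l) | l. True} =
     {fmul (fw [Gy]) (fw [Gx]) - fpoly a, fmul (fw [Gx]) (fw [Gy]) - (fpoly (sh (- h0) a) :: 'k fa)}"
    by (auto simp: gl_def al_def)
  then show ?thesis unfolding gwa_rels_def shift_sh fsub_eq fgen_eq by simp
qed

lemma rels_Fset: "rels \<subseteq> Fset"
  unfolding rels_eq by (auto intro!: Fset_diff Fset_fmul)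

lemma rels_phi: "f \<in> rels \<Longrightarrow> phi f = 0"
proof -
  have e: "phi (fw [Gx]) = sng (sg True) 1" "phi (fw [Gy]) = sng (sg False) 1"
    using wel_gl[of True] wel_gl[of False] by (simp_all add: gl_def)
  have 1: "phi (fmul (fw [gl l]) (fw [gl (\<not> l)]) - fpoly (al l)) = 0" for l
    using G.X_X[of l] by (simp add: phi_diff Fset_fmul phi_fmul wel_gl)
  have 2: "phi (fmul (fw [Gx]) (fpoly r) - fmul (fpoly (sh (- h0) r)) (fw [Gx])) = 0" for r
    using G.X_hp[of True r] e by (simp add: phi_diff Fset_fmul phi_fmul ss_def)
  have 3: "phi (fmul (fpoly r) (fw [Gy]) - fmul (fw [Gy]) (fpoly (sh (- h0) r))) = 0" for r
    using G.X_hp[of False "sh (- h0) r"] e by (simp add: phi_diff Fset_fmul phi_fmul ss_def sh_sh)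
  show "f \<in> rels \<Longrightarrow> phi f = 0" unfolding rels_eq using 1 2 3 by blast
qed

lemma II_Fset: "f \<in> II \<Longrightarrow> f \<in> Fset" using fideal_Fset[OF rels_Fset] .

lemma II_phi: "f \<in> II \<Longrightarrow> phi f = 0"
proof (induction rule: fideal.induct)
  case (gen s) then show ?case by (rule rels_phi)
next
  case zero show ?case by (simp only: fzero_eq phi_0)
next
  case (add p q)
  then show ?case unfolding fadd_eq phi_add[OF II_Fset[OF add(1)] II_Fset[OF add(2)]] by simp
next
  case (lmul p u) then show ?case using II_Fset by (simp add: phi_fmul)
next
  case (rmul p u) then show ?case using II_Fset by (simp add: phi_fmul)
qed

lemma II_add: "f \<in> II \<Longrightarrow> g \<in> II \<Longrightarrow> f + g \<in> II" using fideal.add[of f rels g] by (simp add: fadd_eq)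
lemma II_minus: "f \<in> II \<Longrightarrow> - f \<in> II"
  using fideal_fsm[of f rels "-1"] II_Fset[of f] by (simp add: fsm_def fun_Compl_def)
lemma II_0: "0 \<in> II" using fideal.zero[of rels] by (simp add: fzero_eq)
lemma II_trans: "f - g \<in> II \<Longrightarrow> g - h \<in> II \<Longrightarrow> f - h \<in> II"
  using II_add[of "f - g" "g - h"] by simp
lemma II_lmul: "f - g \<in> II \<Longrightarrow> u \<in> Fset \<Longrightarrow> fmul u f - fmul u g \<in> II"
  using fideal.lmul[of "f - g" rels u] by (simp add: fmul_diff_right)
lemma II_rmul: "f - g \<in> II \<Longrightarrow> u \<in> Fset \<Longrightarrow> fmul f u - fmul g u \<in> II"
  using fideal.rmul[of "f - g" rels u] by (simp add: fmul_diff_left)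

lemma II_XX: "fmul (fw [gl l]) (fw [gl (\<not> l)]) - fpoly (al l) \<in> II"
  by (rule fideal.gen) (auto simp: rels_eq)

lemma II_X_poly: "fmul (fw [gl l]) (fpoly p) - fmul (fpoly (sh (- ss l) p)) (fw [gl l]) \<in> II"
proof (cases l)
  case True
  then show ?thesis by (intro fideal.gen) (auto simp: rels_eq gl_def ss_def)
next
  case False
  \<comment> \<open>The relation for y moves polynomials in the opposite direction, so it is applied
    to the translated polynomial and its sign is reversed.\<close>
  have "fmul (fpoly (sh h0 p)) (fw [Gy]) - fmul (fw [Gy]) (fpoly (sh (- h0) (sh h0 p))) \<in> II"
    by (rule fideal.gen) (auto simp: rels_eq)
  from II_minus[OF this] show ?thesis using False by (simp add: gl_def ss_def sh_sh)
qed

definition Xw :: "int \<Rightarrow> gen list" where "Xw j = replicate (nat \<bar>j\<bar>) (gl (0 \<le> j))"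

lemma Xw_sg: "Xw (sg l * int k) = replicate k (gl l)"
  by (cases k) (auto simp: Xw_def sg_def nat_add_distrib)

text \<open>Section of \<open>phi\<close>, whose values are the normal forms with the polynomial in
  front of a power of x or of y.\<close>

definition NF :: "('k gwt) \<Rightarrow> 'k fa" where
  "NF = pext (\<lambda>j p. fmul (fpoly p) (fw (Xw j)))"

lemma NF_add: "NF (s + t) = NF s + NF t"
  unfolding NF_def by (rule pext_add) (simp add: fpoly_add fmul_add_left)

lemma NF_0 [simp]: "NF 0 = 0" by (rule additive_zero) (rule NF_add)

lemma NF_single: "NF (sng j p) = fmul (fpoly p) (fw (Xw j))"
  by (simp add: NF_def)

lemma single_induct:
  assumes "P 0" "\<And>t j p. P t \<Longrightarrow> P (t + sng j p)" shows "P t"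
proof (induction t rule: update_induct)
  case const then show ?case using assms(1) by simp
next
  case (update f j p)
  have "Poly_Mapping.update j p f = f + sng j p"
    using update(1) by (intro poly_mapping_eqI) (auto simp: lookup_update lookup_add lookup_single in_keys_iff when_def)
  then show ?case using update assms by simp
qed

lemma NF_Fset [simp]: "NF t \<in> Fset"
  by (induction t rule: single_induct) (simp_all only: NF_0 Fset_zero NF_add NF_single Fset_add Fset_fmul Fset_fpoly Fset_fw)

lemma wel_Xw: "wel (Xw j) = sng j 1"
proof -
  have "foldr gop (replicate k (gl l)) t = (Xo l ^^ k) t" for k l t
    by (induction k) (simp_all add: gop_gl)
  then show ?thesis using XX_one[of j] by (simp add: wel_def Xw_def XX_def)
qed

lemma phi_NF [simp]: "phi (NF t) = t"
  by (induction t rule: single_induct)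
    (simp_all only: NF_0 phi_0 NF_add phi_add NF_single NF_Fset Fset_fmul Fset_fpoly Fset_fw phi_fmul phi_fw phi_fpoly wel_Xw tmul_single XX_0 pop_single mult_1_right)

text \<open>The rewriting step: modulo the ideal, x or y in front of a normal form passes the
  polynomial and then either lengthens the monomial or cancels with its first letter, while h is
  absorbed into the polynomial.\<close>

lemma NF_gop: "fmul (fw [g]) (NF t) - NF (gop g t) \<in> II"
proof (induction t rule: single_induct)
  case 1
  have "gop g 0 = 0" by (cases g) (simp_all add: gop_def)
  then show ?case by (simp only: NF_0 fmul_zero_right diff_self II_0)
next
  case (2 t j p)
  have ga: "gop g (s + t) = gop g s + gop g t" for s t by (cases g) (simp_all add: gop_def pop_add Xo_add)
  have X: "fmul (fw [gl l]) (NF (sng j p)) - NF (Xo l (sng j p)) \<in> II" for l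
  proof -
    let ?W = "fw (Xw j) :: 'k fa" and ?q = "sh (- ss l) p"
    have "fmul (fmul (fw [gl l]) (fpoly p)) ?W - fmul (fmul (fpoly ?q) (fw [gl l])) ?W \<in> II"
      by (rule II_rmul[OF II_X_poly]) simp
    then have s1: "fmul (fw [gl l]) (NF (sng j p)) - fmul (fpoly ?q) (fw (gl l # Xw j)) \<in> II"
      by (simp add: NF_single fmul_assoc fmul_fw)
    show ?thesis
    proof (cases j rule: sg_cases[of _ l])
      case (1 k)
      have "j + sg l = sg l * int (Suc k)" by (simp add: 1 algebra_simps)
      then have "Xw (j + sg l) = gl l # Xw j" by (simp only: 1 Xw_sg replicate_Suc)
      moreover have "0 \<le> sg l * j" by (simp add: 1 sg_def)
      ultimately show ?thesis using s1 by (simp add: Xo_single NF_single)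
    next
      case (2 k)
      have "j + sg l = sg (\<not> l) * int k" by (simp add: 2 algebra_simps)
      then have w: "Xw j = gl (\<not> l) # Xw (j + sg l)" by (simp only: 2 Xw_sg replicate_Suc)
      let ?V = "fw (Xw (j + sg l)) :: 'k fa"
      have "fmul (fmul (fw [gl l]) (fw [gl (\<not> l)])) ?V - fmul (fpoly (al l)) ?V \<in> II"
        by (rule II_rmul[OF II_XX]) simp
      then have "fw (gl l # Xw j) - fmul (fpoly (al l)) ?V \<in> II" by (simp add: fmul_fw w)
      then have "fmul (fpoly ?q) (fw (gl l # Xw j)) - fmul (fpoly ?q) (fmul (fpoly (al l)) ?V) \<in> II"
        by (rule II_lmul) simp
      moreover have "\<not> 0 \<le> sg l * j" by (simp add: 2 sg_def)
      then have "NF (Xo l (sng j p)) = fmul (fpoly ?q) (fmul (fpoly (al l)) ?V)"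
        by (simp add: Xo_single NF_single fpoly_mult fmul_assoc)
      ultimately show ?thesis using s1 II_trans by simp
    qed
  qed
  have "fmul (fw [g]) (NF (sng j p)) - NF (gop g (sng j p)) \<in> II"
  proof (cases g)
    case Gh
    have "fmul (fw [Gh]) (NF (sng j p)) = NF (sng j (pCons 0 p))"
      by (simp only: NF_single fpoly_pCons_0 fmul_assoc Fset_fpoly Fset_fw)
    then have "fmul (fw [g]) (NF (sng j p)) - NF (gop g (sng j p)) = 0" using Gh by (simp add: gop_def)
    then show ?thesis by (simp only: II_0)
  next
    case Gx then show ?thesis using X[of True] by (simp add: gl_def gop_def)
  next
    case Gy then show ?thesis using X[of False] by (simp add: gl_def gop_def)
  qed
  from II_add[OF 2 this] show ?case by (simp only: NF_add fmul_add_right ga add_diff_add)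
qed

lemma NF_wel: "fw w - NF (wel w) \<in> II"
proof (induction w)
  case Nil
  have "NF (sng 0 1) = fw []" using fpoly_pCons[of 1 "0::'k poly"]
    by (simp add: NF_single Xw_def one_pCons) (simp add: fsm_def)
  then show ?case by (simp only: wel_Nil diff_self II_0)
next
  case (Cons g w)
  have "fmul (fw [g]) (fw w) - fmul (fw [g]) (NF (wel w)) \<in> II" by (rule II_lmul[OF Cons]) simp
  from II_trans[OF this NF_gop] show ?case by (simp add: fmul_fw wel_def fun_diff_def)
qed

lemma NF_sm_single: "NF (pop [:c:] (sng j p)) = fsm c (NF (sng j p))"
proof -
  have "pop [:c:] (sng j p) = sng j (smult c p)" by simp
  then show ?thesis by (simp only: NF_single fpoly_smult fmul_fsm_left)
qed

lemma NF_sm: "NF (pop [:c:] t) = fsm c (NF t)"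
  by (induction t rule: single_induct)
    (simp_all only: pop_0 NF_0 fsm_zero pop_add NF_add NF_sm_single fsm_add)

lemma NF_phi: "f \<in> Fset \<Longrightarrow> f - NF (phi f) \<in> II"
proof (erule Fset_induct[where P = "\<lambda>f. f - NF (phi f) \<in> II"])
  show "0 - NF (phi 0) \<in> II" by (simp add: II_0)
next
  fix f c w assume f: "f \<in> Fset" and IH: "f - NF (phi f) \<in> II"
  have "fsm c (fw w - NF (wel w)) \<in> II" using NF_wel by (intro fideal_fsm) (auto intro: Fset_diff)
  then have "fsm c (fw w) - fsm c (NF (wel w)) \<in> II"
    by (simp add: fsm_def fun_diff_def right_diff_distrib)
  from II_add[OF IH this] show "f + fsm c (fw w) - NF (phi (f + fsm c (fw w))) \<in> II" using f
    by (simp add: phi_add Fset_fsm phi_fsm NF_add NF_sm algebra_simps)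
qed

text \<open>The relations hold in the model, so the ideal is contained in the kernel of
  \<open>phi\<close>; reduction to normal forms gives the converse. In effect this is the basis
  theorem for A.\<close>

lemma II_iff: "f \<in> Fset \<Longrightarrow> f \<in> II \<longleftrightarrow> phi f = 0"
  using II_phi NF_phi[of f] by auto

text \<open>The fibres of \<open>phi\<close> are the cosets of the ideal, hence the elements of the
  presented algebra.\<close>

definition Psi :: "('k gwt) \<Rightarrow> 'k fa set" where "Psi t = {q \<in> Fset. phi q = t}"

lemma fcoset_Psi: "p \<in> Fset \<Longrightarrow> fcoset II p = Psi (phi p)"
  by (auto simp: fcoset_def Psi_def fsub_eq II_iff Fset_diff phi_diff)

lemma NF_Psi: "NF t \<in> Psi t" by (simp add: Psi_def)

lemma Psi_iso: "kalg_iso tmul (sng 0 1) (\<lambda>c. pop [:c:]) (gwa a (shift_aut h0)) Psi"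
proof unfold_locales
  show "inj Psi"
  proof (rule injI)
    fix s t assume "Psi s = Psi t"
    then have "NF s \<in> Psi t" using NF_Psi[of s] by simp
    then show "s = t" by (simp add: Psi_def)
  qed
  have "fcoset II ` Fset = range Psi"
  proof (intro equalityI subsetI)
    fix C assume "C \<in> fcoset II ` Fset" then show "C \<in> range Psi" by (auto simp: fcoset_Psi)
  next
    fix C assume "C \<in> range Psi"
    then obtain t where "C = Psi t" by blast
    then have "C = fcoset II (NF t)" by (simp add: fcoset_Psi)
    then show "C \<in> fcoset II ` Fset" by simp
  qed
  then show "kcar (gwa a (shift_aut h0)) = range Psi" by (simp add: gwa_def Let_def)
  have P: "fcoset II p = Psi t" if "p \<in> Fset" "phi p = t" for p t using that fcoset_Psi by simp
  fix s t c
  \<comment> \<open>Operations on cosets are unions over representatives. These collapse because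
    every choice yields the same coset and the normal forms supply at least one choice.\<close>
  have U2: "(\<Union>p\<in>Psi s. \<Union>q\<in>Psi t. H p q) = C" if "\<And>p q. p \<in> Psi s \<Longrightarrow> q \<in> Psi t \<Longrightarrow> H p q = C"
    for H :: "'k fa \<Rightarrow> 'k fa \<Rightarrow> 'k fa set" and C
    using that NF_Psi[of s] NF_Psi[of t] by blast
  show "kadd (gwa a (shift_aut h0)) (Psi s) (Psi t) = Psi (s + t)"
    unfolding gwa_def Let_def kalg.simps by (rule U2) (auto simp: Psi_def fadd_eq phi_add Fset_add intro!: P[unfolded Psi_def])
  show "kmul (gwa a (shift_aut h0)) (Psi s) (Psi t) = Psi (s \<odot> t)"
    unfolding gwa_def Let_def kalg.simps by (rule U2) (auto simp: Psi_def phi_fmul Fset_fmul intro!: P[unfolded Psi_def])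
  show "kzero (gwa a (shift_aut h0)) = Psi 0"
    unfolding gwa_def Let_def kalg.simps by (rule P) (simp_all add: fzero_eq)
  have U1: "(\<Union>p\<in>Psi t. H p) = C" if "\<And>p. p \<in> Psi t \<Longrightarrow> H p = C" for H :: "'k fa \<Rightarrow> 'k fa set" and C
    using that NF_Psi[of t] by blast
  show "ksm (gwa a (shift_aut h0)) c (Psi t) = Psi (pop [:c:] t)"
    unfolding gwa_def Let_def kalg.simps by (rule U1) (auto simp: Psi_def phi_fsm Fset_fsm intro!: P[unfolded Psi_def])
qed

end

context gw0
begin

lemma hh_dim_gwa:
  assumes "qdim G.ksc (KZ n) (KB n) m"
  shows "hh_dim (gwa a (shift_aut h0)) n m"
  by (rule kalg_iso.hh_dim_if_qdim[OF Psi_iso G.qdim_hoch[OF assms]])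

end

theorem theorem1p2:
  fixes a :: "'k::{field_char_0,field_gcd} poly" and h0 :: 'k
  assumes "degree a \<ge> 1" and "h0 \<noteq> 0"
  defines "A \<equiv> gwa a (shift_aut h0)"
      and "n \<equiv> degree a"
      and "d \<equiv> degree (gcd a (pderiv a))"
  shows "(d = 0 \<longrightarrow> hh_dim A 0 1 \<and> hh_dim A 2 (n - 1) \<and> (\<forall>i. i \<noteq> 0 \<and> i \<noteq> 2 \<longrightarrow> hh_dim A i 0))
       \<and> (d \<ge> 1 \<longrightarrow> hh_dim A 0 1 \<and> hh_dim A 1 0 \<and> hh_dim A 2 (n - 1) \<and> (\<forall>i\<ge>3. hh_dim A i d))"
proof -
  interpret gw0 a h0 by unfold_locales (use assms in auto)
  have 0: "hh_dim A 0 1" unfolding A_def by (rule hh_dim_gwa[OF KH0])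
  have 1: "hh_dim A 1 0" unfolding A_def by (rule hh_dim_gwa[OF KH1])
  have 2: "hh_dim A 2 (n - 1)" unfolding A_def n_def by (rule hh_dim_gwa[OF KH2])
  have 3: "hh_dim A i d" if "i \<ge> 3" for i
  proof (cases "even i")
    case True
    then have "i \<ge> 4" using that by (cases "i = 3") auto
    then show ?thesis unfolding A_def d_def by (rule hh_dim_gwa[OF KH_even[OF True]])
  next
    case False
    show ?thesis unfolding A_def d_def by (rule hh_dim_gwa[OF KH_odd[OF False that]])
  qed
  have "hh_dim A i 0" if "d = 0" "i \<noteq> 0" "i \<noteq> 2" for i
  proof (cases "i = 1")
    case False
    then have "i \<ge> 3" using that by linarith
    then show ?thesis using 3 that(1) by metis
  qed (use 1 in simp)
  then show ?thesis using 0 1 2 3 by blast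
qed

end
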